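(* Let $H$ be a Hilbert space, $d_1,\dots,d_k\ge1$, and for each $i,j\in\{1,\dots,k\}$ let $u^{(i,j)}=(u^{(i,j)}_{(q,m)(p,l)})_{(q,m),(p,l)\in[d_i]\times[d_j]}$ be a unitary matrix such that the induced maps $t_{i,j}$ satisfy $t_{i,i}=\mathrm{id}$, $t_{j,i}=t_{i,j}^{-1}$ and the associativity condition $(t_{j,i}\otimes I_{E_l})(I_{E_j}\otimes t_{l,i})(t_{l,j}\otimes I_{E_i})=(I_{E_i}\otimes t_{l,j})(t_{l,i}\otimes I_{E_j})(I_{E_l}\otimes t_{j,i})$ for all $i,j,l$. Let $T^{(1)},\dots,T^{(k)}$ be row contractions on $H$, $T^{(i)}$ of length $d_i$, such that for all $i\neq j$ the pair $(T^{(i)},T^{(j)})$ $u^{(i,j)}$-doubly commutes. Then there exist a Hilbert space $K\supseteq H$ and row isometries $V^{(1)},\dots,V^{(k)}$ on $K$, $V^{(i)}$ of length $d_i$, such that for all $i\neq j$ the pair $(V^{(i)},V^{(j)})$ $u^{(i,j)}$-doubly commutes, and the representation of $X$ determined by the $V^{(i)}$ is a (minimal) regular isometric dilation of the representation determined by the $T^{(i)}$.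
   Context: $[m]=\{1,\dots,m\}$. $E_i$ is a Hilbert space of dimension $d_i$ with orthonormal basis $\{e^{(i)}_l\}_{l\in[d_i]}$ (a $C^*$-correspondence over $\mathbb C$). $t_{i,j}:E_i\otimes E_j\to E_j\otimes E_i$ is defined by $t_{i,j}(e^{(i)}_q\otimes e^{(j)}_m)=\sum_{(p,l)\in[d_i]\times[d_j]}u^{(i,j)}_{(q,m)(p,l)}\,e^{(j)}_l\otimes e^{(i)}_p$. $X$ is the product system over $\mathbb Z_+^k$ with $X(\mathbf n)=E_1^{\otimes n_1}\otimes\cdots\otimes E_k^{\otimes n_k}$, $X(\mathbf 0)=\mathbb C$, whose multiplication reorders factors via the $t_{i,j}$ (with $\theta_{\mathbf e_i,\mathbf e_j}=\mathrm{id}$ for $i\le j$ and $=t_{i,j}$ for $i>j$). A row contraction of length $n$ on $H$ is $T=(T_1,\dots,T_n)$, $T_i\in B(H)$, with $\sum_iT_iT_i^*\le I$; a row isometry is a row contraction with each $T_i$ an isometry. For a unitary $u$ of size $nm$ indexed by $[n]\times[m]$, row contractions $T$ (length $n$) and $S$ (length $m$) $u$-doubly commute if for all $q\in[n]$, $r\in[m]$: (a) $T_qS_r=\sum_{(p,l)\in[n]\times[m]}u_{(q,r)(p,l)}S_lT_p$ and (b) $S_r^*T_q=\sum_{(p,l)\in[n]\times[m]}u_{(q,l)(p,r)}T_pS_l^*$. A $k$-tuple of row contractions $T^{(i)}=(T^{(i)}_1,\dots,T^{(i)}_{d_i})$ satisfying (a) for all pairs determines a representation of $X$ by $T^{(i)}(e^{(i)}_l)=T^{(i)}_l$,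 extended linearly; for $\mathbf n\in\mathbb Z_+^k$, $\tilde T_{\mathbf n}:X(\mathbf n)\otimes H\to H$, $\tilde T_{\mathbf n}(\xi^{(1)}_1\otimes\cdots\otimes\xi^{(k)}_{n_k}\otimes h)=T^{(1)}(\xi^{(1)}_1)\cdots T^{(k)}(\xi^{(k)}_{n_k})h$, $\tilde T_{\mathbf 0}=I$; for $\mathbf n\in\mathbb Z^k$, $\mathbf n_+$ has entries $\max(n_i,0)$, $\mathbf n_-=\mathbf n_+-\mathbf n$, and $T(\mathbf n)=\tilde T_{\mathbf n_-}^*\tilde T_{\mathbf n_+}$. Representation $V$ on $K\supseteq H$ is a regular isometric dilation of $T$ if each $V^{(i)}$ is a row isometry, $H$ is invariant under all $V^{(i)*}_l$, and $(I_{X(\mathbf n_-)}\otimes P_H)V(\mathbf n)|_{X(\mathbf n_+)\otimes H}=T(\mathbf n)$ for all $\mathbf n\in\mathbb Z^k$; minimal if $K$ is the smallest closed subspace containing $H$ invariant under all $V^{(i)}_l$. *)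

theory Defs
  imports "HOL-Analysis.Analysis" "HOL-Library.Function_Algebras"
begin

text \<open>A complex inner product space: a real normed vector space with a compatible
complex scalar multiplication and a complex inner product (conjugate-linear in the
first argument) inducing the norm. A complex Hilbert space is such a type which is
moreover a complete metric space.\<close>

class complex_inner_space = real_normed_vector +
  fixes scaleC :: "complex \<Rightarrow> 'a \<Rightarrow> 'a"
    and cinner :: "'a \<Rightarrow> 'a \<Rightarrow> complex"
  assumes scaleC_add_right: "scaleC a (x + y) = scaleC a x + scaleC a y"
    and scaleC_add_left: "scaleC (a + b) x = scaleC a x + scaleC b x"
    and scaleC_scaleC: "scaleC a (scaleC b x) = scaleC (a * b) x"
    and scaleC_one: "scaleC 1 x = x"
    and scaleR_scaleC: "scaleR r x = scaleC (complex_of_real r) x"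
    and cinner_add_left: "cinner (x + y) z = cinner x z + cinner y z"
    and cinner_scaleC_left: "cinner (scaleC a x) y = cnj a * cinner x y"
    and cinner_commute: "cinner x y = cnj (cinner y x)"
    and cinner_norm: "cinner x x = complex_of_real ((norm x)\<^sup>2)"

record 'a ips =
  car :: "'a set"
  ip :: "'a \<Rightarrow> 'a \<Rightarrow> complex"
  sc :: "complex \<Rightarrow> 'a \<Rightarrow> 'a"

definition ipnorm :: "'a ips \<Rightarrow> 'a \<Rightarrow> real" where
  "ipnorm E x = sqrt (Re (ip E x x))"

definition bop :: "('a::ab_group_add) ips \<Rightarrow> ('a \<Rightarrow> 'a) \<Rightarrow> bool" where
  "bop E T \<longleftrightarrow> (\<forall>x\<in>car E. T x \<in> car E)
     \<and> (\<forall>x\<in>car E. \<forall>y\<in>car E. T (x + y) = T x + T y)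
     \<and> (\<forall>c. \<forall>x\<in>car E. T (sc E c x) = sc E c (T x))
     \<and> (\<exists>B. \<forall>x\<in>car E. ipnorm E (T x) \<le> B * ipnorm E x)"

definition adj :: "('a::ab_group_add) ips \<Rightarrow> ('a \<Rightarrow> 'a) \<Rightarrow> ('a \<Rightarrow> 'a)" where
  "adj E T = (THE A. (\<forall>y\<in>car E. A y \<in> car E) \<and> (\<forall>y. y \<notin> car E \<longrightarrow> A y = 0)
                 \<and> (\<forall>x\<in>car E. \<forall>y\<in>car E. ip E (T x) y = ip E x (A y)))"

definition positive_op :: "('a::ab_group_add) ips \<Rightarrow> ('a \<Rightarrow> 'a) \<Rightarrow> bool" where
  "positive_op E A \<longleftrightarrow> (\<forall>x\<in>car E. Im (ip E x (A x)) = 0 \<and> 0 \<le> Re (ip E x (A x)))"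

definition row_contraction :: "('a::ab_group_add) ips \<Rightarrow> nat \<Rightarrow> (nat \<Rightarrow> 'a \<Rightarrow> 'a) \<Rightarrow> bool" where
  "row_contraction E n T \<longleftrightarrow> (\<forall>i<n. bop E (T i))
     \<and> positive_op E (\<lambda>x. x - (\<Sum>i<n. T i (adj E (T i) x)))"

definition isometry :: "('a::ab_group_add) ips \<Rightarrow> ('a \<Rightarrow> 'a) \<Rightarrow> bool" where
  "isometry E V \<longleftrightarrow> bop E V \<and> (\<forall>x\<in>car E. ip E (V x) (V x) = ip E x x)"

definition row_isometry :: "('a::ab_group_add) ips \<Rightarrow> nat \<Rightarrow> (nat \<Rightarrow> 'a \<Rightarrow> 'a) \<Rightarrow> bool" where
  "row_isometry E n V \<longleftrightarrow> row_contraction E n V \<and> (\<forall>i<n. isometry E (V i))"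

definition unitary_mat :: "nat \<Rightarrow> nat \<Rightarrow> (nat \<times> nat \<Rightarrow> nat \<times> nat \<Rightarrow> complex) \<Rightarrow> bool" where
  "unitary_mat n m U \<longleftrightarrow>
     (\<forall>a\<in>{..<n}\<times>{..<m}. \<forall>b\<in>{..<n}\<times>{..<m}.
        (\<Sum>c\<in>{..<n}\<times>{..<m}. U a c * cnj (U b c)) = (if a = b then 1 else 0)
      \<and> (\<Sum>c\<in>{..<n}\<times>{..<m}. cnj (U c a) * U c b) = (if a = b then 1 else 0))"

definition doubly_commute ::
  "('a::ab_group_add) ips \<Rightarrow> (nat \<times> nat \<Rightarrow> nat \<times> nat \<Rightarrow> complex) \<Rightarrow> nat \<Rightarrow> nat
    \<Rightarrow> (nat \<Rightarrow> 'a \<Rightarrow> 'a) \<Rightarrow> (nat \<Rightarrow> 'a \<Rightarrow> 'a) \<Rightarrow> bool" where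
  "doubly_commute E U n m T S \<longleftrightarrow>
     (\<forall>q<n. \<forall>r<m. \<forall>x\<in>car E.
        T q (S r x) = (\<Sum>p<n. \<Sum>l<m. sc E (U (q, r) (p, l)) (S l (T p x))))
   \<and> (\<forall>q<n. \<forall>r<m. \<forall>x\<in>car E.
        adj E (S r) (T q x) = (\<Sum>p<n. \<Sum>l<m. sc E (U (q, l) (p, r)) (T p (adj E (S l) x))))"

text \<open>Elements of \<open>E_i \<otimes> E_j\<close> are coefficient functions \<open>v (q,m)\<close> w.r.t. the basis
\<open>e^{(i)}_q \<otimes> e^{(j)}_m\<close>; triple tensors likewise with triples.
\<open>tmap U di dj\<close> is \<open>t_{i,j}\<close>: \<open>e_q \<otimes> e_m \<mapsto> \<Sum> U_{(q,m)(p,l)} e_l \<otimes> e_p\<close>.\<close>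

definition tmap :: "(nat \<times> nat \<Rightarrow> nat \<times> nat \<Rightarrow> complex) \<Rightarrow> nat \<Rightarrow> nat
    \<Rightarrow> (nat \<times> nat \<Rightarrow> complex) \<Rightarrow> (nat \<times> nat \<Rightarrow> complex)" where
  "tmap U di dj v = (\<lambda>(l, p). if l < dj \<and> p < di
       then (\<Sum>q<di. \<Sum>m<dj. v (q, m) * U (q, m) (p, l)) else 0)"

definition supp2 :: "nat \<Rightarrow> nat \<Rightarrow> (nat \<times> nat \<Rightarrow> complex) \<Rightarrow> bool" where
  "supp2 a b v \<longleftrightarrow> (\<forall>x y. (a \<le> x \<or> b \<le> y) \<longrightarrow> v (x, y) = 0)"

definition supp3 :: "nat \<Rightarrow> nat \<Rightarrow> nat \<Rightarrow> (nat \<times> nat \<times> nat \<Rightarrow> complex) \<Rightarrow> bool" where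
  "supp3 a b c w \<longleftrightarrow> (\<forall>x y z. (a \<le> x \<or> b \<le> y \<or> c \<le> z) \<longrightarrow> w (x, y, z) = 0)"

definition tensI :: "((nat \<times> nat \<Rightarrow> complex) \<Rightarrow> (nat \<times> nat \<Rightarrow> complex))
    \<Rightarrow> (nat \<times> nat \<times> nat \<Rightarrow> complex) \<Rightarrow> (nat \<times> nat \<times> nat \<Rightarrow> complex)" where
  "tensI f w = (\<lambda>(a, b, c). f (\<lambda>(x, y). w (x, y, c)) (a, b))"

definition Itens :: "((nat \<times> nat \<Rightarrow> complex) \<Rightarrow> (nat \<times> nat \<Rightarrow> complex))
    \<Rightarrow> (nat \<times> nat \<times> nat \<Rightarrow> complex) \<Rightarrow> (nat \<times> nat \<times> nat \<Rightarrow> complex)" where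
  "Itens f w = (\<lambda>(a, b, c). f (\<lambda>(y, z). w (a, y, z)) (b, c))"

fun wordop :: "(nat \<Rightarrow> nat \<Rightarrow> 'a \<Rightarrow> 'a) \<Rightarrow> (nat \<times> nat) list \<Rightarrow> 'a \<Rightarrow> 'a" where
  "wordop W [] = id"
| "wordop W ((i, l) # r) = W i l \<circ> wordop W r"

text \<open>Basis vector \<open>e_{ws}\<close> of \<open>X(m) = E_1^{\<otimes> m_1} \<otimes> \<dots> \<otimes> E_k^{\<otimes> m_k}\<close>:
\<open>ws i\<close> lists the indices of the \<open>m_i\<close> factors from \<open>E_i\<close>.\<close>
definition valid_word :: "nat \<Rightarrow> (nat \<Rightarrow> nat) \<Rightarrow> (nat \<Rightarrow> nat) \<Rightarrow> (nat \<Rightarrow> nat list) \<Rightarrow> bool" where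
  "valid_word k d m ws \<longleftrightarrow> (\<forall>i<k. length (ws i) = m i \<and> set (ws i) \<subseteq> {..<d i})"

definition flat_word :: "nat \<Rightarrow> (nat \<Rightarrow> nat list) \<Rightarrow> (nat \<times> nat) list" where
  "flat_word k ws = concat (map (\<lambda>i. map (Pair i) (ws i)) [0..<k])"

definition l2seq :: "(nat \<Rightarrow> 'h::complex_inner_space) set" where
  "l2seq = {f. summable (\<lambda>n. (norm (f n))\<^sup>2)}"

definition l2ip :: "(nat \<Rightarrow> 'h::complex_inner_space) \<Rightarrow> (nat \<Rightarrow> 'h) \<Rightarrow> complex" where
  "l2ip f g = (\<Sum>n. cinner (f n) (g n))"

definition l2sc :: "complex \<Rightarrow> (nat \<Rightarrow> 'h::complex_inner_space) \<Rightarrow> (nat \<Rightarrow> 'h)" where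
  "l2sc c f = (\<lambda>n. scaleC c (f n))"

definition l2norm :: "(nat \<Rightarrow> 'h::complex_inner_space) \<Rightarrow> real" where
  "l2norm f = sqrt (\<Sum>n. (norm (f n))\<^sup>2)"

definition closed_l2_subspace :: "(nat \<Rightarrow> 'h::complex_inner_space) set \<Rightarrow> bool" where
  "closed_l2_subspace K \<longleftrightarrow> K \<subseteq> l2seq \<and> 0 \<in> K
     \<and> (\<forall>f\<in>K. \<forall>g\<in>K. f + g \<in> K) \<and> (\<forall>c. \<forall>f\<in>K. l2sc c f \<in> K)
     \<and> (\<forall>X f. (\<forall>n. X n \<in> K) \<and> f \<in> l2seq \<and> (\<lambda>n. l2norm (X n - f)) \<longlonglongrightarrow> 0 \<longrightarrow> f \<in> K)"

definition Hsp :: "('h::complex_inner_space) ips" where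
  "Hsp = \<lparr>car = UNIV, ip = cinner, sc = scaleC\<rparr>"

definition Ksp :: "(nat \<Rightarrow> 'h::complex_inner_space) set \<Rightarrow> (nat \<Rightarrow> 'h) ips" where
  "Ksp K = \<lparr>car = K, ip = l2ip, sc = l2sc\<rparr>"

text \<open>Embedding of H into \<open>l^2(\<nat>, H)\<close> as the 0-th coordinate; the orthogonal
projection onto its range is \<open>f \<mapsto> emb (f 0)\<close>.\<close>
definition emb :: "'h::complex_inner_space \<Rightarrow> (nat \<Rightarrow> 'h)" where
  "emb h = (\<lambda>n. if n = 0 then h else 0)"

end

theory Submission
  imports Defs
begin

text \<open>
  A single row contraction \<open>T = (T\<^sub>1, \<dots>, T\<^sub>d)\<close> is dilated by Popescu's construction: on the Fock
  space tensored with \<open>H\<close> let \<open>V\<^sub>l\<close> act on the vacuum component by \<open>T\<^sub>l\<close> together with the defect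
  operator \<open>(1 - T\<^sup>*T)\<^sup>1\<^sup>/\<^sup>2\<close>, and on all other components by creation. A row that doubly commutes
  with \<open>T\<close> lifts level by level to the Fock space through the flips \<open>t\<^sub>i\<^sub>j\<close>; it commutes with the
  defect operator because of double commutation, it stays row contractive (isometric) because the
  flips are unitary, and two lifted rows still doubly commute because of the associativity
  condition. Hence the rows can be dilated one after the other. The smallest invariant subspace \<open>K\<close>
  containing \<open>H\<close> is reducing by double commutation, and double commutation also moves each adjoint to
  the right in \<open>V\<^sub>\<beta>\<^sup>*V\<^sub>\<alpha>\<close> exactly as in \<open>T\<^sub>\<beta>\<^sup>*T\<^sub>\<alpha>\<close>, which gives regularity.
\<close>

subsection \<open>Complex inner product spaces\<close>

text \<open>Condition (b) is the obstacle to lifting: it involves adjoints, so the adjoint of a lift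
  must be known before it can be moved past another lift. It is again a lift, of the adjoint row
  along the partially conjugated matrix \<open>partial_adj\<close>, and the braid relation survives
  this replacement because the other matrix is invertible. Hence one recursion, one commutation
  lemma and one intertwining lemma serve both (a) and (b), and every system carries its adjoints
  \<open>B\<close> as data beside the operators \<open>A\<close>.

  The dilation has to live on square-summable sequences in \<open>H\<close>, whatever the number of
  rows, whereas each step adds a layer of sequences. The induction therefore runs on a single type:
  it starts from the given rows extended by zero, and a pairing function that fixes \<open>0\<close>
  flattens the two layers after each step. What it hands on is that the adjoints map coordinate 0
  into itself and act there as the given adjoints; regularity is derived from this and double
  commutation alone.\<close>

context complex_inner_space
begin

lemma cinner_add_right: "cinner x (y + z) = cinner x y + cinner x z"
  by (simp add: cinner_commute[of x] cinner_add_left)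

lemma cinner_scaleC_right: "cinner x (scaleC c y) = c * cinner x y"
  by (simp add: cinner_commute[of x] cinner_scaleC_left)

lemma Re_cinner_self: "Re (cinner x x) = (norm x)\<^sup>2"
  by (simp add: cinner_norm)

lemma norm_add_square: "(norm (x + y))\<^sup>2 = (norm x)\<^sup>2 + (norm y)\<^sup>2 + 2 * Re (cinner x y)"
proof -
  have "Re (cinner y x) = Re (cinner x y)"
    by (subst cinner_commute) simp
  then show ?thesis
    by (simp flip: Re_cinner_self add: cinner_add_left cinner_add_right)
qed

lemma norm_scaleC: "norm (scaleC c x) = cmod c * norm x"
proof -
  have "complex_of_real ((norm (scaleC c x))\<^sup>2) = (c * cnj c) * cinner x x"
    by (simp only: cinner_norm[symmetric] cinner_scaleC_left cinner_scaleC_right mult_ac)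
  also have "\<dots> = complex_of_real ((cmod c * norm x)\<^sup>2)"
    by (simp only: complex_norm_square[symmetric] cinner_norm power_mult_distrib of_real_mult of_real_power)
  finally have "(norm (scaleC c x))\<^sup>2 = (cmod c * norm x)\<^sup>2"
    using of_real_eq_iff by blast
  then show ?thesis
    by simp
qed

lemma norm_cinner_le: "cmod (cinner x y) \<le> norm x * norm y"
proof (cases "y = 0")
  case True
  have "cinner x 0 = 0"
    using cinner_add_right[of x 0 0] by simp
  with True show ?thesis by simp
next
  case False
  then have ny: "norm y > 0" by simp
  \<comment> \<open>The coefficient that makes \<open>x + scaleC a y\<close> orthogonal to
    \<open>y\<close>, so that its norm is minimal.\<close>
  define a where "a = - cinner y x / complex_of_real ((norm y)\<^sup>2)"
  have "0 \<le> (norm (x + scaleC a y))\<^sup>2" by simp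
  also have "\<dots> = (norm x)\<^sup>2 + (cmod a * norm y)\<^sup>2 + 2 * Re (a * cinner x y)"
    by (simp add: norm_add_square norm_scaleC cinner_scaleC_right)
  also have "a * cinner x y = - complex_of_real ((cmod (cinner x y))\<^sup>2 / (norm y)\<^sup>2)"
    unfolding a_def complex_norm_square of_real_divide by (simp add: cinner_commute[of y x])
  also have "cmod a = cmod (cinner x y) / (norm y)\<^sup>2"
    by (simp add: a_def norm_divide norm_power cinner_commute[of y x])
  finally have "0 \<le> (norm x)\<^sup>2 - (cmod (cinner x y))\<^sup>2 / (norm y)\<^sup>2"
    using ny by (simp add: power_divide field_simps power2_eq_square)
  then have "(cmod (cinner x y))\<^sup>2 \<le> (norm x * norm y)\<^sup>2"
    using ny by (simp add: field_simps)
  then show ?thesis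
    by (rule power2_le_imp_le) simp
qed

end

lemma bounded_bilinear_cinner: "bounded_bilinear (cinner :: 'a::complex_inner_space \<Rightarrow> 'a \<Rightarrow> complex)"
proof
  show "\<exists>K. \<forall>a b :: 'a. norm (cinner a b) \<le> norm a * norm b * K"
    by (rule exI[of _ 1]) (simp add: norm_cinner_le)
qed (simp_all add: cinner_add_left cinner_add_right cinner_scaleC_left cinner_scaleC_right
      scaleR_scaleC scaleR_conv_of_real)

lemma bounded_bilinear_scaleC: "bounded_bilinear (scaleC :: complex \<Rightarrow> 'a::complex_inner_space \<Rightarrow> 'a)"
proof
  show "\<exists>K. \<forall>a b. norm (scaleC a b :: 'a) \<le> norm a * norm b * K"
    by (rule exI[of _ 1]) (simp add: norm_scaleC)
qed (simp_all add: scaleC_add_left scaleC_add_right scaleC_scaleC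
      scaleR_scaleC scaleR_conv_of_real mult.commute)

interpretation cinner: bounded_bilinear cinner
  by (rule bounded_bilinear_cinner)

interpretation scaleC: bounded_bilinear scaleC
  by (rule bounded_bilinear_scaleC)

declare cinner.zero_left [simp] cinner.zero_right [simp] scaleC.zero_left [simp] scaleC.zero_right [simp]
declare scaleC_one [simp] scaleC_scaleC [simp]

lemma cinner_eqI: "(\<And>z. cinner x z = cinner y z) \<Longrightarrow> x = (y :: 'a::complex_inner_space)"
  using cinner_norm[of "x - y"] by (simp add: cinner.diff_left)

lemma cinner_eqI_right: "(\<And>z. cinner z x = cinner z y) \<Longrightarrow> x = (y :: 'a::complex_inner_space)"
  using cinner_norm[of "x - y"] by (simp add: cinner.diff_right)

section \<open>Complex-linear maps and pairs of adjoint operators\<close>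

definition clinear :: "('a::complex_inner_space \<Rightarrow> 'b::complex_inner_space) \<Rightarrow> bool" where
  "clinear A \<longleftrightarrow> (\<forall>x y. A (x + y) = A x + A y) \<and> (\<forall>c x. A (scaleC c x) = scaleC c (A x))"

lemma clinear_add: "clinear A \<Longrightarrow> A (x + y) = A x + A y"
  and clinear_scaleC: "clinear A \<Longrightarrow> A (scaleC c x) = scaleC c (A x)"
  by (auto simp: clinear_def)

lemma clinear_linear: "clinear A \<Longrightarrow> linear A"
  by (rule linearI) (simp_all add: clinear_def scaleR_scaleC)

lemma clinear_0: "clinear A \<Longrightarrow> A 0 = 0"
  by (simp add: clinear_linear linear_0)

lemma clinear_sum: "clinear A \<Longrightarrow> A (\<Sum>i\<in>I. f i) = (\<Sum>i\<in>I. A (f i))"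
  by (simp add: clinear_linear linear_sum)

text \<open>A relation between two given maps, possibly between different spaces: the operators
  constructed below come with an explicit candidate for the adjoint. The \<open>adj\<close> of the
  statement is matched with it only in the last part.\<close>

definition is_adj :: "('a::complex_inner_space \<Rightarrow> 'b::complex_inner_space) \<Rightarrow> ('b \<Rightarrow> 'a) \<Rightarrow> bool" where
  "is_adj A B \<longleftrightarrow> (\<forall>x y. cinner (A x) y = cinner x (B y))"

lemma is_adjD: "is_adj A B \<Longrightarrow> cinner (A x) y = cinner x (B y)"
  by (simp add: is_adj_def)

lemma is_adj_sym: "is_adj A B \<Longrightarrow> is_adj B A"
proof -
  assume "is_adj A B"
  then have "cinner x (A y) = cinner (B x) y" for x y
    using cinner_commute[of x "A y"] cinner_commute[of "B x" y] by (simp only: is_adj_def)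
  then show ?thesis by (simp only: is_adj_def simp_thms)
qed

text \<open>The inner product separates points, so a map with an adjoint is automatically linear.
  Linearity of most constructed operators is obtained in this way.\<close>

lemma is_adj_clinear: "is_adj A B \<Longrightarrow> clinear A"
proof -
  assume adj: "is_adj A B"
  have "A (x + y) = A x + A y" for x y
    by (rule cinner_eqI) (simp only: is_adjD[OF adj] cinner_add_left)
  moreover have "A (scaleC c x) = scaleC c (A x)" for c x
    by (rule cinner_eqI) (simp only: is_adjD[OF adj] cinner_scaleC_left)
  ultimately show ?thesis by (simp only: clinear_def simp_thms)
qed

lemma is_adj_clinear2: "is_adj A B \<Longrightarrow> clinear B"
  using is_adj_clinear is_adj_sym by blast

lemma is_adj_comp: "is_adj A B \<Longrightarrow> is_adj A' B' \<Longrightarrow> is_adj (\<lambda>x. A (A' x)) (\<lambda>x. B' (B x))"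
  by (simp add: is_adj_def)

lemma is_adj_sum: "(\<And>i. i \<in> I \<Longrightarrow> is_adj (A i) (B i)) \<Longrightarrow>
    is_adj (\<lambda>x. \<Sum>i\<in>I. A i x) (\<lambda>x. \<Sum>i\<in>I. B i x)"
  by (simp add: is_adj_def cinner.sum_left cinner.sum_right)

lemma is_adj_add: "is_adj A B \<Longrightarrow> is_adj A' B' \<Longrightarrow> is_adj (\<lambda>x. A x + A' x) (\<lambda>x. B x + B' x)"
  by (simp add: is_adj_def cinner_add_left cinner_add_right)

lemma is_adj_diff: "is_adj A B \<Longrightarrow> is_adj A' B' \<Longrightarrow> is_adj (\<lambda>x. A x - A' x) (\<lambda>x. B x - B' x)"
  by (simp add: is_adj_def cinner.diff_left cinner.diff_right)

lemma is_adj_scaleC: "is_adj A B \<Longrightarrow> is_adj (\<lambda>x. scaleC c (A x)) (\<lambda>x. scaleC (cnj c) (B x))"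
  by (simp add: is_adj_def cinner_scaleC_left cinner_scaleC_right)

lemma is_adj_id: "is_adj (\<lambda>x. x) (\<lambda>x. x)"
  by (simp add: is_adj_def)

lemma is_adj_unique: "is_adj A B \<Longrightarrow> is_adj A B' \<Longrightarrow> B = B'"
  unfolding is_adj_def by (metis cinner_eqI_right ext)

subsection \<open>The Riesz representation theorem and adjoints\<close>

text \<open>The vector is the minimiser of \<open>J\<close>. The parallelogram law makes a
  minimising sequence Cauchy, and the first variation at its limit \<open>z\<close> gives equality
  of real parts; replacing \<open>x\<close> by its multiple by \<open>\<i>\<close> gives the
  imaginary parts.\<close>

lemma riesz_representation:
  fixes \<phi> :: "'a::{complex_inner_space, complete_space} \<Rightarrow> complex"
  assumes add: "\<And>x y. \<phi> (x + y) = \<phi> x + \<phi> y"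
    and scale: "\<And>c x. \<phi> (scaleC c x) = c * \<phi> x"
    and bdd: "\<And>x. cmod (\<phi> x) \<le> B * norm x"
  shows "\<exists>z. \<forall>x. \<phi> x = cinner z x"
proof -
  define J where "J x = (norm x)\<^sup>2 - 2 * Re (\<phi> x)" for x
  have Jlow: "J x \<ge> - B\<^sup>2" for x
  proof -
    have "Re (\<phi> x) \<le> B * norm x"
      using bdd[of x] complex_Re_le_cmod[of "\<phi> x"] by linarith
    then have "J x \<ge> (norm x)\<^sup>2 - 2 * (B * norm x)" by (simp add: J_def)
    also have "(norm x)\<^sup>2 - 2 * (B * norm x) = (norm x - B)\<^sup>2 - B\<^sup>2"
      by (simp add: power2_eq_square algebra_simps)
    finally show ?thesis
      using zero_le_power2[of "norm x - B"] by linarith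
  qed
  define m where "m = Inf (range J)"
  have bb: "bdd_below (range J)"
    by (rule bdd_belowI2[where m="- B\<^sup>2"]) (rule Jlow)
  have mle: "m \<le> J x" for x
    unfolding m_def using bb by (auto intro: cInf_lower)
  have "\<exists>x. J x < m + 1 / real (Suc n)" for n
    using cInf_lessD[of "range J" "m + 1 / real (Suc n)"] by (auto simp: m_def)
  then obtain X where X: "\<And>n. J (X n) < m + 1 / real (Suc n)" by metis
  \<comment> \<open>The midpoint of \<open>x\<close> and \<open>y\<close> cannot lie below the
    infimum \<open>m\<close>; this turns the parallelogram law into a bound of the distance by the
    excess of \<open>J\<close> over \<open>m\<close>.\<close>
  have par: "(norm (x - y))\<^sup>2 \<le> 2 * (J x - m) + 2 * (J y - m)" for x y
  proof -
    have 1: "(norm (x + y))\<^sup>2 + (norm (x - y))\<^sup>2 = 2 * (norm x)\<^sup>2 + 2 * (norm y)\<^sup>2"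
      using norm_add_square[of x y] norm_add_square[of x "- y"] by (simp add: cinner.minus_right)
    have "m \<le> J (scaleC (1/2) (x + y))" by (rule mle)
    also have "\<dots> = (norm (x + y))\<^sup>2 / 4 - Re (\<phi> x) - Re (\<phi> y)"
      by (simp add: J_def norm_scaleC scale add power_mult_distrib power_divide norm_divide
          field_simps)
    finally show ?thesis using 1 by (simp add: J_def algebra_simps)
  qed
  have "Cauchy X"
  proof (rule CauchyI)
    fix e :: real assume e: "e > 0"
    obtain N where N: "4 / e\<^sup>2 < real N"
      using reals_Archimedean2 by blast
    have "norm (X i - X j) < e" if "i \<ge> N" "j \<ge> N" for i j
    proof -
      have a: "J (X i) - m < 1 / real (Suc N)" if "i \<ge> N" for i
      proof -
        have "1 / real (Suc i) \<le> 1 / real (Suc N)"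
          using that by (simp add: field_simps)
        then show ?thesis using X[of i] by linarith
      qed
      have "(norm (X i - X j))\<^sup>2 < 4 / real (Suc N)"
        using par[of "X i" "X j"] a[OF that(1)] a[OF that(2)] by simp
      also have "\<dots> < e\<^sup>2"
      proof -
        have "4 < real N * e\<^sup>2" using N e by (simp add: field_simps)
        also have "\<dots> \<le> real (Suc N) * e\<^sup>2" by (simp add: mult_right_mono)
        finally show ?thesis by (simp add: field_simps)
      qed
      finally show ?thesis using e power_less_imp_less_base[of _ 2 e] by auto
    qed
    then show "\<exists>M. \<forall>m\<ge>M. \<forall>n\<ge>M. norm (X m - X n) < e" by blast
  qed
  then obtain z where z: "X \<longlonglongrightarrow> z"
    using Cauchy_convergent_iff convergentD by blast
  interpret \<phi>: bounded_linear \<phi>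
    by (rule bounded_linear_intro[where K=B])
       (simp_all add: add scaleR_scaleC scale scaleR_conv_of_real bdd mult.commute)
  have "(\<lambda>n. J (X n)) \<longlonglongrightarrow> J z"
    unfolding J_def by (intro tendsto_intros \<phi>.tendsto z)
  moreover have "(\<lambda>n. J (X n)) \<longlonglongrightarrow> m"
  proof (rule tendsto_sandwich[where f = "\<lambda>_. m"])
    show "(\<lambda>n. m + 1 / real (Suc n)) \<longlonglongrightarrow> m"
      using tendsto_add[OF tendsto_const LIMSEQ_inverse_real_of_nat, of m]
      by (simp add: inverse_eq_divide)
  qed (use X mle in \<open>auto intro!: always_eventually less_imp_le\<close>)
  ultimately have Jz: "J z = m"
    using LIMSEQ_unique by blast
  have Reeq: "Re (cinner z x) = Re (\<phi> x)" for x
  proof (rule ccontr)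
    assume ne: "Re (cinner z x) \<noteq> Re (\<phi> x)"
    define a where "a = Re (cinner z x) - Re (\<phi> x)"
    have a: "a \<noteq> 0" using ne by (simp add: a_def)
    have ineq: "0 \<le> t\<^sup>2 * (norm x)\<^sup>2 + 2 * t * a" for t :: real
    proof -
      have "J z \<le> J (z + scaleC (complex_of_real t) x)"
        using mle Jz by simp
      then show ?thesis
        by (simp add: J_def norm_add_square norm_scaleC cinner_scaleC_right add scale a_def
            power_mult_distrib algebra_simps)
    qed
    show False
    proof (cases "x = 0")
      case True
      then show False using ineq[of "-a"] a not_real_square_gt_zero[of a] by simp
    next
      case False
      then have nx: "(norm x)\<^sup>2 > 0" by simp
      \<comment> \<open>The value of \<open>t\<close> that minimises the quadratic polynomial in
        \<open>ineq\<close>.\<close>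
      have "0 \<le> (- a / (norm x)\<^sup>2)\<^sup>2 * (norm x)\<^sup>2 + 2 * (- a / (norm x)\<^sup>2) * a"
        by (rule ineq)
      also have "\<dots> = - (a\<^sup>2 / (norm x)\<^sup>2)"
        using nx by (simp add: field_simps power2_eq_square)
      also have "\<dots> < 0" using a nx by simp
      finally show False by simp
    qed
  qed
  have "\<phi> x = cinner z x" for x
  proof (rule complex_eqI)
    show "Re (\<phi> x) = Re (cinner z x)" by (simp add: Reeq)
    show "Im (\<phi> x) = Im (cinner z x)"
      using Reeq[of "scaleC \<i> x"] by (simp add: cinner_scaleC_right scale)
  qed
  then show ?thesis by blast
qed

text \<open>Riesz representation of the functionals \<open>x \<mapsto> cinner y (A x)\<close>. It
  serves the given rows; the adjoints of constructed operators are written down explicitly.\<close>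

lemma adjoint_exists:
  fixes A :: "'a::{complex_inner_space, complete_space} \<Rightarrow> 'b::complex_inner_space"
  assumes lin: "clinear A" and bdd: "\<And>x. norm (A x) \<le> B * norm x"
  shows "\<exists>A'. is_adj A A'"
proof -
  have "\<exists>z. \<forall>x. cinner y (A x) = cinner z x" for y
  proof (rule riesz_representation)
    fix x
    have "cmod (cinner y (A x)) \<le> norm y * norm (A x)" by (rule norm_cinner_le)
    also have "\<dots> \<le> norm y * (B * norm x)" by (intro mult_left_mono bdd) simp
    finally show "cmod (cinner y (A x)) \<le> (norm y * B) * norm x" by (simp add: mult.assoc)
  qed (simp_all add: clinear_add[OF lin] clinear_scaleC[OF lin] cinner_add_right cinner_scaleC_right)
  then obtain A' where "\<And>y x. cinner y (A x) = cinner (A' y) x" by metis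
  then have "is_adj A' A" by (simp add: is_adj_def)
  then show ?thesis using is_adj_sym by blast
qed

subsection \<open>The Hilbert space of square-summable sequences as a type\<close>

lemma l2seq_add:
  assumes "f \<in> l2seq" "g \<in> l2seq"
  shows "(\<lambda>n. f n + g n) \<in> l2seq"
proof -
  have "summable (\<lambda>n. 2 * (norm (f n))\<^sup>2 + 2 * (norm (g n))\<^sup>2)"
    using assms by (auto simp: l2seq_def intro: summable_add summable_mult)
  moreover have "(norm (f n + g n))\<^sup>2 \<le> 2 * (norm (f n))\<^sup>2 + 2 * (norm (g n))\<^sup>2" for n
  proof -
    have "(norm (f n + g n))\<^sup>2 \<le> (norm (f n) + norm (g n))\<^sup>2"
      by (simp add: norm_triangle_ineq power_mono)
    also have "\<dots> \<le> 2 * (norm (f n))\<^sup>2 + 2 * (norm (g n))\<^sup>2"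
      using zero_le_power2[of "norm (f n) - norm (g n)"]
      by (simp add: power2_sum power2_diff)
    finally show ?thesis .
  qed
  ultimately show ?thesis
    unfolding l2seq_def by (auto intro: summable_comparison_test')
qed

lemma l2seq_scaleC: "f \<in> l2seq \<Longrightarrow> (\<lambda>n. scaleC c (f n)) \<in> l2seq"
  by (auto simp: l2seq_def norm_scaleC power_mult_distrib intro: summable_mult)

lemma l2seq_zero: "(\<lambda>n. 0) \<in> l2seq"
  by (simp add: l2seq_def)

lemma l2seq_diff:
  assumes "f \<in> l2seq" "g \<in> l2seq"
  shows "(\<lambda>n. f n - g n) \<in> l2seq"
  using l2seq_add[OF assms(1) l2seq_scaleC[OF assms(2), of "-1"]]
  by (simp add: scaleC.minus_left)

lemma summable_cinner:
  assumes "f \<in> l2seq" "g \<in> l2seq"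
  shows "summable (\<lambda>n. cinner (f n) (g n))"
proof -
  have "summable (\<lambda>n. (norm (f n))\<^sup>2 + (norm (g n))\<^sup>2)"
    using assms by (auto simp: l2seq_def intro: summable_add)
  moreover have "cmod (cinner (f n) (g n)) \<le> (norm (f n))\<^sup>2 + (norm (g n))\<^sup>2" for n
  proof -
    have "cmod (cinner (f n) (g n)) \<le> norm (f n) * norm (g n)" by (rule norm_cinner_le)
    also have "\<dots> \<le> (norm (f n))\<^sup>2 + (norm (g n))\<^sup>2"
      using zero_le_power2[of "norm (f n) - norm (g n)"]
        mult_nonneg_nonneg[OF norm_ge_zero[of "f n"] norm_ge_zero[of "g n"]]
      unfolding power2_diff by linarith
    finally show ?thesis .
  qed
  ultimately show ?thesis
    by (auto intro: summable_comparison_test')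
qed

lemma l2ip_self: "f \<in> l2seq \<Longrightarrow> l2ip f f = complex_of_real ((l2norm f)\<^sup>2)"
  by (simp add: l2ip_def l2norm_def cinner_norm l2seq_def suminf_nonneg suminf_of_real
      flip: of_real_power)

lemma sum_le_l2norm: "f \<in> l2seq \<Longrightarrow> (\<Sum>n<N. (norm (f n))\<^sup>2) \<le> (l2norm f)\<^sup>2"
  by (simp add: l2norm_def l2seq_def suminf_nonneg sum_le_suminf)

lemma l2seqI_bounded:
  assumes "\<And>N. (\<Sum>n<N. (norm (f n))\<^sup>2) \<le> b"
  shows "f \<in> l2seq" and "(l2norm f)\<^sup>2 \<le> b"
proof -
  have s: "summable (\<lambda>n. (norm (f n))\<^sup>2)"
    by (rule summableI_nonneg_bounded[where x = b]) (use assms in auto)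
  then show "f \<in> l2seq" by (simp add: l2seq_def)
  show "(l2norm f)\<^sup>2 \<le> b"
    using suminf_le_const[OF s, of b] assms by (simp add: l2norm_def suminf_nonneg[OF s])
qed

lemma l2norm_nonneg: "f \<in> l2seq \<Longrightarrow> 0 \<le> l2norm f"
  by (simp add: l2norm_def l2seq_def suminf_nonneg)

text \<open>Minkowski's inequality on finite sections, with a bound uniform in the length of the
  section.\<close>

lemma l2norm_triangle:
  assumes "f \<in> l2seq" "g \<in> l2seq"
  shows "l2norm (\<lambda>n. f n + g n) \<le> l2norm f + l2norm g"
proof (rule power2_le_imp_le)
  have *: "L2_set (\<lambda>n. norm (f n)) {..<N} \<le> l2norm f" if "f \<in> l2seq" for f :: "nat \<Rightarrow> 'a" and N
    unfolding L2_set_def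
    by (rule real_le_lsqrt) (simp_all add: sum_nonneg l2norm_nonneg sum_le_l2norm that)
  show "(l2norm (\<lambda>n. f n + g n))\<^sup>2 \<le> (l2norm f + l2norm g)\<^sup>2"
  proof (rule l2seqI_bounded(2))
    fix N
    have "L2_set (\<lambda>n. norm (f n + g n)) {..<N} \<le> L2_set (\<lambda>n. norm (f n) + norm (g n)) {..<N}"
      by (rule L2_set_mono) (simp_all add: norm_triangle_ineq)
    also have "\<dots> \<le> L2_set (\<lambda>n. norm (f n)) {..<N} + L2_set (\<lambda>n. norm (g n)) {..<N}"
      by (rule L2_set_triangle_ineq)
    also have "\<dots> \<le> l2norm f + l2norm g"
      using *[OF assms(1), of N] *[OF assms(2), of N] by simp
    finally have "(L2_set (\<lambda>n. norm (f n + g n)) {..<N})\<^sup>2 \<le> (l2norm f + l2norm g)\<^sup>2"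
      by (rule power_mono) simp
    then show "(\<Sum>n<N. (norm (f n + g n))\<^sup>2) \<le> (l2norm f + l2norm g)\<^sup>2"
      by (simp add: L2_set_def sum_nonneg)
  qed
  show "0 \<le> l2norm f + l2norm g" using assms by (simp add: l2norm_nonneg)
qed

text \<open>A type in place of the set \<open>l2seq\<close>, so that the space carrying one dilation
  is an instance of the same classes as \<open>H\<close> and the construction can be repeated on
  it.\<close>

typedef (overloaded) 'a ell2 = "l2seq :: (nat \<Rightarrow> 'a::complex_inner_space) set"
  morphisms coord Abs_ell2
  using l2seq_zero by blast

lemmas coord_Abs [simp] = Abs_ell2_inverse
declare coord [simp]

lemma ell2_eqI: "(\<And>n. coord f n = coord g n) \<Longrightarrow> f = g"
  by (metis coord_inject ext)

instantiation ell2 :: (complex_inner_space) complex_inner_space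
begin

definition zero_ell2 :: "'a ell2" where "0 = Abs_ell2 (\<lambda>n. 0)"
definition plus_ell2 :: "'a ell2 \<Rightarrow> 'a ell2 \<Rightarrow> 'a ell2"
  where "f + g = Abs_ell2 (\<lambda>n. coord f n + coord g n)"
definition minus_ell2 :: "'a ell2 \<Rightarrow> 'a ell2 \<Rightarrow> 'a ell2"
  where "f - g = Abs_ell2 (\<lambda>n. coord f n - coord g n)"
definition scaleC_ell2 :: "complex \<Rightarrow> 'a ell2 \<Rightarrow> 'a ell2"
  where "scaleC c f = Abs_ell2 (\<lambda>n. scaleC c (coord f n))"
definition uminus_ell2 :: "'a ell2 \<Rightarrow> 'a ell2" where "- f = scaleC (-1) (f :: 'a ell2)"
definition scaleR_ell2 :: "real \<Rightarrow> 'a ell2 \<Rightarrow> 'a ell2"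
  where "scaleR r f = scaleC (complex_of_real r) (f :: 'a ell2)"
definition cinner_ell2 :: "'a ell2 \<Rightarrow> 'a ell2 \<Rightarrow> complex"
  where "cinner f g = l2ip (coord f) (coord g)"
definition norm_ell2 :: "'a ell2 \<Rightarrow> real" where "norm f = l2norm (coord f)"
definition dist_ell2 :: "'a ell2 \<Rightarrow> 'a ell2 \<Rightarrow> real" where "dist f g = norm (f - g :: 'a ell2)"
definition sgn_ell2 :: "'a ell2 \<Rightarrow> 'a ell2" where "sgn f = inverse (norm f) *\<^sub>R (f :: 'a ell2)"
definition uniformity_ell2 :: "('a ell2 \<times> 'a ell2) filter"
  where "uniformity = (INF e\<in>{0 <..}. principal {(x, y :: 'a ell2). dist x y < e})"
definition open_ell2 :: "'a ell2 set \<Rightarrow> bool"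
  where "open U \<longleftrightarrow> (\<forall>x\<in>U. eventually (\<lambda>(x', y). x' = x \<longrightarrow> y \<in> U) (uniformity :: ('a ell2 \<times> 'a ell2) filter))"

lemma coord_zero: "coord (0 :: 'a ell2) n = 0"
  and coord_plus: "coord (f + g :: 'a ell2) n = coord f n + coord g n"
  and coord_minus: "coord (f - g :: 'a ell2) n = coord f n - coord g n"
  and coord_scaleC: "coord (scaleC c f :: 'a ell2) n = scaleC c (coord f n)"
  by (simp_all add: zero_ell2_def plus_ell2_def minus_ell2_def scaleC_ell2_def
      l2seq_zero l2seq_add l2seq_diff l2seq_scaleC)

lemma coord_uminus: "coord (- f :: 'a ell2) n = - coord f n"
  by (simp add: uminus_ell2_def coord_scaleC scaleC.minus_left)

lemma coord_scaleR: "coord (scaleR r f :: 'a ell2) n = scaleR r (coord f n)"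
  by (simp add: scaleR_ell2_def coord_scaleC scaleR_scaleC)

instance
proof
  fix f g h :: "'a ell2" and a b :: complex and r s :: real
  note coord_simps = coord_zero coord_plus coord_minus coord_scaleC coord_uminus coord_scaleR
  show "f + g + h = f + (g + h)" "f + g = g + f" "0 + f = f" "- f + f = 0" "f - g = f + - g"
    "scaleR r (f + g) = scaleR r f + scaleR r g" "scaleR (r + s) f = scaleR r f + scaleR s f"
    "scaleR r (scaleR s f) = scaleR (r * s) f" "scaleR 1 f = f"
    "scaleC a (f + g) = scaleC a f + scaleC a g" "scaleC (a + b) f = scaleC a f + scaleC b f"
    "scaleC a (scaleC b f) = scaleC (a * b) f" "scaleC 1 f = f"
    by (auto intro!: ell2_eqI simp: coord_simps algebra_simps scaleC_add_left scaleC_add_right)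
  show "scaleR r f = scaleC (complex_of_real r) f" by (simp add: scaleR_ell2_def)
  show "cinner (f + g) h = cinner f h + cinner g h"
    by (simp add: cinner_ell2_def l2ip_def coord_simps cinner_add_left suminf_add summable_cinner)
  show "cinner (scaleC a f) g = cnj a * cinner f g"
    by (simp add: cinner_ell2_def l2ip_def coord_simps cinner_scaleC_left suminf_mult summable_cinner)
  show "cinner f g = cnj (cinner g f)"
  proof -
    have "(\<lambda>n. cinner (coord g n) (coord f n)) sums cinner g f"
      by (simp add: cinner_ell2_def l2ip_def summable_cinner summable_sums)
    then have "(\<lambda>n. cnj (cinner (coord g n) (coord f n))) sums cnj (cinner g f)"
      by (simp add: sums_cnj)
    then show ?thesis
      by (simp add: cinner_ell2_def l2ip_def sums_iff flip: cinner_commute)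
  qed
  show "cinner f f = complex_of_real ((norm f)\<^sup>2)"
    by (simp add: cinner_ell2_def norm_ell2_def l2ip_self)
  show "(norm f = 0) = (f = 0)"
  proof
    assume "norm f = 0"
    then have "(\<Sum>n. (norm (coord f n))\<^sup>2) = 0" by (simp add: norm_ell2_def l2norm_def)
    then have "\<forall>n. (norm (coord f n))\<^sup>2 = 0"
      using suminf_eq_zero_iff[of "\<lambda>n. (norm (coord f n))\<^sup>2"] coord[of f]
      by (simp add: l2seq_def)
    then show "f = 0" by (auto intro: ell2_eqI simp: coord_simps)
  qed (simp add: norm_ell2_def l2norm_def coord_simps)
  show "norm (f + g) \<le> norm f + norm g"
    by (simp add: norm_ell2_def plus_ell2_def l2seq_add l2norm_triangle)
  show "norm (scaleR r f) = \<bar>r\<bar> * norm f"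
    using coord[of f]
    by (simp add: norm_ell2_def l2norm_def coord_simps power_mult_distrib suminf_mult l2seq_def
        real_sqrt_mult)
qed (simp_all add: dist_ell2_def sgn_ell2_def uniformity_ell2_def open_ell2_def)

end

lemmas coord_simps [simp] = coord_zero coord_plus coord_minus coord_scaleC coord_uminus coord_scaleR

lemma coord_sum [simp]: "coord (\<Sum>i\<in>I. f i) n = (\<Sum>i\<in>I. coord (f i) n)"
  by (induction I rule: infinite_finite_induct) auto

lemma norm_ell2_square: "(norm (f :: 'a::complex_inner_space ell2))\<^sup>2 = (\<Sum>n. (norm (coord f n))\<^sup>2)"
  using coord[of f] by (simp add: norm_ell2_def l2norm_def l2seq_def suminf_nonneg)

lemma sums_norm_ell2: "(\<lambda>n. (norm (coord f n))\<^sup>2) sums (norm f)\<^sup>2"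
  using coord[of f] by (simp add: norm_ell2_square l2seq_def summable_sums)

lemma sums_cinner_ell2: "(\<lambda>n. cinner (coord f n) (coord g n)) sums cinner f g"
  by (simp add: cinner_ell2_def l2ip_def summable_cinner summable_sums)

lemma norm_coord_le: "norm (coord f n) \<le> norm f"
proof (rule power2_le_imp_le)
  have "(norm (coord f n))\<^sup>2 \<le> (\<Sum>m<Suc n. (norm (coord f m))\<^sup>2)"
    by (simp add: sum_nonneg)
  also have "\<dots> \<le> (norm f)\<^sup>2" by (simp only: norm_ell2_def sum_le_l2norm coord)
  finally show "(norm (coord f n))\<^sup>2 \<le> (norm f)\<^sup>2" .
qed simp

lemma bounded_linear_coord: "bounded_linear (\<lambda>f. coord f n)"
  by (rule bounded_linear_intro[where K = 1]) (simp_all add: norm_coord_le)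

text \<open>The limit is taken coordinatewise. The Cauchy estimate bounds every finite section of
  \<open>X m - X m'\<close>; the bound persists as \<open>m'\<close> grows, which yields both
  square-summability of the limit and convergence in norm.\<close>

instance ell2 :: ("{complex_inner_space, complete_space}") complete_space
proof
  fix X :: "nat \<Rightarrow> 'a ell2"
  assume X: "Cauchy X"
  have "convergent (\<lambda>m. coord (X m) n)" for n
    using Cauchy_convergent[OF bounded_linear.Cauchy[OF bounded_linear_coord X]] .
  then obtain g where g: "\<And>n. (\<lambda>m. coord (X m) n) \<longlonglongrightarrow> g n"
    unfolding convergent_def by metis
  have key: "\<exists>M. \<forall>m\<ge>M. (\<lambda>n. coord (X m) n - g n) \<in> l2seq \<and> (l2norm (\<lambda>n. coord (X m) n - g n))\<^sup>2 \<le> e\<^sup>2"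
    if e: "e > 0" for e :: real
  proof -
    obtain M where M: "\<And>m m'. m \<ge> M \<Longrightarrow> m' \<ge> M \<Longrightarrow> norm (X m - X m') < e"
      using CauchyD[OF X e] by blast
    have b: "(\<Sum>n<N. (norm (coord (X m) n - g n))\<^sup>2) \<le> e\<^sup>2" if m: "m \<ge> M" for m N
    proof (rule Lim_bounded)
      show "(\<lambda>m'. \<Sum>n<N. (norm (coord (X m) n - coord (X m') n))\<^sup>2) \<longlonglongrightarrow>
          (\<Sum>n<N. (norm (coord (X m) n - g n))\<^sup>2)"
        by (intro tendsto_intros g)
      show "\<forall>m'\<ge>M. (\<Sum>n<N. (norm (coord (X m) n - coord (X m') n))\<^sup>2) \<le> e\<^sup>2"
      proof (intro allI impI)
        fix m' assume m': "m' \<ge> M"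
        have "(\<Sum>n<N. (norm (coord (X m - X m') n))\<^sup>2) \<le> (norm (X m - X m'))\<^sup>2"
          by (simp only: norm_ell2_def sum_le_l2norm coord)
        also have "\<dots> \<le> e\<^sup>2"
          using M[OF m m'] by (simp add: power_mono less_imp_le)
        finally show "(\<Sum>n<N. (norm (coord (X m) n - coord (X m') n))\<^sup>2) \<le> e\<^sup>2" by simp
      qed
    qed
    show ?thesis
      by (rule exI[of _ M]) (use l2seqI_bounded[OF b] in blast)
  qed
  obtain M where M: "(\<lambda>n. coord (X M) n - g n) \<in> l2seq"
    using key[of 1] by auto
  have gl: "g \<in> l2seq"
    using l2seq_diff[OF coord[of "X M"] M] by simp
  have "X \<longlonglongrightarrow> Abs_ell2 g"
  proof (rule LIMSEQ_I)
    fix e :: real assume e: "e > 0"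
    then obtain M where M: "\<And>m. m \<ge> M \<Longrightarrow> (l2norm (\<lambda>n. coord (X m) n - g n))\<^sup>2 \<le> (e/2)\<^sup>2"
      using key[of "e/2"] by auto
    have "norm (X m - Abs_ell2 g) < e" if "m \<ge> M" for m
    proof -
      have "coord (X m - Abs_ell2 g) = (\<lambda>n. coord (X m) n - g n)"
        using gl by (auto simp: fun_eq_iff)
      then have "(norm (X m - Abs_ell2 g))\<^sup>2 \<le> (e/2)\<^sup>2"
        using M[OF that] by (simp add: norm_ell2_def)
      then have "norm (X m - Abs_ell2 g) \<le> e / 2"
        by (rule power2_le_imp_le) (use e in simp)
      then show ?thesis using e by simp
    qed
    then show "\<exists>no. \<forall>n\<ge>no. norm (X n - Abs_ell2 g) < e" by blast
  qed
  then show "convergent X" by (auto simp: convergent_def)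
qed

text \<open>\<open>single 0\<close> is the embedding of \<open>H\<close> into a dilation space; its
  adjoint, reading off coordinate 0, plays the role of the projection onto \<open>H\<close>.\<close>

definition single :: "nat \<Rightarrow> 'a::complex_inner_space \<Rightarrow> 'a ell2" where
  "single m h = Abs_ell2 (\<lambda>n. if n = m then h else 0)"

lemma coord_single: "coord (single m h) n = (if n = m then h else 0)"
proof -
  have "(\<lambda>n. if n = m then h else 0) \<in> l2seq"
    unfolding l2seq_def mem_Collect_eq by (rule summable_finite[of "{m}"]) auto
  then show ?thesis by (simp add: single_def)
qed

lemma is_adj_single: "is_adj (single m) (\<lambda>f. coord f m)"
  unfolding is_adj_def
proof (intro allI)
  fix h and f :: "'a ell2"
  have "(\<lambda>n. cinner (coord (single m h) n) (coord f n)) sums (\<Sum>n\<in>{m}. cinner (coord (single m h) n) (coord f n))"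
    by (rule sums_finite) (auto simp: coord_single)
  then show "cinner (single m h) f = cinner h (coord f m)"
    using sums_unique2[OF sums_cinner_ell2[of "single m h" f]] by (simp add: coord_single)
qed

lemma clinear_single: "clinear (single m)"
  using is_adj_single by (rule is_adj_clinear)

lemma norm_single [simp]: "norm (single m h) = norm h"
proof -
  have "cinner (single m h) (single m h) = cinner h h"
    by (simp add: is_adjD[OF is_adj_single] coord_single)
  then show ?thesis by (simp add: cinner_norm flip: of_real_power)
qed

lemma norm_square_finite_support:
  assumes "\<And>n. n \<ge> N \<Longrightarrow> coord f n = 0"
  shows "(norm f)\<^sup>2 = (\<Sum>n<N. (norm (coord f n))\<^sup>2)"
proof -
  have "(\<lambda>n. (norm (coord f n))\<^sup>2) sums (\<Sum>n<N. (norm (coord f n))\<^sup>2)"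
    by (rule sums_finite) (use assms in auto)
  then show ?thesis using sums_unique2 sums_norm_ell2 by blast
qed

subsection \<open>The square root of one minus a contraction\<close>

text \<open>If \<open>1 - Z\<close> squares to \<open>1 - P\<close>, then
  \<open>Z = (P + Z Z) / 2\<close>; the iteration approximates this fixed point from
  \<open>0\<close>. Each iterate is a polynomial in \<open>P\<close>, so it commutes with every
  linear map that commutes with \<open>P\<close>.\<close>

primrec sqrt_iter :: "('a::real_vector \<Rightarrow> 'a) \<Rightarrow> nat \<Rightarrow> 'a \<Rightarrow> 'a" where
  "sqrt_iter P 0 x = 0"
| "sqrt_iter P (Suc n) x = (1/2) *\<^sub>R (P x + sqrt_iter P n (sqrt_iter P n x))"

lemma sqrt_iter_commute:
  assumes "linear C" "\<And>x. C (P x) = P (C x)"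
  shows "C (sqrt_iter P n x) = sqrt_iter P n (C x)"
  by (induction n arbitrary: x) (simp_all add: assms linear_0 linear_cmul linear_add)

lemma linear_sqrt_iter: "linear P \<Longrightarrow> linear (sqrt_iter P n)"
proof (induction n)
  case 0
  then show ?case by (auto intro: linearI)
next
  case (Suc n)
  then show ?case
    by (intro linearI) (simp_all add: linear_add linear_cmul algebra_simps)
qed

text \<open>The same iteration for the scalar contraction 1; it majorises the operator iteration.\<close>

primrec sqrt_bound :: "nat \<Rightarrow> real" where
  "sqrt_bound 0 = 0"
| "sqrt_bound (Suc n) = (1 + (sqrt_bound n)\<^sup>2) / 2"

lemma sqrt_bound_bounds: "0 \<le> sqrt_bound n" "sqrt_bound n \<le> 1" "sqrt_bound n \<le> sqrt_bound (Suc n)"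
proof -
  have "0 \<le> sqrt_bound n \<and> sqrt_bound n \<le> 1" for n
    by (induction n) (simp_all add: power_le_one)
  then show "0 \<le> sqrt_bound n" "sqrt_bound n \<le> 1" by auto
  show "sqrt_bound n \<le> sqrt_bound (Suc n)"
    using zero_le_power2[of "1 - sqrt_bound n"] by (simp add: power2_diff)
qed

declare sqrt_iter.simps(2) [simp del] sqrt_bound.simps(2) [simp del]

text \<open>Successive iterates commute, so half the difference of their squares is half their sum
  applied to their difference. The numbers \<open>sqrt_bound n\<close> satisfy the same identity,
  and both estimates follow by induction.\<close>

lemma norm_sqrt_iter_le:
  fixes P :: "'a::real_normed_vector \<Rightarrow> 'a"
  assumes lin: "linear P" and contr: "\<And>x. norm (P x) \<le> norm x"
  shows "norm (sqrt_iter P n x) \<le> sqrt_bound n * norm x"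
    and "norm (sqrt_iter P (Suc n) x - sqrt_iter P n x) \<le> (sqrt_bound (Suc n) - sqrt_bound n) * norm x"
proof -
  note y = sqrt_bound_bounds
  let ?Y = "sqrt_iter P"
  note linY = linear_sqrt_iter[OF lin]
  have commP: "P (?Y n x) = ?Y n (P x)" for n x
    using sqrt_iter_commute[of P P] lin by simp
  have comm: "?Y m (?Y n x) = ?Y n (?Y m x)" for m n x
    using sqrt_iter_commute[of "?Y m" P] linY commP by simp
  have bd: "norm (?Y n x) \<le> sqrt_bound n * norm x" for n x
  proof (induction n arbitrary: x)
    case 0
    then show ?case by simp
  next
    case (Suc n)
    have "norm (?Y n (?Y n x)) \<le> sqrt_bound n * (sqrt_bound n * norm x)"
      using Suc[of "?Y n x"] mult_left_mono[OF Suc[of x] y(1)[of n]] by linarith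
    then have "norm (P x + ?Y n (?Y n x)) \<le> norm x + sqrt_bound n * (sqrt_bound n * norm x)"
      using norm_triangle_ineq[of "P x" "?Y n (?Y n x)"] contr[of x] by linarith
    moreover have "norm (?Y (Suc n) x) = norm (P x + ?Y n (?Y n x)) / 2"
      by (simp add: sqrt_iter.simps(2) del: scaleR_add_right)
    ultimately show ?case by (simp add: sqrt_bound.simps(2) power2_eq_square algebra_simps)
  qed
  then show "norm (sqrt_iter P n x) \<le> sqrt_bound n * norm x" .
  have "norm (?Y (Suc n) x - ?Y n x) \<le> (sqrt_bound (Suc n) - sqrt_bound n) * norm x" for n x
  proof (induction n arbitrary: x)
    case 0
    then show ?case using contr[of x] by (simp add: sqrt_iter.simps(2) sqrt_bound.simps(2))
  next
    case (Suc n)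
    define z where "z = ?Y (Suc n) x - ?Y n x"
    have nz: "norm z \<le> (sqrt_bound (Suc n) - sqrt_bound n) * norm x" unfolding z_def by (rule Suc)
    have "?Y (Suc (Suc n)) x - ?Y (Suc n) x
        = (1/2) *\<^sub>R (?Y (Suc n) (?Y (Suc n) x) - ?Y n (?Y n x))"
      by (simp only: sqrt_iter.simps(2)[of P "Suc n"] sqrt_iter.simps(2)[of P n x] flip: scaleR_diff_right) simp
    also have "?Y (Suc n) (?Y (Suc n) x) - ?Y n (?Y n x) = ?Y (Suc n) z + ?Y n z"
      using comm[of "Suc n" n x] by (simp add: z_def linear_diff[OF linY])
    finally have "norm (?Y (Suc (Suc n)) x - ?Y (Suc n) x) = norm (?Y (Suc n) z + ?Y n z) / 2"
      by simp
    also have "\<dots> \<le> (sqrt_bound (Suc n) * norm z + sqrt_bound n * norm z) / 2"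
      using bd[of "Suc n" z] bd[of n z] norm_triangle_ineq[of "?Y (Suc n) z" "?Y n z"]
      by (intro divide_right_mono) (auto intro: order_trans)
    also have "\<dots> = ((sqrt_bound (Suc n) + sqrt_bound n) / 2) * norm z" by (simp add: algebra_simps)
    also have "\<dots> \<le> ((sqrt_bound (Suc n) + sqrt_bound n) / 2) * ((sqrt_bound (Suc n) - sqrt_bound n) * norm x)"
      using y(1)[of n] y(1)[of "Suc n"] by (intro mult_left_mono nz) simp
    also have "(sqrt_bound (Suc n) + sqrt_bound n) / 2 * ((sqrt_bound (Suc n) - sqrt_bound n) * norm x)
        = (((sqrt_bound (Suc n))\<^sup>2 - (sqrt_bound n)\<^sup>2) / 2) * norm x"
      by (simp add: power2_eq_square field_simps)
    also have "((sqrt_bound (Suc n))\<^sup>2 - (sqrt_bound n)\<^sup>2) / 2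
        = sqrt_bound (Suc (Suc n)) - sqrt_bound (Suc n)"
    proof -
      have "(a - b) / 2 = c - e" if "c = (1 + a) / 2" "e = (1 + b) / 2" for a b c e :: real
        using that by (simp add: field_simps)
      then show ?thesis using sqrt_bound.simps(2) by blast
    qed
    finally show ?case .
  qed
  then show "norm (sqrt_iter P (Suc n) x - sqrt_iter P n x) \<le> (sqrt_bound (Suc n) - sqrt_bound n) * norm x" .
qed

text \<open>The numbers \<open>sqrt_bound n\<close> increase and stay below or at 1, so their
  differences make the iterates pointwise Cauchy; with \<open>Z\<close> their limit, the root is
  \<open>1 - Z\<close>. The commutation clause covers every bounded \<open>C\<close>, self-adjoint
  or not, since it will be applied to operators built from another row.\<close>

lemma sqrt_one_minus_contraction:
  fixes P :: "'a::{complex_inner_space, complete_space} \<Rightarrow> 'a"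
  assumes sa: "is_adj P P" and contr: "\<And>x. norm (P x) \<le> norm x"
  shows "\<exists>R. is_adj R R \<and> (\<forall>x. R (R x) = x - P x) \<and>
      (\<forall>C. bounded_linear C \<longrightarrow> (\<forall>x. C (P x) = P (C x)) \<longrightarrow> (\<forall>x. C (R x) = R (C x)))"
proof -
  note y = sqrt_bound_bounds
  let ?Y = "sqrt_iter P"
  have lin: "linear P" using sa is_adj_clinear clinear_linear by blast
  note linY = linear_sqrt_iter[OF lin]
  note bd = norm_sqrt_iter_le[OF lin contr]
  have bd1: "norm (?Y n x) \<le> norm x" for n x
    using bd(1)[of n x] mult_right_mono[OF y(2)[of n], of "norm x"] by simp
  have incy: "incseq sqrt_bound" using y(3) by (simp add: incseq_SucI)
  have convy: "convergent sqrt_bound"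
    by (rule Bseq_mono_convergent)
       (use y(1,2) incy in \<open>auto intro!: BseqI'[where K = 1] simp: incseq_def\<close>)
  have diffY: "norm (?Y (m + j) x - ?Y m x) \<le> (sqrt_bound (m + j) - sqrt_bound m) * norm x" for m j x
  proof (induction j)
    case 0
    then show ?case by simp
  next
    case (Suc j)
    have "norm (?Y (m + Suc j) x - ?Y m x)
        \<le> norm (?Y (Suc (m + j)) x - ?Y (m + j) x) + norm (?Y (m + j) x - ?Y m x)"
      using norm_triangle_ineq[of "?Y (Suc (m + j)) x - ?Y (m + j) x" "?Y (m + j) x - ?Y m x"]
      by simp
    also have "\<dots> \<le> (sqrt_bound (Suc (m + j)) - sqrt_bound (m + j)) * norm x + (sqrt_bound (m + j) - sqrt_bound m) * norm x"
      by (intro add_mono bd(2) Suc)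
    finally show ?case by (simp add: algebra_simps)
  qed
  have "convergent (\<lambda>n. ?Y n x)" for x
  proof (rule Cauchy_convergent, rule CauchyI)
    fix e :: real assume e: "e > 0"
    \<comment> \<open>Adding 1 to the norm covers \<open>x = 0\<close>.\<close>
    have "e / (norm x + 1) > 0" using e by (simp add: add_nonneg_pos)
    from CauchyD[OF convergent_Cauchy[OF convy] this]
    obtain M where "\<forall>m\<ge>M. \<forall>n\<ge>M. norm (sqrt_bound m - sqrt_bound n) < e / (norm x + 1)"
      by (elim exE)
    then have M: "norm (sqrt_bound m - sqrt_bound n) < e / (norm x + 1)" if "m \<ge> M" "n \<ge> M" for m n
      using that by simp
    have half: "norm (?Y n x - ?Y m x) < e" if nm: "n \<ge> m" and mM: "m \<ge> M" for m n
    proof -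
      obtain j where j: "n = m + j" using le_Suc_ex[OF nm] by blast
      have "norm (?Y n x - ?Y m x) \<le> (sqrt_bound n - sqrt_bound m) * norm x" unfolding j by (rule diffY)
      also have "\<dots> \<le> (sqrt_bound n - sqrt_bound m) * (norm x + 1)"
        using incseqD[OF incy nm] by (intro mult_left_mono) simp_all
      also have "\<dots> < e"
      proof -
        have "norm (sqrt_bound n - sqrt_bound m) < e / (norm x + 1)"
          using M nm mM by simp
        then have "sqrt_bound n - sqrt_bound m < e / (norm x + 1)"
          unfolding real_norm_def by linarith
        then show ?thesis by (simp only: pos_less_divide_eq add_nonneg_pos[OF norm_ge_zero zero_less_one])
      qed
      finally show ?thesis .
    qed
    have "norm (?Y m x - ?Y n x) < e" if "m \<ge> M" "n \<ge> M" for m n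
      using half[of m n] half[of n m] that norm_minus_commute[of "?Y m x" "?Y n x"] nat_le_linear[of m n]
      by argo
    then show "\<exists>M. \<forall>m\<ge>M. \<forall>n\<ge>M. norm (?Y m x - ?Y n x) < e" by blast
  qed
  then obtain Z where Z: "\<And>x. (\<lambda>n. ?Y n x) \<longlonglongrightarrow> Z x"
    unfolding convergent_def by metis
  \<comment> \<open>Pointwise limit of a product: the iterates are contractions uniformly in
    \<open>n\<close>, so the inner one may be replaced by its limit.\<close>
  have ZZ: "(\<lambda>n. ?Y n (?Y n x)) \<longlonglongrightarrow> Z (Z x)" for x
  proof -
    have "(\<lambda>n. ?Y n (?Y n x - Z x)) \<longlonglongrightarrow> 0"
    proof (rule Lim_null_comparison)
      show "\<forall>\<^sub>F n in sequentially. norm (?Y n (?Y n x - Z x)) \<le> norm (?Y n x - Z x)"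
        using bd1 by simp
      show "(\<lambda>n. norm (?Y n x - Z x)) \<longlonglongrightarrow> 0"
        using tendsto_norm_zero[OF LIM_zero[OF Z]] .
    qed
    from tendsto_add[OF this Z[of "Z x"]] show ?thesis
      by (simp add: linear_diff[OF linY])
  qed
  have Zeq: "Z x = (1/2) *\<^sub>R (P x + Z (Z x))" for x
  proof -
    have "(\<lambda>n. ?Y (Suc n) x) \<longlonglongrightarrow> Z x"
      using LIMSEQ_Suc[OF Z] .
    moreover have "(\<lambda>n. ?Y (Suc n) x) \<longlonglongrightarrow> (1/2) *\<^sub>R (P x + Z (Z x))"
      unfolding sqrt_iter.simps by (intro tendsto_intros ZZ)
    ultimately show ?thesis using LIMSEQ_unique by blast
  qed
  have saY: "is_adj (?Y n) (?Y n)" for n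
  proof (induction n)
    case 0
    then show ?case by (simp add: is_adj_def)
  next
    case (Suc n)
    from is_adj_scaleC[OF is_adj_add[OF sa is_adj_comp[OF Suc Suc]], of "1/2"]
    show ?case by (simp add: is_adj_def scaleR_scaleC sqrt_iter.simps(2))
  qed
  have saZ: "is_adj Z Z"
    unfolding is_adj_def
  proof (intro allI)
    fix x z
    have "(\<lambda>n. cinner (?Y n x) z) \<longlonglongrightarrow> cinner (Z x) z"
      by (intro cinner.tendsto Z tendsto_const)
    moreover have "(\<lambda>n. cinner x (?Y n z)) \<longlonglongrightarrow> cinner x (Z z)"
      by (intro cinner.tendsto Z tendsto_const)
    ultimately show "cinner (Z x) z = cinner x (Z z)"
      unfolding is_adjD[OF saY] using LIMSEQ_unique by blast
  qed
  then have linZ: "linear Z" using is_adj_clinear clinear_linear by blast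
  have CZ: "C (Z x) = Z (C x)" if C: "bounded_linear C" "\<forall>x. C (P x) = P (C x)" for C x
  proof -
    have "(\<lambda>n. C (?Y n x)) \<longlonglongrightarrow> C (Z x)"
      by (intro bounded_linear.tendsto[OF C(1)] Z)
    then have "(\<lambda>n. ?Y n (C x)) \<longlonglongrightarrow> C (Z x)"
      using sqrt_iter_commute[of C P] C by (simp add: bounded_linear.linear)
    then show ?thesis using Z LIMSEQ_unique by blast
  qed
  show ?thesis
  proof (intro exI conjI allI impI)
    show "is_adj (\<lambda>x. x - Z x) (\<lambda>x. x - Z x)"
      by (rule is_adj_diff[OF is_adj_id saZ])
    show "(x - Z x) - Z (x - Z x) = x - P x" for x
    proof -
      have "2 *\<^sub>R Z x = P x + Z (Z x)"
        by (subst Zeq) simp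
      then show ?thesis by (simp add: linear_diff[OF linZ] scaleR_2 algebra_simps)
    qed
    show "C (x - Z x) = C x - Z (C x)" if "bounded_linear C" "\<forall>x. C (P x) = P (C x)" for C x
      using CZ[OF that] by (simp add: linear_diff[OF bounded_linear.linear[OF that(1)]])
  qed
qed

subsection \<open>Rows of operators and twisted commutation\<close>

type_synonym cmat = "nat \<times> nat \<Rightarrow> nat \<times> nat \<Rightarrow> complex"

text \<open>The row is read as one operator on the \<open>n\<close>-fold direct sum, whose elements
  are the tuples \<open>x\<close>. This form passes to lifts and limits without mention of adjoints;
  \<open>row_contractive_iff_adjoint\<close> ties it to the form used in the statement.\<close>

definition row_contractive :: "nat \<Rightarrow> (nat \<Rightarrow> 'a \<Rightarrow> 'a::complex_inner_space) \<Rightarrow> bool" where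
  "row_contractive n A \<longleftrightarrow> (\<forall>x. (norm (\<Sum>l<n. A l (x l)))\<^sup>2 \<le> (\<Sum>l<n. (norm (x l))\<^sup>2))"

definition row_isometric :: "nat \<Rightarrow> (nat \<Rightarrow> 'a \<Rightarrow> 'a::complex_inner_space) \<Rightarrow> bool" where
  "row_isometric n A \<longleftrightarrow> (\<forall>x. (norm (\<Sum>l<n. A l (x l)))\<^sup>2 = (\<Sum>l<n. (norm (x l))\<^sup>2))"

lemma row_isometric_contractive: "row_isometric n A \<Longrightarrow> row_contractive n A"
  by (simp add: row_isometric_def row_contractive_def)

lemma row_contractive_norm_le:
  assumes "row_contractive n A" "l < n" and lin: "\<And>r. r < n \<Longrightarrow> clinear (A r)"
  shows "norm (A l x) \<le> norm x"
proof (rule power2_le_imp_le)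
  have "(\<Sum>r<n. A r (if r = l then x else 0)) = (\<Sum>r<n. if r = l then A l x else 0)"
    by (rule sum.cong) (auto simp: clinear_0 lin)
  moreover have "(\<Sum>r<n. (norm (if r = l then x else 0))\<^sup>2) = (\<Sum>r<n. if r = l then (norm x)\<^sup>2 else 0)"
    by (rule sum.cong) auto
  ultimately show "(norm (A l x))\<^sup>2 \<le> (norm x)\<^sup>2"
    using assms(1)[unfolded row_contractive_def, rule_format, of "\<lambda>r. if r = l then x else 0"] \<open>l < n\<close>
    by simp
qed simp

lemma bounded_linear_contraction:
  "clinear A \<Longrightarrow> (\<And>x. norm (A x) \<le> norm x) \<Longrightarrow> bounded_linear A"
  by (rule bounded_linear_intro[where K = 1])
     (simp_all add: clinear_add clinear_linear linear_cmul)

lemma norm_adjoint_contraction: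
  assumes "is_adj A B" "\<And>x. norm (A x) \<le> norm x"
  shows "norm (B y) \<le> norm y"
proof -
  have "cinner (B y) (B y) = cinner (A (B y)) y" using is_adjD[OF assms(1)] by simp
  then have "(norm (B y))\<^sup>2 = cmod (cinner (A (B y)) y)"
    unfolding cinner_norm[of "B y"] by (metis norm_of_real abs_power2)
  also have "\<dots> \<le> norm (A (B y)) * norm y" by (rule norm_cinner_le)
  also have "\<dots> \<le> norm (B y) * norm y" by (intro mult_right_mono assms(2)) simp
  finally show ?thesis
    by (cases "B y = 0") (simp_all add: power2_eq_square)
qed

definition twisted_commute ::
  "nat \<Rightarrow> nat \<Rightarrow> cmat \<Rightarrow> (nat \<Rightarrow> 'a \<Rightarrow> 'a::complex_inner_space) \<Rightarrow> (nat \<Rightarrow> 'a \<Rightarrow> 'a) \<Rightarrow> bool" where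
  "twisted_commute n m w X Y \<longleftrightarrow> (\<forall>l<n. \<forall>p<m. \<forall>x.
     X l (Y p x) = (\<Sum>r<n. \<Sum>q<m. scaleC (w (l, p) (r, q)) (Y q (X r x))))"

lemma twisted_commuteD: "twisted_commute n m w X Y \<Longrightarrow> l < n \<Longrightarrow> p < m \<Longrightarrow>
    X l (Y p x) = (\<Sum>r<n. \<Sum>q<m. scaleC (w (l, p) (r, q)) (Y q (X r x)))"
  by (simp add: twisted_commute_def)

text \<open>Partial conjugate transpose, in the second tensor factor only: if \<open>X\<close> and \<open>Y\<close> commute
  with twist \<open>w\<close>, then double commutation says that \<open>X\<^sup>*\<close> and \<open>Y\<close> commute with twist
  \<open>partial_adj w\<close>.\<close>

definition partial_adj :: "cmat \<Rightarrow> cmat" where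
  "partial_adj w = (\<lambda>(l, p) (r, q). cnj (w (l, q) (r, p)))"

lemma partial_adj_apply [simp]: "partial_adj w (l, p) (r, q) = cnj (w (l, q) (r, p))"
  by (simp add: partial_adj_def)

lemma sum_lessThan_delta_apply:
  fixes l n p m :: nat
  assumes "l < n" "p < m"
  shows "(\<Sum>r<n. \<Sum>q<m. scaleC (if (l, p) = (r, q) then 1 else 0) (f r q)) = (f l p :: 'a::complex_inner_space)"
proof -
  have "(\<Sum>r<n. \<Sum>q<m. scaleC (if (l, p) = (r, q) then 1 else 0) (f r q))
      = (\<Sum>r<n. if l = r then f l p else 0)"
    by (rule sum.cong) (use assms in \<open>auto simp: if_distrib[of "\<lambda>c. scaleC c _"] cong: if_cong\<close>)
  then show ?thesis using assms by simp
qed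

text \<open>Summing the relation against conjugate coefficients removes the twist, because the
  columns of \<open>w\<close> are orthonormal. Thus one order of a pair of rows yields the
  other.\<close>

lemma twisted_commute_flip:
  assumes tc: "twisted_commute n m w X Y"
    and unit: "unitary_mat n m w"
    and flip: "\<And>l p r q. l < n \<Longrightarrow> p < m \<Longrightarrow> r < n \<Longrightarrow> q < m \<Longrightarrow> w' (p, l) (q, r) = cnj (w (r, q) (l, p))"
  shows "twisted_commute m n w' Y X"
  unfolding twisted_commute_def
proof (intro allI impI)
  fix p l x assume p: "p < m" and l: "l < n"
  have "(\<Sum>q<m. \<Sum>r<n. scaleC (w' (p, l) (q, r)) (X r (Y q x)))
      = (\<Sum>q<m. \<Sum>r<n. \<Sum>r'<n. \<Sum>q'<m. scaleC (cnj (w (r, q) (l, p)) * w (r, q) (r', q')) (Y q' (X r' x)))"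
    by (intro sum.cong refl) (simp add: flip p l twisted_commuteD[OF tc] scaleC.sum_right)
  also have "\<dots> = (\<Sum>r<n. \<Sum>q<m. \<Sum>r'<n. \<Sum>q'<m. scaleC (cnj (w (r, q) (l, p)) * w (r, q) (r', q')) (Y q' (X r' x)))"
    by (rule sum.swap)
  also have "\<dots> = (\<Sum>c\<in>{..<n}\<times>{..<m}. \<Sum>r'<n. \<Sum>q'<m. scaleC (cnj (w c (l, p)) * w c (r', q')) (Y q' (X r' x)))"
    by (rule trans[OF sum.cartesian_product], rule sum.cong) auto
  also have "\<dots> = (\<Sum>r'<n. \<Sum>q'<m. \<Sum>c\<in>{..<n}\<times>{..<m}. scaleC (cnj (w c (l, p)) * w c (r', q')) (Y q' (X r' x)))"
    by (subst sum.swap, rule sum.cong[OF refl], rule sum.swap)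
  also have "\<dots> = (\<Sum>r'<n. \<Sum>q'<m. scaleC (if (l, p) = (r', q') then 1 else 0) (Y q' (X r' x)))"
    using unit p l by (intro sum.cong refl) (simp add: unitary_mat_def flip: scaleC.sum_left)
  also have "\<dots> = Y p (X l x)" using l p by (rule sum_lessThan_delta_apply)
  finally show "Y p (X l x) = (\<Sum>q<m. \<Sum>r<n. scaleC (w' (p, l) (q, r)) (X r (Y q x)))" by simp
qed

text \<open>Both sides of the relation have explicit adjoints, and adjoints are unique.\<close>

lemma twisted_commute_adjoint:
  assumes tc: "twisted_commute n m w X Y"
    and X: "\<And>l. l < n \<Longrightarrow> is_adj (X l) (X' l)" and Y: "\<And>p. p < m \<Longrightarrow> is_adj (Y p) (Y' p)"
    and l: "l < n" and p: "p < m"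
  shows "Y' p (X' l x) = (\<Sum>r<n. \<Sum>q<m. scaleC (cnj (w (l, p) (r, q))) (X' r (Y' q x)))"
proof -
  have 1: "is_adj (\<lambda>x. X l (Y p x)) (\<lambda>x. Y' p (X' l x))"
    by (rule is_adj_comp[OF X[OF l] Y[OF p]])
  have 2: "is_adj (\<lambda>x. \<Sum>r<n. \<Sum>q<m. scaleC (w (l, p) (r, q)) (Y q (X r x)))
      (\<lambda>x. \<Sum>r<n. \<Sum>q<m. scaleC (cnj (w (l, p) (r, q))) (X' r (Y' q x)))"
    by (rule is_adj_sum, rule is_adj_sum, rule is_adj_scaleC, rule is_adj_comp[OF Y X]) auto
  have "(\<lambda>x. X l (Y p x)) = (\<lambda>x. \<Sum>r<n. \<Sum>q<m. scaleC (w (l, p) (r, q)) (Y q (X r x)))"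
    by (rule ext) (rule twisted_commuteD[OF tc l p])
  from fun_cong[OF is_adj_unique[OF 1[unfolded this] 2]] show ?thesis .
qed

subsection \<open>The defect operator of a row contraction\<close>

text \<open>\<open>D l p\<close> are the matrix entries of the square root of \<open>1 - A\<^sup>*A\<close>, where \<open>A\<close> is the row
  regarded as one operator on the \<open>d\<close>-fold direct sum. A family \<open>X\<close> doubly commuting with the row
  acts on this sum, commuting with \<open>A\<^sup>*A\<close> and hence with the square root.\<close>

lemma defect_operator_exists:
  fixes A B :: "nat \<Rightarrow> 'a::{complex_inner_space, complete_space} \<Rightarrow> 'a"
  assumes adj: "\<And>l. l < d \<Longrightarrow> is_adj (A l) (B l)" and contr: "row_contractive d A"
  obtains D :: "nat \<Rightarrow> nat \<Rightarrow> 'a \<Rightarrow> 'a" where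
    "\<And>l p. is_adj (D l p) (D p l)"
    "\<And>x. (\<Sum>p<d. (norm (\<Sum>l<d. D l p (x l)))\<^sup>2) + (norm (\<Sum>l<d. A l (x l)))\<^sup>2 = (\<Sum>l<d. (norm (x l))\<^sup>2)"
    "\<And>n w X l p c h. (\<And>r. r < n \<Longrightarrow> bounded_linear (X r)) \<Longrightarrow> (\<And>r. r < n \<Longrightarrow> clinear (X r)) \<Longrightarrow>
        twisted_commute n d w X A \<Longrightarrow>
        (\<And>q l x. q < d \<Longrightarrow> l < n \<Longrightarrow> B q (X l x) = (\<Sum>r<n. \<Sum>p<d. scaleC (w (l, p) (r, q)) (X r (B p x)))) \<Longrightarrow>
        l < n \<Longrightarrow> p < d \<Longrightarrow> c < d \<Longrightarrow>
        (\<Sum>b<d. \<Sum>r<n. scaleC (w (l, b) (r, c)) (X r (D p b h)))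
          = (\<Sum>r<n. \<Sum>q<d. scaleC (w (l, p) (r, q)) (D q c (X r h)))"
proof -
  \<comment> \<open>The \<open>d\<close>-fold direct sum is realised as the first \<open>d\<close>
    coordinates of \<open>'a ell2\<close>. \<open>T\<close> is the row extended by zero to the other
    coordinates, \<open>S\<close> its adjoint, and \<open>P\<close> is \<open>T\<close> followed by
    \<open>S\<close>.\<close>
  define T where "T x = (\<Sum>p<d. A p (coord x p))" for x :: "'a ell2"
  define S where "S h = (\<Sum>q<d. single q (B q h))" for h
  define P where "P x = S (T x)" for x
  have TS: "is_adj T S"
    unfolding T_def S_def
    by (rule is_adj_sum, rule is_adj_comp[OF adj is_adj_sym[OF is_adj_single]]) auto
  have ST: "is_adj S T" using TS by (rule is_adj_sym)
  have cS: "coord (S h) c = (if c < d then B c h else 0)" for h c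
    by (simp add: S_def coord_single if_distrib cong: if_cong)
  have PP: "is_adj P P"
    unfolding P_def by (rule is_adj_comp[OF ST TS])
  have nT: "norm (T x) \<le> norm x" for x
  proof (rule power2_le_imp_le)
    have "(norm (T x))\<^sup>2 \<le> (\<Sum>l<d. (norm (coord x l))\<^sup>2)"
      unfolding T_def using contr by (simp add: row_contractive_def)
    also have "\<dots> \<le> (norm x)\<^sup>2" by (simp only: norm_ell2_def sum_le_l2norm coord)
    finally show "(norm (T x))\<^sup>2 \<le> (norm x)\<^sup>2" .
  qed simp
  have nP: "norm (P x) \<le> norm x" for x
    unfolding P_def using norm_adjoint_contraction[OF TS nT, of "T x"] nT[of x] by linarith
  obtain R where RR: "is_adj R R" and R2: "\<And>x. R (R x) = x - P x"
    and Rcomm: "\<And>C x. bounded_linear C \<Longrightarrow> (\<And>x. C (P x) = P (C x)) \<Longrightarrow> C (R x) = R (C x)"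
    using sqrt_one_minus_contraction[OF PP nP] by blast
  define D where "D l p h = coord (R (single l h)) p" for l p h
  have linR: "clinear R" using RR by (rule is_adj_clinear)
  have bl_single: "bounded_linear (single q :: 'a \<Rightarrow> 'a ell2)" for q
    by (rule bounded_linear_contraction[OF clinear_single]) simp
  show thesis
  proof (rule that[of D])
    show "is_adj (D l p) (D p l)" for l p
      unfolding D_def
      using is_adj_comp[OF is_adj_sym[OF is_adj_single[of p]] is_adj_comp[OF RR is_adj_single[of l]]]
      by simp
    show "(\<Sum>p<d. (norm (\<Sum>l<d. D l p (x l)))\<^sup>2) + (norm (\<Sum>l<d. A l (x l)))\<^sup>2 = (\<Sum>l<d. (norm (x l))\<^sup>2)" for x
    proof -
      define z where "z = (\<Sum>l<d. single l (x l))"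
      have cz: "coord z c = (if c < d then x c else 0)" for c
        by (simp add: z_def coord_single if_distrib cong: if_cong)
      \<comment> \<open>\<open>Q\<close> projects onto the first \<open>d\<close> coordinates. It
        commutes with \<open>P\<close>, hence with \<open>R\<close>; so \<open>R\<close> does not
        leave the direct sum and the norm of \<open>R z\<close> is a finite sum.\<close>
      define Q where "Q f = (\<Sum>l<d. single l (coord f l))" for f :: "'a ell2"
      have cQ: "coord (Q f) c = (if c < d then coord f c else 0)" for f c
        by (simp add: Q_def coord_single if_distrib cong: if_cong)
      have "Q (R z) = R (Q z)"
      proof (rule Rcomm)
        show "bounded_linear Q" unfolding Q_def
          by (intro bounded_linear_sum bounded_linear_compose[OF bl_single] bounded_linear_coord)
        have "T (Q f) = T f" for f by (simp add: T_def cQ)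
        then show "Q (P f) = P (Q f)" for f
          by (intro ell2_eqI) (simp add: P_def cQ cS)
      qed
      moreover have "Q z = z" by (intro ell2_eqI) (simp add: cQ cz)
      ultimately have QRz: "Q (R z) = R z" by simp
      have "coord (R z) n = 0" if "n \<ge> d" for n
        using cQ[of "R z" n] that unfolding QRz by simp
      then have nRz: "(norm (R z))\<^sup>2 = (\<Sum>p<d. (norm (coord (R z) p))\<^sup>2)"
        by (rule norm_square_finite_support)
      have nz: "(norm z)\<^sup>2 = (\<Sum>p<d. (norm (x p))\<^sup>2)"
        using norm_square_finite_support[of d z] by (simp add: cz)
      have cRz: "coord (R z) p = (\<Sum>l<d. D l p (x l))" for p
        by (simp add: z_def clinear_sum[OF linR] D_def)
      have Tz: "T z = (\<Sum>l<d. A l (x l))" by (simp add: T_def cz)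
      have "cinner (R z) (R z) = cinner z z - cinner (T z) (T z)"
        using is_adjD[OF RR, of z "R z"] is_adjD[OF TS, of z "T z"]
        by (simp add: R2 P_def cinner.diff_right)
      then have "complex_of_real ((norm (R z))\<^sup>2) = complex_of_real ((norm z)\<^sup>2 - (norm (T z))\<^sup>2)"
        by (simp add: cinner_norm)
      then have "(norm (R z))\<^sup>2 = (norm z)\<^sup>2 - (norm (T z))\<^sup>2"
        using of_real_eq_iff by blast
      then show ?thesis using nRz nz cRz Tz by simp
    qed
    fix n w l p c h and X :: "nat \<Rightarrow> 'a \<Rightarrow> 'a"
    assume bl: "\<And>r. r < n \<Longrightarrow> bounded_linear (X r)" and lin: "\<And>r. r < n \<Longrightarrow> clinear (X r)"
      and tc: "twisted_commute n d w X A"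
      and tc2: "\<And>q l x. q < d \<Longrightarrow> l < n \<Longrightarrow> B q (X l x) = (\<Sum>r<n. \<Sum>p<d. scaleC (w (l, p) (r, q)) (X r (B p x)))"
      and l: "l < n" and p: "p < d" and c: "c < d"
    \<comment> \<open>The action of \<open>X l\<close> on the direct sum, twisted by
      \<open>w\<close>. The hypotheses \<open>tc\<close> and \<open>tc2\<close> say that
      \<open>T\<close> and \<open>S\<close> intertwine it with \<open>X l\<close>, whence it
      commutes with \<open>P\<close>.\<close>
    define X1 where "X1 f = (\<Sum>q<d. single q (\<Sum>p<d. \<Sum>r<n. scaleC (w (l, p) (r, q)) (X r (coord f p))))" for f
    have cX1: "coord (X1 f) q = (if q < d then \<Sum>p<d. \<Sum>r<n. scaleC (w (l, p) (r, q)) (X r (coord f p)) else 0)" for f q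
      by (simp add: X1_def coord_single if_distrib cong: if_cong)
    have "X1 (R (single p h)) = R (X1 (single p h))"
    proof (rule Rcomm)
      show "bounded_linear X1" unfolding X1_def
        by (intro bounded_linear_sum bounded_linear_compose[OF bl_single]
            bounded_linear_compose[OF scaleC.bounded_linear_right] bounded_linear_compose[OF bl] bounded_linear_coord)
           auto
      have linA: "clinear (A q)" if "q < d" for q using adj[OF that] by (rule is_adj_clinear)
      have 1: "T (X1 f) = X l (T f)" for f
      proof -
        have "T (X1 f) = (\<Sum>q<d. \<Sum>p<d. \<Sum>r<n. scaleC (w (l, p) (r, q)) (A q (X r (coord f p))))"
          by (simp add: T_def cX1 clinear_sum linA clinear_scaleC)
        also have "\<dots> = (\<Sum>p<d. \<Sum>q<d. \<Sum>r<n. scaleC (w (l, p) (r, q)) (A q (X r (coord f p))))"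
          by (rule sum.swap)
        also have "\<dots> = (\<Sum>p<d. \<Sum>r<n. \<Sum>q<d. scaleC (w (l, p) (r, q)) (A q (X r (coord f p))))"
          by (rule sum.cong[OF refl], rule sum.swap)
        also have "\<dots> = X l (T f)"
          by (simp add: T_def clinear_sum lin l twisted_commuteD[OF tc])
        finally show ?thesis .
      qed
      have 2: "X1 (S x) = S (X l x)" for x
      proof (rule ell2_eqI)
        fix q
        have "(\<Sum>p<d. \<Sum>r<n. scaleC (w (l, p) (r, q)) (X r (B p x)))
            = (\<Sum>r<n. \<Sum>p<d. scaleC (w (l, p) (r, q)) (X r (B p x)))"
          by (rule sum.swap)
        then show "coord (X1 (S x)) q = coord (S (X l x)) q"
          by (simp add: cX1 cS tc2 l)
      qed
      show "X1 (P f) = P (X1 f)" for f by (simp add: P_def 1 2)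
    qed
    then have e: "coord (X1 (R (single p h))) c = coord (R (X1 (single p h))) c" by simp
    have "X1 (single p h) = (\<Sum>q<d. single q (\<Sum>r<n. scaleC (w (l, p) (r, q)) (X r h)))"
    proof (rule ell2_eqI)
      fix q
      have "(\<Sum>p'<d. \<Sum>r<n. scaleC (w (l, p') (r, q)) (X r (if p' = p then h else 0)))
          = (\<Sum>p'<d. if p' = p then \<Sum>r<n. scaleC (w (l, p) (r, q)) (X r h) else 0)"
        by (intro sum.cong refl) (auto simp: clinear_0 lin)
      then show "coord (X1 (single p h)) q = coord (\<Sum>q<d. single q (\<Sum>r<n. scaleC (w (l, p) (r, q)) (X r h))) q"
        using p by (simp add: cX1 coord_single if_distrib cong: if_cong)
    qed
    then have "coord (R (X1 (single p h))) c = (\<Sum>q<d. \<Sum>r<n. scaleC (w (l, p) (r, q)) (D q c (X r h)))"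
      by (simp add: D_def clinear_sum[OF linR] clinear_sum[OF clinear_single] clinear_scaleC[OF linR]
          clinear_scaleC[OF clinear_single])
    also have "\<dots> = (\<Sum>r<n. \<Sum>q<d. scaleC (w (l, p) (r, q)) (D q c (X r h)))"
      by (rule sum.swap)
    finally show "(\<Sum>b<d. \<Sum>r<n. scaleC (w (l, b) (r, c)) (X r (D p b h)))
          = (\<Sum>r<n. \<Sum>q<d. scaleC (w (l, p) (r, q)) (D q c (X r h)))"
      using e c by (simp add: cX1 D_def)
  qed
qed

subsection \<open>Lifting operators to sequences indexed by words\<close>

text \<open>A word over the alphabet \<open>{..<d}\<close> is coded by a natural number in bijective base \<open>d\<close>: the
  empty word is \<open>0\<close> and the word with first letter \<open>p\<close> and remainder coded by \<open>n\<close> is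
  \<open>Suc (p + d * n)\<close>. Thus \<open>'a ell2\<close> is the Fock space of a \<open>d\<close>-dimensional space tensored with \<open>'a\<close>.\<close>

lemma word_code_cases:
  assumes "(d::nat) \<ge> 1"
  obtains "m = 0" | p n where "p < d" "m = Suc (p + d * n)" "n < m"
proof (cases m)
  case 0
  then show ?thesis using that by blast
next
  case (Suc k)
  have "k div d < Suc k" by (rule le_imp_less_Suc) simp
  then show ?thesis
    using Suc that(2)[of "k mod d" "k div d"] assms by simp
qed

lemma sum_lessThan_add:
  fixes g :: "nat \<Rightarrow> 'a::comm_monoid_add"
  shows "(\<Sum>n<a + b. g n) = (\<Sum>n<a. g n) + (\<Sum>p<b. g (a + p))"
  by (induction b) (simp_all add: add.assoc)

text \<open>The codes below \<open>Suc (d * N)\<close> are that of the empty word and those of a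
  letter followed by a word coded below \<open>N\<close>.\<close>

lemma sum_word_code:
  fixes g :: "nat \<Rightarrow> 'a::comm_monoid_add"
  shows "(\<Sum>n<Suc (d * N). g n) = g 0 + (\<Sum>p<d. \<Sum>n<N. g (Suc (p + d * n)))"
proof -
  have "(\<Sum>n<d * N. h n) = (\<Sum>p<d. \<Sum>n<N. h (p + d * n))" for h :: "nat \<Rightarrow> 'a"
  proof (induction N)
    case (Suc N)
    have "(\<Sum>n<d * Suc N. h n) = (\<Sum>n<d * N. h n) + (\<Sum>p<d. h (d * N + p))"
      using sum_lessThan_add[of h "d * N" d] by (simp add: add.commute)
    then show ?case by (simp add: Suc sum.distrib add.commute)
  qed simp
  from this[of "\<lambda>n. g (Suc n)"] show ?thesis by (simp only: sum.lessThan_Suc_shift)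
qed

text \<open>Equal to \<open>1 + d + ... + d^(c-1)\<close>: the codes below it are those of the words
  with fewer than \<open>c\<close> letters. Lifts preserve the length of words, so sums over these
  ranges are compatible with them.\<close>

primrec word_level :: "nat \<Rightarrow> nat \<Rightarrow> nat" where
  "word_level d 0 = 0"
| "word_level d (Suc c) = Suc (d * word_level d c)"

lemma word_level_ge: "d \<ge> 1 \<Longrightarrow> c \<le> word_level d c"
proof (induction c)
  case (Suc c)
  then have "c \<le> word_level d c" by simp
  also have "\<dots> \<le> d * word_level d c" using Suc.prems by simp
  finally show ?case by simp
qed simp

lemma tendsto_word_level:
  assumes "d \<ge> 1" "g sums s"
  shows "(\<lambda>c. \<Sum>n<word_level d c. g n) \<longlonglongrightarrow> s"
proof -
  have "filterlim (word_level d) sequentially sequentially"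
    by (rule filterlim_at_top_mono[OF filterlim_ident])
       (rule always_eventually, rule allI, rule word_level_ge[OF assms(1)])
  from filterlim_compose[OF assms(2)[unfolded sums_def] this] show ?thesis .
qed

text \<open>Forced by the desired relation with creation operators: \<open>X l\<close> passes the
  first letter \<open>p\<close>, turning into \<open>X r\<close> and leaving the letter
  \<open>q\<close>, with coefficient \<open>w (l, p) (r, q)\<close>; at the empty word
  \<open>X l\<close> itself acts. The letter \<open>q\<close> and the shorter word are decoded from
  \<open>m\<close>. Arguments are arbitrary functions, so that the algebra precedes all questions of
  convergence.\<close>

function word_lift :: "nat \<Rightarrow> nat \<Rightarrow> cmat \<Rightarrow> (nat \<Rightarrow> 'a \<Rightarrow> 'a::complex_inner_space)
    \<Rightarrow> nat \<Rightarrow> (nat \<Rightarrow> 'a) \<Rightarrow> nat \<Rightarrow> 'a" where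
  "word_lift d n w X l f m = (if m = 0 then X l (f 0)
     else \<Sum>p<d. \<Sum>r<n. scaleC (w (l, p) (r, (m - 1) mod d))
       (word_lift d n w X r (\<lambda>j. f (Suc (p + d * j))) ((m - 1) div d)))"
  by auto
termination
proof (relation "Wellfounded.measure (\<lambda>(d, n, w, X, l, f, m). m)", simp)
  fix d m :: nat
  assume "m \<noteq> 0"
  moreover have "(m - 1) div d \<le> m - 1" by simp
  ultimately have "(m - 1) div d < m" by linarith
  then show "((d, n, w, X, r, \<lambda>j. f (Suc (p + d * j)), (m - 1) div d), (d, n, w, X, l, f, m))
      \<in> Wellfounded.measure (\<lambda>(d, n, w, X, l, f, m). m)" for n w X l f r p
    by simp
qed

declare word_lift.simps [simp del]

lemma word_lift_0 [simp]: "word_lift d n w X l f 0 = X l (f 0)"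
  by (simp add: word_lift.simps)

lemma word_lift_Suc: "q < d \<Longrightarrow> word_lift d n w X l f (Suc (q + d * j))
    = (\<Sum>p<d. \<Sum>r<n. scaleC (w (l, p) (r, q)) (word_lift d n w X r (\<lambda>j. f (Suc (p + d * j))) j))"
  by (simp add: word_lift.simps[of d n w X l f "Suc (q + d * j)"])

lemma word_lift_scaleC:
  assumes d: "d \<ge> 1" and lin: "\<And>r. r < n \<Longrightarrow> clinear (X r)"
  shows "l < n \<Longrightarrow> word_lift d n w X l (\<lambda>m. scaleC c (f m)) m = scaleC c (word_lift d n w X l f m)"
proof (induction m arbitrary: l f rule: less_induct)
  case (less m)
  show ?case
  proof (rule word_code_cases[OF d, of m])
    assume "m = 0"
    then show ?thesis using less.prems by (simp add: clinear_scaleC lin)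
  next
    fix p j assume "p < d" "m = Suc (p + d * j)" "j < m"
    then show ?thesis
      by (simp add: word_lift_Suc less.IH scaleC.sum_right mult.commute)
  qed
qed

lemma word_lift_add:
  assumes d: "d \<ge> 1" and lin: "\<And>r. r < n \<Longrightarrow> clinear (X r)"
  shows "l < n \<Longrightarrow> word_lift d n w X l (\<lambda>m. f m + g m) m = word_lift d n w X l f m + word_lift d n w X l g m"
proof (induction m arbitrary: l f g rule: less_induct)
  case (less m)
  show ?case
  proof (rule word_code_cases[OF d, of m])
    assume "m = 0"
    then show ?thesis using less.prems by (simp add: clinear_add lin)
  next
    fix p j assume "p < d" "m = Suc (p + d * j)" "j < m"
    then show ?thesis
      by (simp add: word_lift_Suc less.IH scaleC_add_right sum.distrib)
  qed
qed

lemma word_lift_zero: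
  assumes d: "d \<ge> 1" and lin: "\<And>r. r < n \<Longrightarrow> clinear (X r)" and "l < n"
  shows "word_lift d n w X l (\<lambda>m. 0) m = 0"
  using word_lift_scaleC[OF assms, where c = 0 and f = "\<lambda>m. 0"] by simp

lemma word_lift_sum:
  assumes d: "d \<ge> 1" and lin: "\<And>r. r < n \<Longrightarrow> clinear (X r)" and "l < n"
  shows "word_lift d n w X l (\<lambda>m. \<Sum>i\<in>I. f i m) m = (\<Sum>i\<in>I. word_lift d n w X l (f i) m)"
  by (induction I rule: infinite_finite_induct)
     (simp_all add: word_lift_zero[OF assms] word_lift_add[OF assms])

text \<open>The braid relation in coordinates: the two ways of reversing
  \<open>e_q \<otimes> e_r \<otimes> e_a\<close> by exchanging neighbours have the same coefficient
  at \<open>e_c \<otimes> e_l \<otimes> e_p\<close>. The factor \<open>e_a\<close> will be a letter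
  of a word, the other two belong to the rows passing it.\<close>

definition yang_baxter :: "nat \<Rightarrow> nat \<Rightarrow> nat \<Rightarrow> cmat \<Rightarrow> cmat \<Rightarrow> cmat \<Rightarrow> bool" where
  "yang_baxter d n m wX wY v \<longleftrightarrow> (\<forall>q<n. \<forall>r<m. \<forall>a<d. \<forall>c<d. \<forall>p<n. \<forall>l<m.
     (\<Sum>s<n. \<Sum>t<m. \<Sum>b<d. wX (q, b) (s, c) * wY (r, a) (t, b) * v (s, t) (p, l))
   = (\<Sum>s<n. \<Sum>t<m. \<Sum>b<d. v (q, r) (s, t) * wY (t, b) (l, c) * wX (s, a) (p, b)))"

text \<open>Induction on the word. When both lifts have passed the first letter, the two sides of
  the claim combine the same values \<open>Z\<close> at the shorter word, and their coefficients are
  the two sides of \<open>yang_baxter\<close>. The argument is pointwise and linear, so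
  \<open>X\<close> may also be a family of adjoints with its own matrix.\<close>

lemma twisted_commute_word_lift:
  fixes X Y :: "nat \<Rightarrow> 'a \<Rightarrow> 'a::complex_inner_space"
  assumes d: "d \<ge> 1"
    and linX: "\<And>r. r < n \<Longrightarrow> clinear (X r)" and linY: "\<And>r. r < m \<Longrightarrow> clinear (Y r)"
    and tc: "twisted_commute n m v X Y" and yb: "yang_baxter d n m wX wY v"
  defines "X' \<equiv> word_lift d n wX X" and "Y' \<equiv> word_lift d m wY Y"
  shows "q < n \<Longrightarrow> r < m \<Longrightarrow>
    X' q (Y' r f) j = (\<Sum>p<n. \<Sum>l<m. scaleC (v (q, r) (p, l)) (Y' l (X' p f) j))"
proof (induction j arbitrary: q r f rule: less_induct)
  case (less j)
  show ?case
  proof (rule word_code_cases[OF d, of j])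
    assume "j = 0"
    then show ?thesis
      using less.prems by (simp add: X'_def Y'_def twisted_commuteD[OF tc])
  next
    fix c i assume c: "c < d" and j: "j = Suc (c + d * i)" and i: "i < j"
    define tl where "tl a g = (\<lambda>j. g (Suc (a + d * j)) :: 'a)" for a g
    define Z where "Z a p l = Y' l (X' p (tl a f)) i" for a p l
    have X'S: "X' q g (Suc (b + d * k)) = (\<Sum>a<d. \<Sum>s<n. scaleC (wX (q, a) (s, b)) (X' s (tl a g) k))"
      if "b < d" for q g b k using that by (simp add: X'_def word_lift_Suc tl_def)
    have Y'S: "Y' q g (Suc (b + d * k)) = (\<Sum>a<d. \<Sum>t<m. scaleC (wY (q, a) (t, b)) (Y' t (tl a g) k))"
      if "b < d" for q g b k using that by (simp add: Y'_def word_lift_Suc tl_def)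
    have tX: "tl b (X' q g) = (\<lambda>k. \<Sum>a<d. \<Sum>s<n. scaleC (wX (q, a) (s, b)) (X' s (tl a g) k))"
      if "b < d" for q g b using X'S[OF that] by (simp add: tl_def[of _ "X' q g"])
    have tY: "tl b (Y' q g) = (\<lambda>k. \<Sum>a<d. \<Sum>t<m. scaleC (wY (q, a) (t, b)) (Y' t (tl a g) k))"
      if "b < d" for q g b using Y'S[OF that] by (simp add: tl_def[of _ "Y' q g"])
    have X'sum: "X' s (\<lambda>k. \<Sum>a<d. \<Sum>t<m. scaleC (e a t) (g a t k)) k = (\<Sum>a<d. \<Sum>t<m. scaleC (e a t) (X' s (g a t) k))"
      if "s < n" for s e g k
      unfolding X'_def by (simp add: word_lift_sum[OF d linX that] word_lift_scaleC[OF d linX that])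
    have Y'sum: "Y' t (\<lambda>k. \<Sum>a<d. \<Sum>s<n. scaleC (e a s) (g a s k)) k = (\<Sum>a<d. \<Sum>s<n. scaleC (e a s) (Y' t (g a s) k))"
      if "t < m" for t e g k
      unfolding Y'_def by (simp add: word_lift_sum[OF d linY that] word_lift_scaleC[OF d linY that])
    have "X' q (Y' r f) j = (\<Sum>b<d. \<Sum>s<n. \<Sum>a<d. \<Sum>t<m. \<Sum>p<n. \<Sum>l<m.
        scaleC (wX (q, b) (s, c) * wY (r, a) (t, b) * v (s, t) (p, l)) (Z a p l))"
      unfolding j X'S[OF c]
      by (intro sum.cong refl) (simp add: tY X'sum less.IH[OF i] scaleC.sum_right mult.assoc Z_def)
    also have "\<dots> = (\<Sum>a<d. \<Sum>p<n. \<Sum>l<m. \<Sum>s<n. \<Sum>t<m. \<Sum>b<d.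
        scaleC (wX (q, b) (s, c) * wY (r, a) (t, b) * v (s, t) (p, l)) (Z a p l))"
      unfolding sum.cartesian_product
      by (rule sum.reindex_bij_witness[of _ "\<lambda>(a,p,l,s,t,b). (b,s,a,t,p,l)" "\<lambda>(b,s,a,t,p,l). (a,p,l,s,t,b)"])
         auto
    also have "\<dots> = (\<Sum>a<d. \<Sum>p<n. \<Sum>l<m. \<Sum>s<n. \<Sum>t<m. \<Sum>b<d.
        scaleC (v (q, r) (s, t) * wY (t, b) (l, c) * wX (s, a) (p, b)) (Z a p l))"
      unfolding scaleC.sum_left[symmetric] using yb less.prems c
      by (intro sum.cong refl) (simp add: yang_baxter_def)
    also have "\<dots> = (\<Sum>s<n. \<Sum>t<m. \<Sum>b<d. \<Sum>l<m. \<Sum>a<d. \<Sum>p<n.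
        scaleC (v (q, r) (s, t) * wY (t, b) (l, c) * wX (s, a) (p, b)) (Z a p l))"
      unfolding sum.cartesian_product
      by (rule sum.reindex_bij_witness[of _ "\<lambda>(s,t,b,l,a,p). (a,p,l,s,t,b)" "\<lambda>(a,p,l,s,t,b). (s,t,b,l,a,p)"])
         auto
    also have "\<dots> = (\<Sum>p<n. \<Sum>l<m. scaleC (v (q, r) (p, l)) (Y' l (X' p f) j))"
      unfolding j Y'S[OF c]
      by (intro sum.cong refl) (simp add: tX Y'sum scaleC.sum_right mult.assoc Z_def)
    finally show ?thesis .
  qed
qed

section \<open>Norms and adjoints of lifts on words of bounded length\<close>

lemma unitary_norm_square:
  fixes z :: "nat \<Rightarrow> nat \<Rightarrow> 'a::complex_inner_space"
  assumes "unitary_mat n d w"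
  shows "(\<Sum>r<n. \<Sum>q<d. (norm (\<Sum>l<n. \<Sum>p<d. scaleC (w (l, p) (r, q)) (z l p)))\<^sup>2) = (\<Sum>l<n. \<Sum>p<d. (norm (z l p))\<^sup>2)"
proof -
  let ?I = "{..<n} \<times> {..<d}"
  define y where "y a = z (fst a) (snd a)" for a
  have "(\<Sum>c\<in>?I. cinner (\<Sum>a\<in>?I. scaleC (w a c) (y a)) (\<Sum>b\<in>?I. scaleC (w b c) (y b)))
      = (\<Sum>c\<in>?I. \<Sum>b\<in>?I. \<Sum>a\<in>?I. (w b c * cnj (w a c)) * cinner (y a) (y b))"
    by (simp add: cinner.sum_left cinner.sum_right cinner_scaleC_left cinner_scaleC_right
        sum_distrib_left mult.assoc mult.left_commute)
  also have "\<dots> = (\<Sum>b\<in>?I. \<Sum>a\<in>?I. \<Sum>c\<in>?I. (w b c * cnj (w a c)) * cinner (y a) (y b))"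
    by (subst sum.swap, rule sum.cong[OF refl], rule sum.swap)
  also have "\<dots> = (\<Sum>b\<in>?I. \<Sum>a\<in>?I. (if b = a then 1 else 0) * cinner (y a) (y b))"
  proof (intro sum.cong refl)
    fix a b assume "a \<in> ?I" "b \<in> ?I"
    then have "(\<Sum>c\<in>?I. w b c * cnj (w a c)) = (if b = a then 1 else 0)"
      using assms unfolding unitary_mat_def by blast
    then show "(\<Sum>c\<in>?I. w b c * cnj (w a c) * cinner (y a) (y b)) = (if b = a then 1 else 0) * cinner (y a) (y b)"
      by (simp only: sum_distrib_right[symmetric])
  qed
  also have "\<dots> = (\<Sum>a\<in>?I. cinner (y a) (y a))"
    by (intro sum.cong refl) (simp add: if_distrib[of "\<lambda>c. c * _"] cong: if_cong)
  finally have "complex_of_real (\<Sum>c\<in>?I. (norm (\<Sum>a\<in>?I. scaleC (w a c) (y a)))\<^sup>2)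
      = complex_of_real (\<Sum>a\<in>?I. (norm (y a))\<^sup>2)"
    by (simp add: cinner_norm)
  then have "(\<Sum>c\<in>?I. (norm (\<Sum>a\<in>?I. scaleC (w a c) (y a)))\<^sup>2) = (\<Sum>a\<in>?I. (norm (y a))\<^sup>2)"
    using of_real_eq_iff by blast
  then show ?thesis
    by (simp add: sum.cartesian_product y_def case_prod_unfold)
qed

text \<open>The relation \<open>R\<close> is either \<open>\<le>\<close> or \<open>=\<close>, for contractive and isometric rows respectively.\<close>

lemma row_word_lift_level:
  fixes X :: "nat \<Rightarrow> 'a \<Rightarrow> 'a::complex_inner_space" and R :: "real \<Rightarrow> real \<Rightarrow> bool"
  assumes lin: "\<And>r. r < n \<Longrightarrow> clinear (X r)" and d: "d \<ge> 1"
    and row: "\<And>z. R ((norm (\<Sum>l<n. X l (z l)))\<^sup>2) (\<Sum>l<n. (norm (z l))\<^sup>2)"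
    and R0: "R 0 0" and Radd: "\<And>a b a' b'. R a b \<Longrightarrow> R a' b' \<Longrightarrow> R (a + a') (b + b')"
    and unit: "unitary_mat n d w"
  shows "R (\<Sum>k<word_level d c. (norm (\<Sum>l<n. word_lift d n w X l (x l) k))\<^sup>2)
           (\<Sum>l<n. \<Sum>k<word_level d c. (norm (x l k))\<^sup>2)"
proof (induction c arbitrary: x)
  case 0
  then show ?case by (simp add: R0)
next
  case (Suc c)
  let ?N = "word_level d c"
  \<comment> \<open>What the row meets behind the outgoing letter \<open>q\<close>. As
    \<open>w\<close> is unitary, the total square norm of \<open>y\<close> is that of all tails of
    the tuple \<open>x\<close>; this carries the estimate from one level to the next.\<close>
  define y where "y r q k = (\<Sum>l<n. \<Sum>p<d. scaleC (w (l, p) (r, q)) (x l (Suc (p + d * k))))" for r q k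
  have Rsum: "R (\<Sum>i\<in>I. a i) (\<Sum>i\<in>I. b i)" if "\<And>i. R (a i) (b i)" for I :: "nat set" and a b
    by (induction I rule: infinite_finite_induct) (simp_all add: R0 Radd that)
  have 1: "(\<Sum>l<n. word_lift d n w X l (x l) (Suc (q + d * k))) = (\<Sum>r<n. word_lift d n w X r (y r q) k)"
    if q: "q < d" for q k
  proof -
    have "(\<Sum>r<n. word_lift d n w X r (y r q) k)
        = (\<Sum>r<n. \<Sum>l<n. \<Sum>p<d. scaleC (w (l, p) (r, q)) (word_lift d n w X r (\<lambda>k. x l (Suc (p + d * k))) k))"
      unfolding y_def by (intro sum.cong refl) (simp add: word_lift_sum[OF d lin] word_lift_scaleC[OF d lin])
    also have "\<dots> = (\<Sum>l<n. \<Sum>r<n. \<Sum>p<d. scaleC (w (l, p) (r, q)) (word_lift d n w X r (\<lambda>k. x l (Suc (p + d * k))) k))"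
      by (rule sum.swap)
    also have "\<dots> = (\<Sum>l<n. \<Sum>p<d. \<Sum>r<n. scaleC (w (l, p) (r, q)) (word_lift d n w X r (\<lambda>k. x l (Suc (p + d * k))) k))"
      by (rule sum.cong[OF refl], rule sum.swap)
    finally show ?thesis by (simp add: word_lift_Suc[OF q])
  qed
  have "R (\<Sum>q<d. \<Sum>k<?N. (norm (\<Sum>r<n. word_lift d n w X r (y r q) k))\<^sup>2)
          (\<Sum>q<d. \<Sum>r<n. \<Sum>k<?N. (norm (y r q k))\<^sup>2)"
    by (rule Rsum) (rule Suc.IH)
  also have "(\<Sum>q<d. \<Sum>r<n. \<Sum>k<?N. (norm (y r q k))\<^sup>2) = (\<Sum>k<?N. \<Sum>r<n. \<Sum>q<d. (norm (y r q k))\<^sup>2)"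
    unfolding sum.cartesian_product
    by (rule sum.reindex_bij_witness[of _ "\<lambda>(k,r,q). (q,r,k)" "\<lambda>(q,r,k). (k,r,q)"]) auto
  also have "\<dots> = (\<Sum>k<?N. \<Sum>l<n. \<Sum>p<d. (norm (x l (Suc (p + d * k))))\<^sup>2)"
    by (rule sum.cong[OF refl]) (simp only: y_def unitary_norm_square[OF unit])
  also have "\<dots> = (\<Sum>l<n. \<Sum>p<d. \<Sum>k<?N. (norm (x l (Suc (p + d * k))))\<^sup>2)"
    unfolding sum.cartesian_product
    by (rule sum.reindex_bij_witness[of _ "\<lambda>(l,p,k). (k,l,p)" "\<lambda>(k,l,p). (l,p,k)"]) auto
  finally have "R (\<Sum>q<d. \<Sum>k<?N. (norm (\<Sum>r<n. word_lift d n w X r (y r q) k))\<^sup>2)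
      (\<Sum>l<n. \<Sum>p<d. \<Sum>k<?N. (norm (x l (Suc (p + d * k))))\<^sup>2)" .
  then have "R ((norm (\<Sum>l<n. X l (x l 0)))\<^sup>2 + (\<Sum>q<d. \<Sum>k<?N. (norm (\<Sum>r<n. word_lift d n w X r (y r q) k))\<^sup>2))
     ((\<Sum>l<n. (norm (x l 0))\<^sup>2) + (\<Sum>l<n. \<Sum>p<d. \<Sum>k<?N. (norm (x l (Suc (p + d * k))))\<^sup>2))"
    by (rule Radd[OF row])
  then show ?case
    unfolding word_level.simps sum_word_code by (simp add: 1 sum.distrib)
qed

text \<open>Transposing the recursion exchanges the incoming letter \<open>p\<close> with the
  outgoing letter \<open>q\<close> and conjugates the coefficient, while the row indices
  \<open>l\<close> and \<open>r\<close> stay in place; this is the origin of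
  \<open>partial_adj\<close>.\<close>

lemma word_lift_adjoint_level:
  fixes X X' :: "nat \<Rightarrow> 'a \<Rightarrow> 'a::complex_inner_space"
  assumes adj: "\<And>r. r < n \<Longrightarrow> is_adj (X r) (X' r)"
  shows "l < n \<Longrightarrow> (\<Sum>k<word_level d c. cinner (word_lift d n w X l f k) (g k))
     = (\<Sum>k<word_level d c. cinner (f k) (word_lift d n (partial_adj w) X' l g k))"
proof (induction c arbitrary: l f g)
  case (Suc c)
  let ?N = "word_level d c"
  let ?t = "\<lambda>p f k. f (Suc (p + d * k)) :: 'a"
  have "(\<Sum>q<d. \<Sum>k<?N. cinner (word_lift d n w X l f (Suc (q + d * k))) (g (Suc (q + d * k))))
      = (\<Sum>q<d. \<Sum>k<?N. \<Sum>p<d. \<Sum>r<n. cnj (w (l, p) (r, q)) * cinner (word_lift d n w X r (?t p f) k) (?t q g k))"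
    by (simp add: word_lift_Suc cinner.sum_left cinner_scaleC_left)
  also have "\<dots> = (\<Sum>q<d. \<Sum>p<d. \<Sum>r<n. \<Sum>k<?N. cnj (w (l, p) (r, q)) * cinner (word_lift d n w X r (?t p f) k) (?t q g k))"
    unfolding sum.cartesian_product
    by (rule sum.reindex_bij_witness[of _ "\<lambda>(q,p,r,k). (q,k,p,r)" "\<lambda>(q,k,p,r). (q,p,r,k)"]) auto
  also have "\<dots> = (\<Sum>q<d. \<Sum>p<d. \<Sum>r<n. \<Sum>k<?N. cnj (w (l, p) (r, q)) * cinner (?t p f k) (word_lift d n (partial_adj w) X' r (?t q g) k))"
    unfolding sum_distrib_left[symmetric] by (intro sum.cong refl) (simp add: Suc.IH)
  also have "\<dots> = (\<Sum>p<d. \<Sum>k<?N. \<Sum>q<d. \<Sum>r<n. cnj (w (l, p) (r, q)) * cinner (?t p f k) (word_lift d n (partial_adj w) X' r (?t q g) k))"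
    unfolding sum.cartesian_product
    by (rule sum.reindex_bij_witness[of _ "\<lambda>(p,k,q,r). (q,p,r,k)" "\<lambda>(q,p,r,k). (p,k,q,r)"]) auto
  also have "\<dots> = (\<Sum>p<d. \<Sum>k<?N. cinner (f (Suc (p + d * k))) (word_lift d n (partial_adj w) X' l g (Suc (p + d * k))))"
    by (simp add: word_lift_Suc cinner.sum_right cinner_scaleC_right)
  finally show ?case
    unfolding word_level.simps sum_word_code using Suc.prems by (simp add: is_adjD[OF adj])
qed simp

lemma norm_sum_cinner_le:
  "cmod (\<Sum>k\<in>I. cinner (f k) (g k)) \<le> sqrt (\<Sum>k\<in>I. (norm (f k))\<^sup>2) * sqrt (\<Sum>k\<in>I. (norm (g k))\<^sup>2)"
proof -
  have "cmod (\<Sum>k\<in>I. cinner (f k) (g k)) \<le> (\<Sum>k\<in>I. \<bar>norm (f k)\<bar> * \<bar>norm (g k)\<bar>)"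
    by (rule sum_norm_le) (simp add: norm_cinner_le)
  also have "\<dots> \<le> L2_set (\<lambda>k. norm (f k)) I * L2_set (\<lambda>k. norm (g k)) I"
    by (rule L2_set_mult_ineq)
  finally show ?thesis by (simp add: L2_set_def)
qed

lemma l2seqI_word_level:
  assumes d: "d \<ge> 1" and f: "f \<in> l2seq"
    and le: "\<And>c. (\<Sum>k<word_level d c. (norm (g k))\<^sup>2) \<le> (\<Sum>k<word_level d c. (norm (f k))\<^sup>2)"
  shows "g \<in> l2seq"
proof (rule l2seqI_bounded(1))
  fix N
  have "(\<Sum>k<N. (norm (g k))\<^sup>2) \<le> (\<Sum>k<word_level d N. (norm (g k))\<^sup>2)"
    using word_level_ge[OF d, of N] by (intro sum_mono2) auto
  also have "\<dots> \<le> (\<Sum>k<word_level d N. (norm (f k))\<^sup>2)" by (rule le)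
  also have "\<dots> \<le> (l2norm f)\<^sup>2" by (rule sum_le_l2norm[OF f])
  finally show "(\<Sum>k<N. (norm (g k))\<^sup>2) \<le> (l2norm f)\<^sup>2" .
qed

text \<open>Meaningful once the lift is known to be square-summable, which
  \<open>coord_word_op\<close> and \<open>coord_word_op_adjoint\<close> establish for a row and for
  its adjoint.\<close>

definition word_op :: "nat \<Rightarrow> nat \<Rightarrow> cmat \<Rightarrow> (nat \<Rightarrow> 'a \<Rightarrow> 'a::complex_inner_space)
    \<Rightarrow> nat \<Rightarrow> 'a ell2 \<Rightarrow> 'a ell2" where
  "word_op d n w X l f = Abs_ell2 (word_lift d n w X l (coord f))"

context
  fixes d n :: nat and w :: cmat and X X' :: "nat \<Rightarrow> 'a \<Rightarrow> 'a::complex_inner_space"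
  assumes d: "d \<ge> 1" and adj: "\<And>r. r < n \<Longrightarrow> is_adj (X r) (X' r)"
    and contr: "row_contractive n X" and unit: "unitary_mat n d w"
begin

text \<open>The row estimate for the tuple whose only nonzero entry is \<open>f\<close> in position
  \<open>l\<close>.\<close>

lemma word_lift_level_le:
  assumes l: "l < n"
  shows "(\<Sum>k<word_level d c. (norm (word_lift d n w X l f k))\<^sup>2) \<le> (\<Sum>k<word_level d c. (norm (f k))\<^sup>2)"
proof -
  have lin: "clinear (X r)" if "r < n" for r using adj[OF that] by (rule is_adj_clinear)
  have "(\<Sum>k<word_level d c. (norm (\<Sum>r<n. word_lift d n w X r (\<lambda>k. if r = l then f k else 0) k))\<^sup>2)
      \<le> (\<Sum>r<n. \<Sum>k<word_level d c. (norm (if r = l then f k else 0))\<^sup>2)"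
    by (rule row_word_lift_level[OF lin d _ _ _ unit])
       (use contr in \<open>auto simp: row_contractive_def intro: add_mono\<close>)
  also have "(\<Sum>r<n. \<Sum>k<word_level d c. (norm (if r = l then f k else 0))\<^sup>2)
      = (\<Sum>r<n. if r = l then \<Sum>k<word_level d c. (norm (f k))\<^sup>2 else 0)"
    by (rule sum.cong) auto
  finally have le: "(\<Sum>k<word_level d c. (norm (\<Sum>r<n. word_lift d n w X r (\<lambda>k. if r = l then f k else 0) k))\<^sup>2)
      \<le> (\<Sum>r<n. if r = l then \<Sum>k<word_level d c. (norm (f k))\<^sup>2 else 0)" .
  have "(\<Sum>r<n. word_lift d n w X r (\<lambda>k. if r = l then f k else 0) k) = word_lift d n w X l f k" for k
  proof -
    have "(\<Sum>r<n. word_lift d n w X r (\<lambda>k. if r = l then f k else 0) k)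
        = (\<Sum>r<n. if r = l then word_lift d n w X l f k else 0)"
      by (rule sum.cong) (auto simp: word_lift_zero[OF d lin])
    then show ?thesis using l by simp
  qed
  then show ?thesis using le l by simp
qed

lemma coord_word_op:
  assumes "l < n"
  shows "coord (word_op d n w X l f) = word_lift d n w X l (coord f)"
  unfolding word_op_def
  by (rule coord_Abs, rule l2seqI_word_level[OF d coord[of f]], rule word_lift_level_le[OF assms])

lemma coord_word_op_adjoint:
  assumes l: "l < n"
  shows "coord (word_op d n (partial_adj w) X' l g) = word_lift d n (partial_adj w) X' l (coord g)"
  unfolding word_op_def
proof (rule coord_Abs, rule l2seqI_word_level[OF d coord[of g]])
  fix c
  let ?I = "{..<word_level d c}" and ?L' = "word_lift d n (partial_adj w) X' l (coord g)"
  define a where "a = (\<Sum>k\<in>?I. (norm (?L' k))\<^sup>2)"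
  define b where "b = (\<Sum>k\<in>?I. (norm (coord g k))\<^sup>2)"
  have a0: "a \<ge> 0" "b \<ge> 0" by (simp_all add: a_def b_def sum_nonneg)
  have "complex_of_real a = (\<Sum>k\<in>?I. cinner (?L' k) (?L' k))" by (simp add: a_def cinner_norm)
  also have "\<dots> = (\<Sum>k\<in>?I. cinner (word_lift d n w X l ?L' k) (coord g k))"
    using word_lift_adjoint_level[OF adj l] by simp
  finally have "a = cmod (\<Sum>k\<in>?I. cinner (word_lift d n w X l ?L' k) (coord g k))"
    using a0 by (metis abs_of_nonneg norm_of_real)
  also have "\<dots> \<le> sqrt (\<Sum>k\<in>?I. (norm (word_lift d n w X l ?L' k))\<^sup>2) * sqrt b"
    unfolding b_def by (rule norm_sum_cinner_le)
  also have "\<dots> \<le> sqrt a * sqrt b"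
    unfolding a_def using a0 by (intro mult_right_mono real_sqrt_le_mono word_lift_level_le l) simp
  finally have h: "a \<le> sqrt a * sqrt b" .
  have "a \<le> b"
  proof (cases "a = 0")
    case False
    then have "sqrt a > 0" using a0 by simp
    moreover have "sqrt a * sqrt a \<le> sqrt a * sqrt b"
      using h a0 by (simp only: real_sqrt_mult_self abs_of_nonneg)
    ultimately show ?thesis by (simp only: mult_le_cancel_left_pos real_sqrt_le_iff)
  qed (use a0 in simp)
  then show "(\<Sum>k\<in>?I. (norm (?L' k))\<^sup>2) \<le> (\<Sum>k\<in>?I. (norm (coord g k))\<^sup>2)"
    by (simp only: a_def b_def)
qed

lemma is_adj_word_op:
  assumes l: "l < n"
  shows "is_adj (word_op d n w X l) (word_op d n (partial_adj w) X' l)"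
  unfolding is_adj_def
proof (intro allI)
  fix f g
  have 1: "(\<lambda>c. \<Sum>k<word_level d c. cinner (word_lift d n w X l (coord f) k) (coord g k)) \<longlonglongrightarrow> cinner (word_op d n w X l f) g"
    using tendsto_word_level[OF d sums_cinner_ell2[of "word_op d n w X l f" g]] by (simp add: coord_word_op[OF l])
  have 2: "(\<lambda>c. \<Sum>k<word_level d c. cinner (coord f k) (word_lift d n (partial_adj w) X' l (coord g) k))
      \<longlonglongrightarrow> cinner f (word_op d n (partial_adj w) X' l g)"
    using tendsto_word_level[OF d sums_cinner_ell2[of f "word_op d n (partial_adj w) X' l g"]]
    by (simp add: coord_word_op_adjoint[OF l])
  have 3: "(\<Sum>k<word_level d c. cinner (word_lift d n w X l (coord f) k) (coord g k))
      = (\<Sum>k<word_level d c. cinner (coord f k) (word_lift d n (partial_adj w) X' l (coord g) k))" for c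
    by (rule word_lift_adjoint_level[OF adj l])
  show "cinner (word_op d n w X l f) g = cinner f (word_op d n (partial_adj w) X' l g)"
    using LIMSEQ_unique[OF 1[unfolded 3] 2] .
qed

lemma row_word_op_limits:
  fixes x :: "nat \<Rightarrow> 'a ell2"
  shows "(\<lambda>c. \<Sum>k<word_level d c. (norm (\<Sum>l<n. word_lift d n w X l (coord (x l)) k))\<^sup>2)
      \<longlonglongrightarrow> (norm (\<Sum>l<n. word_op d n w X l (x l)))\<^sup>2"
    and "(\<lambda>c. \<Sum>l<n. \<Sum>k<word_level d c. (norm (coord (x l) k))\<^sup>2) \<longlonglongrightarrow> (\<Sum>l<n. (norm (x l))\<^sup>2)"
proof -
  show "(\<lambda>c. \<Sum>k<word_level d c. (norm (\<Sum>l<n. word_lift d n w X l (coord (x l)) k))\<^sup>2)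
      \<longlonglongrightarrow> (norm (\<Sum>l<n. word_op d n w X l (x l)))\<^sup>2"
    using tendsto_word_level[OF d sums_norm_ell2[of "\<Sum>l<n. word_op d n w X l (x l)"]]
    by (simp add: coord_word_op)
  show "(\<lambda>c. \<Sum>l<n. \<Sum>k<word_level d c. (norm (coord (x l) k))\<^sup>2) \<longlonglongrightarrow> (\<Sum>l<n. (norm (x l))\<^sup>2)"
    by (intro tendsto_sum tendsto_word_level[OF d] sums_norm_ell2)
qed

lemma row_contractive_word_op: "row_contractive n (word_op d n w X)"
  unfolding row_contractive_def
proof
  fix x :: "nat \<Rightarrow> 'a ell2"
  have lin: "clinear (X r)" if "r < n" for r using adj[OF that] by (rule is_adj_clinear)
  have "(\<Sum>k<word_level d c. (norm (\<Sum>l<n. word_lift d n w X l (coord (x l)) k))\<^sup>2)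
      \<le> (\<Sum>l<n. \<Sum>k<word_level d c. (norm (coord (x l) k))\<^sup>2)" for c
    by (rule row_word_lift_level[OF lin d _ _ _ unit])
       (use contr in \<open>auto simp: row_contractive_def intro: add_mono\<close>)
  then show "(norm (\<Sum>l<n. word_op d n w X l (x l)))\<^sup>2 \<le> (\<Sum>l<n. (norm (x l))\<^sup>2)"
    using LIMSEQ_le[OF row_word_op_limits(1)[of x] row_word_op_limits(2)[of x]] by simp
qed

lemma row_isometric_word_op:
  assumes iso: "row_isometric n X"
  shows "row_isometric n (word_op d n w X)"
  unfolding row_isometric_def
proof
  fix x :: "nat \<Rightarrow> 'a ell2"
  have lin: "clinear (X r)" if "r < n" for r using adj[OF that] by (rule is_adj_clinear)
  have "(\<Sum>k<word_level d c. (norm (\<Sum>l<n. word_lift d n w X l (coord (x l)) k))\<^sup>2)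
      = (\<Sum>l<n. \<Sum>k<word_level d c. (norm (coord (x l) k))\<^sup>2)" for c
    by (rule row_word_lift_level[OF lin d _ _ _ unit, where R = "(=)"])
       (use iso in \<open>auto simp: row_isometric_def\<close>)
  then show "(norm (\<Sum>l<n. word_op d n w X l (x l)))\<^sup>2 = (\<Sum>l<n. (norm (x l))\<^sup>2)"
    using LIMSEQ_unique[OF row_word_op_limits(1)[of x]] row_word_op_limits(2)[of x] by simp
qed

end

subsection \<open>The row isometry dilating a row contraction\<close>

text \<open>The creation operator of the letter \<open>p\<close>; its adjoint is the annihilation
  operator \<open>word_tail\<close>.\<close>

definition word_cons :: "nat \<Rightarrow> nat \<Rightarrow> 'a::complex_inner_space ell2 \<Rightarrow> 'a ell2" where
  "word_cons d p f = Abs_ell2 (\<lambda>m. if m > 0 \<and> (m - 1) mod d = p then coord f ((m - 1) div d) else 0)"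

definition word_tail :: "nat \<Rightarrow> nat \<Rightarrow> 'a::complex_inner_space ell2 \<Rightarrow> 'a ell2" where
  "word_tail d p f = Abs_ell2 (\<lambda>n. coord f (Suc (p + d * n)))"

lemma le_word_code: "(d::nat) \<ge> 1 \<Longrightarrow> N \<le> Suc (d * N)"
  by (rule le_SucI) simp

lemma l2seqI_word_code:
  assumes d: "d \<ge> 1" and le: "\<And>N. (\<Sum>k<Suc (d * N). (norm (g k))\<^sup>2) \<le> b"
  shows "g \<in> l2seq"
proof (rule l2seqI_bounded(1))
  fix N :: nat
  have "(\<Sum>k<N. (norm (g k))\<^sup>2) \<le> (\<Sum>k<Suc (d * N). (norm (g k))\<^sup>2)"
    by (rule sum_mono2) (simp_all only: lessThan_subset_iff le_word_code[OF d] finite_lessThan zero_le_power2)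
  then show "(\<Sum>k<N. (norm (g k))\<^sup>2) \<le> b" using le[of N] by linarith
qed

lemma tendsto_word_code:
  assumes "d \<ge> 1" "g sums s"
  shows "(\<lambda>N. \<Sum>n<Suc (d * N). g n) \<longlonglongrightarrow> s"
proof -
  have "filterlim (\<lambda>N. Suc (d * N)) sequentially sequentially"
    by (rule filterlim_at_top_mono[OF filterlim_ident])
       (rule always_eventually, rule allI, rule le_word_code[OF assms(1)])
  from filterlim_compose[OF assms(2)[unfolded sums_def] this] show ?thesis .
qed

lemma coord_word_cons:
  assumes d: "d \<ge> 1" and p: "p < d"
  shows "coord (word_cons d p f) 0 = 0"
    and "q < d \<Longrightarrow> coord (word_cons d p f) (Suc (q + d * n)) = (if q = p then coord f n else 0)"
proof -
  let ?g = "\<lambda>m. if m > 0 \<and> (m - 1) mod d = p then coord f ((m - 1) div d) else 0"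
  have S: "?g (Suc (q + d * n)) = (if q = p then coord f n else 0)" if "q < d" for q n
    using that by simp
  have "?g \<in> l2seq"
  proof (rule l2seqI_word_code[OF d])
    fix N
    have "(\<Sum>k<Suc (d * N). (norm (?g k))\<^sup>2) = (\<Sum>q<d. \<Sum>n<N. (norm (?g (Suc (q + d * n))))\<^sup>2)"
      unfolding sum_word_code by simp
    also have "\<dots> = (\<Sum>q<d. if q = p then \<Sum>n<N. (norm (coord f n))\<^sup>2 else 0)"
      by (rule sum.cong) (auto simp: S)
    also have "\<dots> \<le> (l2norm (coord f))\<^sup>2" using p by (simp add: sum_le_l2norm)
    finally show "(\<Sum>k<Suc (d * N). (norm (?g k))\<^sup>2) \<le> (l2norm (coord f))\<^sup>2" .
  qed
  then have *: "coord (word_cons d p f) = ?g" by (simp add: word_cons_def)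
  show "coord (word_cons d p f) 0 = 0" by (simp add: *)
  show "coord (word_cons d p f) (Suc (q + d * n)) = (if q = p then coord f n else 0)" if "q < d"
    using that by (simp add: *)
qed

lemma coord_word_tail:
  assumes p: "p < d"
  shows "coord (word_tail d p f) n = coord f (Suc (p + d * n))"
proof -
  have "(\<lambda>n. coord f (Suc (p + d * n))) \<in> l2seq"
  proof (rule l2seqI_bounded(1))
    fix N
    have "(\<Sum>n<N. (norm (coord f (Suc (p + d * n))))\<^sup>2) \<le> (\<Sum>q<d. \<Sum>n<N. (norm (coord f (Suc (q + d * n))))\<^sup>2)"
      by (rule member_le_sum[of p "{..<d}" "\<lambda>q. \<Sum>n<N. (norm (coord f (Suc (q + d * n))))\<^sup>2"])
         (use p in \<open>auto simp: sum_nonneg\<close>)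
    also have "\<dots> \<le> (\<Sum>k<Suc (d * N). (norm (coord f k))\<^sup>2)"
      unfolding sum_word_code by simp
    also have "\<dots> \<le> (l2norm (coord f))\<^sup>2" by (rule sum_le_l2norm) simp
    finally show "(\<Sum>n<N. (norm (coord f (Suc (p + d * n))))\<^sup>2) \<le> (l2norm (coord f))\<^sup>2" .
  qed
  then show ?thesis by (simp add: word_tail_def)
qed

lemma is_adj_word_cons:
  assumes d: "d \<ge> 1" and p: "p < d"
  shows "is_adj (word_cons d p) (word_tail d p)"
  unfolding is_adj_def
proof (intro allI)
  fix f g :: "'a ell2"
  have "(\<Sum>n<Suc (d * N). cinner (coord (word_cons d p f) n) (coord g n))
      = (\<Sum>n<N. cinner (coord f n) (coord (word_tail d p g) n))" for N
  proof -
    have "(\<Sum>n<Suc (d * N). cinner (coord (word_cons d p f) n) (coord g n))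
        = (\<Sum>q<d. if q = p then \<Sum>n<N. cinner (coord f n) (coord g (Suc (p + d * n))) else 0)"
      unfolding sum_word_code coord_word_cons(1)[OF d p]
      by (simp only: cinner.zero_left add_0, rule sum.cong) (auto simp: coord_word_cons(2)[OF d p])
    then show ?thesis using p by (simp add: coord_word_tail[OF p])
  qed
  then have "(\<lambda>N. \<Sum>n<N. cinner (coord f n) (coord (word_tail d p g) n)) \<longlonglongrightarrow> cinner (word_cons d p f) g"
    using tendsto_word_code[OF d sums_cinner_ell2[of "word_cons d p f" g]] by simp
  then show "cinner (word_cons d p f) g = cinner f (word_tail d p g)"
    using LIMSEQ_unique[OF _ sums_cinner_ell2[of f "word_tail d p g", unfolded sums_def]] by simp
qed

text \<open>The code \<open>Suc p\<close> is that of the one-letter word \<open>p\<close>, so the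
  one-letter level is a copy of the \<open>d\<close>-fold direct sum and receives the defect. Longer
  words arise by creation on the left, and their last letter keeps naming the component of the
  direct sum. The vacuum component is removed before creation because the defect takes its
  place.\<close>

definition dil_op :: "nat \<Rightarrow> (nat \<Rightarrow> 'a \<Rightarrow> 'a::complex_inner_space) \<Rightarrow> (nat \<Rightarrow> nat \<Rightarrow> 'a \<Rightarrow> 'a)
    \<Rightarrow> nat \<Rightarrow> 'a ell2 \<Rightarrow> 'a ell2" where
  "dil_op d A D l f = single 0 (A l (coord f 0)) + (\<Sum>p<d. single (Suc p) (D l p (coord f 0)))
     + word_cons d l (f - single 0 (coord f 0))"

definition dil_adj :: "nat \<Rightarrow> (nat \<Rightarrow> 'a \<Rightarrow> 'a::complex_inner_space) \<Rightarrow> (nat \<Rightarrow> nat \<Rightarrow> 'a \<Rightarrow> 'a)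
    \<Rightarrow> nat \<Rightarrow> 'a ell2 \<Rightarrow> 'a ell2" where
  "dil_adj d B D l g = single 0 (B l (coord g 0)) + (\<Sum>p<d. single 0 (D p l (coord g (Suc p))))
     + (word_tail d l g - single 0 (coord (word_tail d l g) 0))"

lemma is_adj_dil_op:
  assumes d: "d \<ge> 1" and l: "l < d" and AB: "is_adj (A l) (B l)" and D: "\<And>l p. is_adj (D l p) (D p l)"
  shows "is_adj (dil_op d A D l) (dil_adj d B D l)"
proof -
  have c: "is_adj (\<lambda>f. coord f m) (single m)" for m by (rule is_adj_sym[OF is_adj_single])
  have 1: "is_adj (\<lambda>f. single 0 (A l (coord f 0))) (\<lambda>g. single 0 (B l (coord g 0)))"
    by (rule is_adj_comp[OF is_adj_single is_adj_comp[OF AB c]])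
  have 2: "is_adj (\<lambda>f. \<Sum>p<d. single (Suc p) (D l p (coord f 0))) (\<lambda>g. \<Sum>p<d. single 0 (D p l (coord g (Suc p))))"
    by (rule is_adj_sum, rule is_adj_comp[OF is_adj_single is_adj_comp[OF D c]])
  have 3: "is_adj (\<lambda>f. f - single 0 (coord f 0)) (\<lambda>f. f - single 0 (coord f 0))"
    by (rule is_adj_diff[OF is_adj_id is_adj_comp[OF is_adj_single c]])
  have 4: "is_adj (\<lambda>f. word_cons d l (f - single 0 (coord f 0)))
      (\<lambda>g. word_tail d l g - single 0 (coord (word_tail d l g) 0))"
    by (rule is_adj_comp[OF is_adj_word_cons[OF d l] 3])
  show ?thesis
    using is_adj_add[OF is_adj_add[OF 1 2] 4] by (simp add: is_adj_def dil_op_def dil_adj_def)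
qed

lemma coord_dil_op:
  assumes d: "d \<ge> 1" and l: "l < d"
  shows "coord (dil_op d A D l f) 0 = A l (coord f 0)"
    and "p < d \<Longrightarrow> coord (dil_op d A D l f) (Suc (p + d * n))
       = (if n = 0 then D l p (coord f 0) else if p = l then coord f n else 0)"
proof -
  show "coord (dil_op d A D l f) 0 = A l (coord f 0)"
    by (simp add: dil_op_def coord_single coord_word_cons[OF d l])
  assume p: "p < d"
  have "(\<Sum>q<d. if p + d * n = q then D l q (coord f 0) else 0) = (if n = 0 then D l p (coord f 0) else 0)"
    using p by (cases n) auto
  then show "coord (dil_op d A D l f) (Suc (p + d * n))
       = (if n = 0 then D l p (coord f 0) else if p = l then coord f n else 0)"
    using p by (simp add: dil_op_def coord_single coord_word_cons[OF d l])
qed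

text \<open>At the empty word and at one-letter words the vacuum components of the
  \<open>x l\<close> appear through \<open>A\<close> and \<open>D\<close>, and the defect identity
  restores their norm. At longer words each other component of each \<open>x l\<close> occurs
  exactly once, behind the letter \<open>l\<close>.\<close>

lemma row_isometric_dil_op:
  assumes d: "d \<ge> 1"
    and D: "\<And>x. (\<Sum>p<d. (norm (\<Sum>l<d. D l p (x l)))\<^sup>2) + (norm (\<Sum>l<d. A l (x l)))\<^sup>2 = (\<Sum>l<d. (norm (x l))\<^sup>2)"
  shows "row_isometric d (dil_op d A D)"
  unfolding row_isometric_def
proof
  fix x :: "nat \<Rightarrow> 'a ell2"
  let ?y = "\<Sum>l<d. dil_op d A D l (x l)"
  have y0: "coord ?y 0 = (\<Sum>l<d. A l (coord (x l) 0))"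
    by (simp add: coord_dil_op[OF d])
  have y1: "coord ?y (Suc p) = (\<Sum>l<d. D l p (coord (x l) 0))" if "p < d" for p
    using coord_dil_op(2)[OF d _ that, of _ A D _ 0] by simp
  have yS: "coord ?y (Suc (p + d * n)) = coord (x p) n" if "p < d" "n > 0" for p n
  proof -
    have "coord ?y (Suc (p + d * n)) = (\<Sum>l<d. if p = l then coord (x l) n else 0)"
      unfolding coord_sum using that by (intro sum.cong refl) (simp add: coord_dil_op(2)[OF d])
    then show ?thesis using that by simp
  qed
  \<comment> \<open>\<open>Suc N\<close> leaves room to split off \<open>n = 0\<close>, that is, the
    one-letter words.\<close>
  have "(\<Sum>m<Suc (d * Suc N). (norm (coord ?y m))\<^sup>2) = (\<Sum>l<d. \<Sum>n<Suc N. (norm (coord (x l) n))\<^sup>2)" for N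
  proof -
    have "(\<Sum>m<Suc (d * Suc N). (norm (coord ?y m))\<^sup>2)
        = (norm (coord ?y 0))\<^sup>2 + (\<Sum>p<d. (norm (coord ?y (Suc p)))\<^sup>2 + (\<Sum>n<N. (norm (coord ?y (Suc (p + d * Suc n))))\<^sup>2))"
      unfolding sum_word_code unfolding sum.lessThan_Suc_shift
      by (simp only: mult_0_right add_0_right)
    also have "\<dots> = ((\<Sum>p<d. (norm (\<Sum>l<d. D l p (coord (x l) 0)))\<^sup>2) + (norm (\<Sum>l<d. A l (coord (x l) 0)))\<^sup>2)
        + (\<Sum>p<d. \<Sum>n<N. (norm (coord (x p) (Suc n)))\<^sup>2)"
      by (simp only: y0 sum.distrib) (simp add: y1 yS del: coord_sum mult_Suc_right)
    also have "\<dots> = (\<Sum>l<d. \<Sum>n<Suc N. (norm (coord (x l) n))\<^sup>2)"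
      unfolding D sum.lessThan_Suc_shift by (simp add: sum.distrib)
    finally show ?thesis .
  qed
  moreover have "(\<lambda>N. \<Sum>m<Suc (d * Suc N). (norm (coord ?y m))\<^sup>2) \<longlonglongrightarrow> (norm ?y)\<^sup>2"
    by (rule LIMSEQ_Suc[OF tendsto_word_code[OF d sums_norm_ell2]])
  moreover have "(\<lambda>N. \<Sum>l<d. \<Sum>n<Suc N. (norm (coord (x l) n))\<^sup>2) \<longlonglongrightarrow> (\<Sum>l<d. (norm (x l))\<^sup>2)"
    by (intro tendsto_sum LIMSEQ_Suc[OF sums_norm_ell2[unfolded sums_def]])
  ultimately show "(norm ?y)\<^sup>2 = (\<Sum>l<d. (norm (x l))\<^sup>2)"
    using LIMSEQ_unique by simp
qed

text \<open>Lifts preserve the length of words, so the value at the empty word does not enter at a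
  nonempty one.\<close>

lemma word_lift_cong_pos:
  assumes d: "d \<ge> 1" and "\<And>k. k > 0 \<Longrightarrow> f k = g k" and "j > 0"
  shows "word_lift d n w X r f j = word_lift d n w X r g j"
  using d by (rule word_code_cases[of d j]) (use assms in \<open>simp_all add: word_lift_Suc\<close>)

text \<open>At the empty word this is the relation with \<open>A\<close>, at one-letter words the
  commutation with the defect operator. At longer words \<open>dil_op\<close> is creation of a
  letter, and the recursion of the lift is the relation itself.\<close>

lemma word_lift_dil_op_commute:
  assumes d: "d \<ge> 1" and lin: "\<And>r. r < n \<Longrightarrow> clinear (X r)"
    and tc: "twisted_commute n d w X A"
    and D: "\<And>l p c h. l < n \<Longrightarrow> p < d \<Longrightarrow> c < d \<Longrightarrow>
        (\<Sum>b<d. \<Sum>r<n. scaleC (w (l, b) (r, c)) (X r (D p b h)))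
          = (\<Sum>r<n. \<Sum>q<d. scaleC (w (l, p) (r, q)) (D q c (X r h)))"
    and cX: "\<And>r f. r < n \<Longrightarrow> coord (X' r f) = word_lift d n w X r (coord f)"
  shows "twisted_commute n d w X' (dil_op d A D)"
  unfolding twisted_commute_def
proof (intro allI impI)
  fix l p and f :: "'a ell2"
  assume l: "l < n" and p: "p < d"
  show "X' l (dil_op d A D p f) = (\<Sum>r<n. \<Sum>q<d. scaleC (w (l, p) (r, q)) (dil_op d A D q (X' r f)))"
  proof (rule ell2_eqI)
    fix m
    show "coord (X' l (dil_op d A D p f)) m
        = coord (\<Sum>r<n. \<Sum>q<d. scaleC (w (l, p) (r, q)) (dil_op d A D q (X' r f))) m"
    proof (rule word_code_cases[OF d, of m])
      assume "m = 0"
      then show ?thesis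
        using l p by (simp add: cX coord_dil_op[OF d] twisted_commuteD[OF tc])
    next
      fix c j assume c: "c < d" and m: "m = Suc (c + d * j)"
      have L: "coord (X' l (dil_op d A D p f)) m
          = (\<Sum>b<d. \<Sum>r<n. scaleC (w (l, b) (r, c)) (word_lift d n w X r (\<lambda>j. coord (dil_op d A D p f) (Suc (b + d * j))) j))"
        using l c by (simp add: m cX word_lift_Suc)
      show ?thesis
      proof (cases "j = 0")
        case True
        then show ?thesis unfolding L
          using D[OF l p c, of "coord f 0"] c p by (simp add: m coord_dil_op[OF d] cX del: mult_0_right)
            (simp add: coord_dil_op(2)[OF d, where n = 0, simplified] cX)
      next
        case False
        have "(\<Sum>b<d. \<Sum>r<n. scaleC (w (l, b) (r, c)) (word_lift d n w X r (\<lambda>j. coord (dil_op d A D p f) (Suc (b + d * j))) j))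
            = (\<Sum>b<d. if b = p then \<Sum>r<n. scaleC (w (l, p) (r, c)) (word_lift d n w X r (coord f) j) else 0)"
        proof (rule sum.cong[OF refl])
          fix b assume b: "b \<in> {..<d}"
          have "word_lift d n w X r (\<lambda>j. coord (dil_op d A D p f) (Suc (b + d * j))) j
              = (if b = p then word_lift d n w X r (coord f) j else 0)" if "r < n" for r
          proof -
            have "word_lift d n w X r (\<lambda>j. coord (dil_op d A D p f) (Suc (b + d * j))) j
                = word_lift d n w X r (if b = p then coord f else (\<lambda>m. 0)) j"
              by (rule word_lift_cong_pos[OF d]) (use b p False in \<open>auto simp: coord_dil_op(2)[OF d]\<close>)
            then show ?thesis by (simp add: word_lift_zero[OF d lin that])
          qed
          then show "(\<Sum>r<n. scaleC (w (l, b) (r, c)) (word_lift d n w X r (\<lambda>j. coord (dil_op d A D p f) (Suc (b + d * j))) j))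
              = (if b = p then \<Sum>r<n. scaleC (w (l, p) (r, c)) (word_lift d n w X r (coord f) j) else 0)"
            by simp
        qed
        also have "\<dots> = (\<Sum>r<n. scaleC (w (l, p) (r, c)) (word_lift d n w X r (coord f) j))"
          using p by simp
        also have "\<dots> = (\<Sum>r<n. \<Sum>q<d. if c = q then scaleC (w (l, p) (r, q)) (word_lift d n w X r (coord f) j) else 0)"
          using c by simp
        also have "\<dots> = coord (\<Sum>r<n. \<Sum>q<d. scaleC (w (l, p) (r, q)) (dil_op d A D q (X' r f))) m"
          unfolding coord_sum
          by (intro sum.cong refl) (use c False in \<open>auto simp: m coord_dil_op(2)[OF d] cX\<close>)
        finally show ?thesis unfolding L .
      qed
    qed
  qed
qed

subsection \<open>Systems of doubly commuting row contractions\<close>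

text \<open>The relation is multiplied by conjugate entries of \<open>wY\<close> on both outer pairs
  of indices and summed. On either side one of the two factors cancels \<open>wY\<close> by
  unitarity, so its conjugate reappears in the opposite position; conjugating the result gives the
  claim. This is what allows the adjoint of one row and another row to be lifted together.\<close>

lemma yang_baxter_partial_adj:
  assumes yb: "yang_baxter d n m wX wY v" and unit: "unitary_mat m d wY"
  shows "yang_baxter d n m (partial_adj wX) wY (partial_adj v)"
  unfolding yang_baxter_def
proof (intro allI impI)
  fix q r a c p l
  assume q: "q < n" and r: "r < m" and a: "a < d" and c: "c < d" and p: "p < n" and l: "l < m"
  let ?I = "{..<m} \<times> {..<d}"
  define F where "F x y = (\<Sum>s<n. \<Sum>z\<in>?I. wX (q, snd z) (s, snd y) * wY x z * v (s, fst z) (p, fst y))" for x y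
  define G where "G x y = (\<Sum>s<n. \<Sum>z\<in>?I. v (q, fst x) (s, fst z) * wY z y * wX (s, snd x) (p, snd z))" for x y
  have FG: "F x y = G x y" if "x \<in> ?I" "y \<in> ?I" for x y
    using yb q p that unfolding yang_baxter_def F_def G_def
    by (cases x; cases y) (simp add: sum.cartesian_product')
  have u1: "(\<Sum>x\<in>?I. cnj (wY x (l, c)) * wY x z) = (if (l, c) = z then 1 else 0)" if "z \<in> ?I" for z
    using unit that l c unfolding unitary_mat_def by blast
  have u2: "(\<Sum>y\<in>?I. wY z y * cnj (wY (r, a) y)) = (if z = (r, a) then 1 else 0)" if "z \<in> ?I" for z
    using unit that r a unfolding unitary_mat_def by blast
  have "(\<Sum>x\<in>?I. \<Sum>y\<in>?I. cnj (wY x (l, c)) * cnj (wY (r, a) y) * F x y)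
      = (\<Sum>x\<in>?I. \<Sum>y\<in>?I. \<Sum>s<n. \<Sum>z\<in>?I. (cnj (wY x (l, c)) * wY x z)
           * (wX (q, snd z) (s, snd y) * cnj (wY (r, a) y) * v (s, fst z) (p, fst y)))"
    by (simp add: F_def sum_distrib_left mult_ac)
  also have "\<dots> = (\<Sum>s<n. \<Sum>y\<in>?I. \<Sum>z\<in>?I. \<Sum>x\<in>?I. (cnj (wY x (l, c)) * wY x z)
           * (wX (q, snd z) (s, snd y) * cnj (wY (r, a) y) * v (s, fst z) (p, fst y)))"
    unfolding sum.cartesian_product
    by (rule sum.reindex_bij_witness[of _ "\<lambda>(s,y,z,x). (x,y,s,z)" "\<lambda>(x,y,s,z). (s,y,z,x)"]) auto
  also have "\<dots> = (\<Sum>s<n. \<Sum>y\<in>?I. \<Sum>z\<in>?I. (if (l, c) = z then 1 else 0)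
           * (wX (q, snd z) (s, snd y) * cnj (wY (r, a) y) * v (s, fst z) (p, fst y)))"
    unfolding sum_distrib_right[symmetric] by (intro sum.cong refl) (simp add: u1)
  also have "\<dots> = (\<Sum>s<n. \<Sum>y\<in>?I. wX (q, c) (s, snd y) * cnj (wY (r, a) y) * v (s, l) (p, fst y))"
    using l c by (intro sum.cong refl) (simp add: if_distrib[of "\<lambda>c. c * _"] cong: if_cong)
  finally have 1: "(\<Sum>x\<in>?I. \<Sum>y\<in>?I. cnj (wY x (l, c)) * cnj (wY (r, a) y) * F x y)
      = (\<Sum>s<n. \<Sum>y\<in>?I. wX (q, c) (s, snd y) * cnj (wY (r, a) y) * v (s, l) (p, fst y))" .
  have "(\<Sum>x\<in>?I. \<Sum>y\<in>?I. cnj (wY x (l, c)) * cnj (wY (r, a) y) * G x y)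
      = (\<Sum>x\<in>?I. \<Sum>y\<in>?I. \<Sum>s<n. \<Sum>z\<in>?I. (wY z y * cnj (wY (r, a) y))
           * (v (q, fst x) (s, fst z) * cnj (wY x (l, c)) * wX (s, snd x) (p, snd z)))"
    by (simp add: G_def sum_distrib_left mult_ac)
  also have "\<dots> = (\<Sum>s<n. \<Sum>x\<in>?I. \<Sum>z\<in>?I. \<Sum>y\<in>?I. (wY z y * cnj (wY (r, a) y))
           * (v (q, fst x) (s, fst z) * cnj (wY x (l, c)) * wX (s, snd x) (p, snd z)))"
    unfolding sum.cartesian_product
    by (rule sum.reindex_bij_witness[of _ "\<lambda>(s,x,z,y). (x,y,s,z)" "\<lambda>(x,y,s,z). (s,x,z,y)"]) auto
  also have "\<dots> = (\<Sum>s<n. \<Sum>x\<in>?I. \<Sum>z\<in>?I. (if z = (r, a) then 1 else 0)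
           * (v (q, fst x) (s, fst z) * cnj (wY x (l, c)) * wX (s, snd x) (p, snd z)))"
    unfolding sum_distrib_right[symmetric] by (intro sum.cong refl) (simp add: u2)
  also have "\<dots> = (\<Sum>s<n. \<Sum>x\<in>?I. v (q, fst x) (s, r) * cnj (wY x (l, c)) * wX (s, snd x) (p, a))"
    using r a by (intro sum.cong refl) (simp add: if_distrib[of "\<lambda>c. c * _"] cong: if_cong)
  finally have 2: "(\<Sum>x\<in>?I. \<Sum>y\<in>?I. cnj (wY x (l, c)) * cnj (wY (r, a) y) * G x y)
      = (\<Sum>s<n. \<Sum>x\<in>?I. v (q, fst x) (s, r) * cnj (wY x (l, c)) * wX (s, snd x) (p, a))" .
  have "(\<Sum>x\<in>?I. \<Sum>y\<in>?I. cnj (wY x (l, c)) * cnj (wY (r, a) y) * F x y)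
      = (\<Sum>x\<in>?I. \<Sum>y\<in>?I. cnj (wY x (l, c)) * cnj (wY (r, a) y) * G x y)"
    by (intro sum.cong refl) (simp only: FG)
  then have "(\<Sum>s<n. \<Sum>y\<in>?I. wX (q, c) (s, snd y) * cnj (wY (r, a) y) * v (s, l) (p, fst y))
      = (\<Sum>s<n. \<Sum>x\<in>?I. v (q, fst x) (s, r) * cnj (wY x (l, c)) * wX (s, snd x) (p, a))"
    unfolding 1 2 .
  then have "cnj (\<Sum>s<n. \<Sum>t<m. \<Sum>b<d. wX (q, c) (s, b) * cnj (wY (r, a) (t, b)) * v (s, l) (p, t))
      = cnj (\<Sum>s<n. \<Sum>t<m. \<Sum>b<d. v (q, t) (s, r) * cnj (wY (t, b) (l, c)) * wX (s, b) (p, a))"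
    by (simp add: sum.cartesian_product' del: complex_cnj_cancel_iff)
  then show "(\<Sum>s<n. \<Sum>t<m. \<Sum>b<d. partial_adj wX (q, b) (s, c) * wY (r, a) (t, b) * partial_adj v (s, t) (p, l))
      = (\<Sum>s<n. \<Sum>t<m. \<Sum>b<d. partial_adj v (q, r) (s, t) * wY (t, b) (l, c) * partial_adj wX (s, a) (p, b))"
    by (simp del: complex_cnj_cancel_iff)
qed

text \<open>The conditions on the maps \<open>t\<close> in matrix form; together with unitarity,
  \<open>flip\<close> expresses that the map for \<open>(j, i)\<close> inverts the one for
  \<open>(i, j)\<close>. In \<open>yb\<close>, row \<open>i\<close> supplies the letters of the
  words, and \<open>j\<close>, \<open>j'\<close> are the rows lifted over them.\<close>

locale twist =
  fixes k :: nat and d :: "nat \<Rightarrow> nat" and u :: "nat \<Rightarrow> nat \<Rightarrow> cmat"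
  assumes d_pos: "i < k \<Longrightarrow> 1 \<le> d i"
    and unitary: "i < k \<Longrightarrow> j < k \<Longrightarrow> unitary_mat (d i) (d j) (u i j)"
    and flip: "i < k \<Longrightarrow> j < k \<Longrightarrow> l < d j \<Longrightarrow> p < d i \<Longrightarrow> m < d j \<Longrightarrow> q < d i \<Longrightarrow>
      u j i (l, p) (m, q) = cnj (u i j (q, m) (p, l))"
    and yb: "i < k \<Longrightarrow> j < k \<Longrightarrow> j' < k \<Longrightarrow> yang_baxter (d i) (d j) (d j') (u j i) (u j' i) (u j j')"
begin

text \<open>With the adjoints \<open>B\<close> as data, condition (b) becomes a second twisted
  commutation, between \<open>B i\<close> and \<open>A j\<close>, to which the same lemmas apply as
  to condition (a).\<close>

definition dc_system :: "(nat \<Rightarrow> nat \<Rightarrow> 'a \<Rightarrow> 'a::complex_inner_space) \<Rightarrow> (nat \<Rightarrow> nat \<Rightarrow> 'a \<Rightarrow> 'a) \<Rightarrow> bool" where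
  "dc_system A B \<longleftrightarrow>
     (\<forall>j<k. \<forall>l<d j. is_adj (A j l) (B j l)) \<and> (\<forall>j<k. row_contractive (d j) (A j)) \<and>
     (\<forall>i<k. \<forall>j<k. i \<noteq> j \<longrightarrow> twisted_commute (d i) (d j) (u i j) (A i) (A j)
        \<and> twisted_commute (d i) (d j) (partial_adj (u i j)) (B i) (A j))"

lemma dc_systemD:
  assumes "dc_system A B"
  shows "j < k \<Longrightarrow> l < d j \<Longrightarrow> is_adj (A j l) (B j l)"
    and "j < k \<Longrightarrow> row_contractive (d j) (A j)"
    and "i < k \<Longrightarrow> j < k \<Longrightarrow> i \<noteq> j \<Longrightarrow> twisted_commute (d i) (d j) (u i j) (A i) (A j)"
    and "i < k \<Longrightarrow> j < k \<Longrightarrow> i \<noteq> j \<Longrightarrow> twisted_commute (d i) (d j) (partial_adj (u i j)) (B i) (A j)"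
  using assms by (auto simp: dc_system_def)

text \<open>The adjoint of condition (b) for one order of two rows is condition (b) for the other
  order; \<open>flip\<close> matches the coefficients.\<close>

lemma twisted_commute_swap:
  assumes ij: "i < k" "j < k"
    and A: "\<And>l. l < d j \<Longrightarrow> is_adj (A l) (A' l)" and V: "\<And>l. l < d i \<Longrightarrow> is_adj (V l) (V' l)"
    and tc: "twisted_commute (d j) (d i) (partial_adj (u j i)) A' V"
  shows "twisted_commute (d i) (d j) (partial_adj (u i j)) V' A"
  unfolding twisted_commute_def
proof (intro allI impI)
  fix p l x assume p: "p < d i" and l: "l < d j"
  have "V' p (A l x) = (\<Sum>r<d j. \<Sum>q<d i. scaleC (u j i (l, q) (r, p)) (A r (V' q x)))"
    using twisted_commute_adjoint[OF tc is_adj_sym[OF A] V l p] by simp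
  also have "\<dots> = (\<Sum>q<d i. \<Sum>r<d j. scaleC (u j i (l, q) (r, p)) (A r (V' q x)))"
    by (rule sum.swap)
  finally show "V' p (A l x) = (\<Sum>q<d i. \<Sum>r<d j. scaleC (partial_adj (u i j) (p, l) (q, r)) (A r (V' q x)))"
    using p l by (simp add: flip[OF ij])
qed

text \<open>The last clause says that the adjoints leave coordinate 0 invariant and act there as
  before; it is the part of the dilation property that the induction preserves.\<close>

lemma dilate_one_row:
  fixes A B :: "nat \<Rightarrow> nat \<Rightarrow> 'a::{complex_inner_space, complete_space} \<Rightarrow> 'a"
  assumes sys: "dc_system A B" and i: "i < k"
  shows "\<exists>A' B' :: nat \<Rightarrow> nat \<Rightarrow> 'a ell2 \<Rightarrow> 'a ell2. dc_system A' B' \<and> row_isometric (d i) (A' i)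
    \<and> (\<forall>j<k. row_isometric (d j) (A j) \<longrightarrow> row_isometric (d j) (A' j))
    \<and> (\<forall>j<k. \<forall>l<d j. \<forall>h. B' j l (single 0 h) = single 0 (B j l h))"
proof -
  note adj = dc_systemD(1)[OF sys] and contr = dc_systemD(2)[OF sys]
    and tcA = dc_systemD(3)[OF sys] and tcB = dc_systemD(4)[OF sys]
  have linA: "clinear (A j l)" if "j < k" "l < d j" for j l
    using adj[OF that] by (rule is_adj_clinear)
  have linB: "clinear (B j l)" if "j < k" "l < d j" for j l
    using adj[OF that] by (rule is_adj_clinear2)
  have nA: "norm (A j l x) \<le> norm x" if "j < k" "l < d j" for j l x
    using row_contractive_norm_le[OF contr[OF that(1)] that(2) linA[OF that(1)]] .
  have nB: "norm (B j l x) \<le> norm x" if "j < k" "l < d j" for j l x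
    using norm_adjoint_contraction[OF adj[OF that] nA[OF that]] .
  obtain D where D1: "\<And>l p. is_adj (D l p) (D p l)"
    and D2: "\<And>x. (\<Sum>p<d i. (norm (\<Sum>l<d i. D l p (x l)))\<^sup>2) + (norm (\<Sum>l<d i. A i l (x l)))\<^sup>2 = (\<Sum>l<d i. (norm (x l))\<^sup>2)"
    and D3: "\<And>n w X l p c h. (\<And>r. r < n \<Longrightarrow> bounded_linear (X r)) \<Longrightarrow> (\<And>r. r < n \<Longrightarrow> clinear (X r)) \<Longrightarrow>
        twisted_commute n (d i) w X (A i) \<Longrightarrow>
        (\<And>q l x. q < d i \<Longrightarrow> l < n \<Longrightarrow> B i q (X l x) = (\<Sum>r<n. \<Sum>p<d i. scaleC (w (l, p) (r, q)) (X r (B i p x)))) \<Longrightarrow>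
        l < n \<Longrightarrow> p < d i \<Longrightarrow> c < d i \<Longrightarrow>
        (\<Sum>b<d i. \<Sum>r<n. scaleC (w (l, b) (r, c)) (X r (D p b h)))
          = (\<Sum>r<n. \<Sum>q<d i. scaleC (w (l, p) (r, q)) (D q c (X r h)))"
    using defect_operator_exists[of "d i" "A i" "B i", OF adj[OF i] contr[OF i]] by blast
  note di = d_pos[OF i]
  define V where "V = dil_op (d i) (A i) D"
  define V' where "V' = dil_adj (d i) (B i) D"
  define LA where "LA j = word_op (d i) (d j) (u j i) (A j)" for j
  define LB where "LB j = word_op (d i) (d j) (partial_adj (u j i)) (B j)" for j
  define A' where "A' j = (if j = i then V else LA j)" for j
  define B' where "B' j = (if j = i then V' else LB j)" for j
  have adjV: "is_adj (V l) (V' l)" if "l < d i" for l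
    unfolding V_def V'_def by (rule is_adj_dil_op[where A = "A i" and B = "B i" and D = D, OF di that adj[OF i that] D1])
  have isoV: "row_isometric (d i) V"
    unfolding V_def by (rule row_isometric_dil_op[OF di D2])
  have adjL: "is_adj (LA j l) (LB j l)" if "j < k" "l < d j" for j l
    unfolding LA_def LB_def
    using is_adj_word_op[OF di adj[OF that(1)] contr[OF that(1)] unitary[OF that(1) i] that(2)] .
  have contrL: "row_contractive (d j) (LA j)" if "j < k" for j
    unfolding LA_def
    using row_contractive_word_op[OF di adj[OF that] contr[OF that] unitary[OF that i]] .
  have isoL: "row_isometric (d j) (LA j)" if "j < k" "row_isometric (d j) (A j)" for j
    unfolding LA_def
    using row_isometric_word_op[OF di adj[OF that(1)] contr[OF that(1)] unitary[OF that(1) i] that(2)] .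
  have cLA: "coord (LA j l f) = word_lift (d i) (d j) (u j i) (A j) l (coord f)" if "j < k" "l < d j" for j l f
    unfolding LA_def
    using coord_word_op[OF di adj[OF that(1)] contr[OF that(1)] unitary[OF that(1) i] that(2)] .
  have cLB: "coord (LB j l f) = word_lift (d i) (d j) (partial_adj (u j i)) (B j) l (coord f)" if "j < k" "l < d j" for j l f
    unfolding LB_def
    using coord_word_op_adjoint[OF di adj[OF that(1)] contr[OF that(1)] unitary[OF that(1) i] that(2)] .
  have LL: "twisted_commute (d j) (d j') (u j j') (LA j) (LA j')
      \<and> twisted_commute (d j) (d j') (partial_adj (u j j')) (LB j) (LA j')" if j: "j < k" "j' < k" "j \<noteq> j'" for j j'
  proof -
    note y = yb[OF i j(1,2)]
    have "twisted_commute (d j) (d j') (u j j') (LA j) (LA j')"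
      unfolding twisted_commute_def
      by (intro allI impI ell2_eqI)
         (simp add: cLA j twisted_commute_word_lift[OF di linA[OF j(1)] linA[OF j(2)] tcA[OF j] y])
    moreover have "twisted_commute (d j) (d j') (partial_adj (u j j')) (LB j) (LA j')"
      unfolding twisted_commute_def
      by (intro allI impI ell2_eqI)
         (simp add: cLA cLB j twisted_commute_word_lift[OF di linB[OF j(1)] linA[OF j(2)] tcB[OF j]
             yang_baxter_partial_adj[OF y unitary[OF j(2) i]]])
    ultimately show ?thesis ..
  qed
  have LV: "twisted_commute (d j) (d i) (u j i) (LA j) V" if j: "j < k" "j \<noteq> i" for j
    unfolding V_def
  proof (rule word_lift_dil_op_commute[OF di linA[OF j(1)] tcA[OF j(1) i j(2)] _ cLA[OF j(1)]])
    \<comment> \<open>Condition (b) for the pair \<open>(i, j)\<close>, rewritten by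
      \<open>flip\<close> into the form required for commutation with the defect operator.\<close>
    have "B i q (A j l x) = (\<Sum>r<d j. \<Sum>p<d i. scaleC (u j i (l, p) (r, q)) (A j r (B i p x)))"
      if "q < d i" "l < d j" for q l x
    proof -
      have "B i q (A j l x) = (\<Sum>p<d i. \<Sum>r<d j. scaleC (u j i (l, p) (r, q)) (A j r (B i p x)))"
        using twisted_commuteD[OF tcB[OF i j(1)] that] j that by (simp add: flip[OF i j(1)])
      also have "\<dots> = (\<Sum>r<d j. \<Sum>p<d i. scaleC (u j i (l, p) (r, q)) (A j r (B i p x)))"
        by (rule sum.swap)
      finally show ?thesis .
    qed
    then show "(\<Sum>b<d i. \<Sum>r<d j. scaleC (u j i (l, b) (r, c)) (A j r (D p b h)))
        = (\<Sum>r<d j. \<Sum>q<d i. scaleC (u j i (l, p) (r, q)) (D q c (A j r h)))"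
      if "l < d j" "p < d i" "c < d i" for l p c h
      using D3[of "d j" "A j" "u j i", OF bounded_linear_contraction[OF linA[OF j(1)] nA[OF j(1)]]
          linA[OF j(1)] tcA[OF j(1) i j(2)] _ that]
      by simp
  qed
  \<comment> \<open>The same lemma for the adjoints of row \<open>j\<close>: condition (b) now takes
    the place of (a), and the adjoint of (a) takes the place of (b).\<close>
  have LV': "twisted_commute (d j) (d i) (partial_adj (u j i)) (LB j) V" if j: "j < k" "j \<noteq> i" for j
    unfolding V_def
  proof (rule word_lift_dil_op_commute[OF di linB[OF j(1)] tcB[OF j(1) i j(2)] _ cLB[OF j(1)]])
    have "B i q (B j l x) = (\<Sum>r<d j. \<Sum>p<d i. scaleC (partial_adj (u j i) (l, p) (r, q)) (B j r (B i p x)))"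
      if "q < d i" "l < d j" for q l x
      using twisted_commute_adjoint[OF tcA[OF j(1) i j(2)] adj[OF j(1)] adj[OF i] that(2,1)] by simp
    then show "(\<Sum>b<d i. \<Sum>r<d j. scaleC (partial_adj (u j i) (l, b) (r, c)) (B j r (D p b h)))
        = (\<Sum>r<d j. \<Sum>q<d i. scaleC (partial_adj (u j i) (l, p) (r, q)) (D q c (B j r h)))"
      if "l < d j" "p < d i" "c < d i" for l p c h
      using D3[of "d j" "B j" "partial_adj (u j i)", OF bounded_linear_contraction[OF linB[OF j(1)] nB[OF j(1)]]
          linB[OF j(1)] tcB[OF j(1) i j(2)] _ that]
      by blast
  qed
  have VL: "twisted_commute (d i) (d j) (u i j) V (LA j)" if j: "j < k" "j \<noteq> i" for j
    by (rule twisted_commute_flip[OF LV[OF j] unitary[OF j(1) i]]) (rule flip[OF j(1) i])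
  have VL': "twisted_commute (d i) (d j) (partial_adj (u i j)) V' (LA j)" if j: "j < k" "j \<noteq> i" for j
    by (rule twisted_commute_swap[OF i j(1) adjL[OF j(1)] adjV LV'[OF j]])
  have "dc_system A' B'"
    unfolding dc_system_def A'_def B'_def
    using adjV adjL contrL row_isometric_contractive[OF isoV] LL LV LV' VL VL' i by auto
  moreover have "row_isometric (d i) (A' i)" using isoV by (simp add: A'_def)
  moreover have "row_isometric (d j) (A' j)" if "j < k" "row_isometric (d j) (A j)" for j
    using isoV isoL[OF that] by (simp add: A'_def)
  moreover have "B' j l (single 0 h) = single 0 (B j l h)" if j: "j < k" and l: "l < d j" for j l h
  proof (cases "j = i")
    case True
    \<comment> \<open>A vector supported at the empty word has neither one-letter components nor
      tails, so only the term with \<open>B\<close> remains.\<close>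
    have "word_tail (d i) l (single 0 h) = 0"
      by (rule ell2_eqI) (use l True in \<open>simp add: coord_word_tail coord_single\<close>)
    then show ?thesis
      using True clinear_0[OF is_adj_clinear[OF D1]]
      by (simp add: B'_def V'_def dil_adj_def coord_single clinear_0[OF clinear_single])
  next
    case False
    have "coord (LB j l (single 0 h)) m = coord (single 0 (B j l h)) m" for m
    proof (rule word_code_cases[OF di, of m])
      fix p n assume "p < d i" "m = Suc (p + d i * n)"
      then show ?thesis
        by (simp add: cLB[OF j l] coord_single word_lift_Suc word_lift_zero[OF di linB[OF j]])
    qed (simp add: cLB[OF j l] coord_single)
    then show ?thesis using False by (auto simp: B'_def intro: ell2_eqI)
  qed
  ultimately show ?thesis by blast
qed

end

subsection \<open>Flattening iterated sequence spaces\<close>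

text \<open>Identifies the two layers of sequences with one by a pairing of indices, so that the
  space does not change its type as rows are dilated.\<close>

definition flat :: "'a::complex_inner_space ell2 ell2 \<Rightarrow> 'a ell2" where
  "flat F = Abs_ell2 (\<lambda>n. coord (coord F (fst (prod_decode n))) (snd (prod_decode n)))"

definition unflat :: "'a::complex_inner_space ell2 \<Rightarrow> 'a ell2 ell2" where
  "unflat g = Abs_ell2 (\<lambda>i. Abs_ell2 (\<lambda>j. coord g (prod_encode (i, j))))"

text \<open>The terms are nonnegative, so the double series may be summed along any enumeration of
  the pairs; unconditional sums express this.\<close>

lemma sums_flat:
  fixes F :: "'a::complex_inner_space ell2 ell2"
  shows "(\<lambda>n. (norm (coord (coord F (fst (prod_decode n))) (snd (prod_decode n))))\<^sup>2) sums (norm F)\<^sup>2"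
proof -
  let ?a = "\<lambda>x. (norm (coord (coord F (fst x)) (snd x)))\<^sup>2"
  have 1: "((\<lambda>j. ?a (i, j)) has_sum (norm (coord F i))\<^sup>2) UNIV" for i
    using sums_nonneg_imp_has_sum[OF sums_norm_ell2[of "coord F i"]] by simp
  have 2: "((\<lambda>i. (norm (coord F i))\<^sup>2) has_sum (norm F)\<^sup>2) UNIV"
    using sums_nonneg_imp_has_sum[OF sums_norm_ell2[of F]] by simp
  have "?a summable_on Sigma UNIV (\<lambda>_. UNIV)"
    by (rule summable_on_SigmaI[OF 1]) (use 2 in \<open>auto simp: summable_on_def\<close>)
  from has_sum_SigmaI[OF 1 2 this]
  have "(?a has_sum (norm F)\<^sup>2) (UNIV :: (nat \<times> nat) set)" by simp
  then have "((\<lambda>n. ?a (prod_decode n)) has_sum (norm F)\<^sup>2) UNIV"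
    by (subst has_sum_reindex_bij_betw[OF bij_prod_decode, where f = ?a])
  then show ?thesis by (rule has_sum_imp_sums)
qed

lemma coord_flat: "coord (flat F) n = coord (coord F (fst (prod_decode n))) (snd (prod_decode n))"
proof -
  have "(\<lambda>n. coord (coord F (fst (prod_decode n))) (snd (prod_decode n))) \<in> l2seq"
    using sums_flat[of F] by (auto simp: l2seq_def sums_iff)
  then show ?thesis by (simp add: flat_def)
qed

lemma norm_flat: "norm (flat F) = norm F"
proof -
  have "(norm (flat F))\<^sup>2 = (norm F)\<^sup>2"
    using sums_unique2[OF sums_norm_ell2[of "flat F"]] sums_flat[of F] by (simp add: coord_flat)
  then show ?thesis by simp
qed

lemma clinear_flat: "clinear flat"
  by (auto simp: clinear_def coord_flat intro: ell2_eqI)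

text \<open>\<open>unflat\<close> uses \<open>Abs_ell2\<close> twice, so each row and the sequence
  of the row norms must be square-summable. Both follow from summing the square norms of
  \<open>g\<close> over a product.\<close>

lemma coord_unflat: "coord (coord (unflat g) i) j = coord g (prod_encode (i, j))"
proof -
  let ?b = "\<lambda>x. (norm (coord g (prod_encode x)))\<^sup>2"
  have "((\<lambda>n. (norm (coord g n))\<^sup>2) has_sum (norm g)\<^sup>2) UNIV"
    using sums_nonneg_imp_has_sum[OF sums_norm_ell2[of g]] by simp
  then have "(?b has_sum (norm g)\<^sup>2) UNIV"
    by (subst has_sum_reindex_bij_betw[OF bij_prod_encode, where f = "\<lambda>n. (norm (coord g n))\<^sup>2"])
  then have b: "(?b has_sum (norm g)\<^sup>2) (Sigma UNIV (\<lambda>_. UNIV))" by simp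
  then have "(\<lambda>(i, j). ?b (i, j)) summable_on (Sigma UNIV (\<lambda>_. UNIV))"
    by (auto simp: summable_on_def case_prod_unfold)
  then have "(\<lambda>j. ?b (i, j)) summable_on UNIV" for i
    by (rule summable_on_SigmaD1) simp
  then have row: "(\<lambda>j. coord g (prod_encode (i, j))) \<in> l2seq" for i
    by (simp add: l2seq_def summable_on_imp_summable)
  let ?G = "\<lambda>i. Abs_ell2 (\<lambda>j. coord g (prod_encode (i, j)))"
  have cG: "coord (?G i) j = coord g (prod_encode (i, j))" for i j using row by simp
  have "((\<lambda>j. ?b (i, j)) has_sum (norm (?G i))\<^sup>2) UNIV" for i
    using sums_nonneg_imp_has_sum[OF sums_norm_ell2[of "?G i"]] by (simp add: cG)
  from has_sum_SigmaD[OF b this] have "((\<lambda>i. (norm (?G i))\<^sup>2) has_sum (norm g)\<^sup>2) UNIV" by simp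
  from has_sum_imp_sums[OF this] have "?G \<in> l2seq"
    by (simp add: l2seq_def sums_iff)
  then show ?thesis by (simp add: unflat_def row)
qed

lemma flat_unflat: "flat (unflat g) = g"
  by (rule ell2_eqI) (simp add: coord_flat coord_unflat)

lemma unflat_flat: "unflat (flat F) = F"
  by (rule ell2_eqI, rule ell2_eqI) (simp add: coord_flat coord_unflat)

text \<open>Polarisation: the norm of \<open>x + y\<close> determines the real part, and multiplying
  \<open>y\<close> by \<open>\<i>\<close> the imaginary part.\<close>

lemma isometry_cinner:
  assumes lin: "clinear U" and iso: "\<And>x. norm (U x) = norm x"
  shows "cinner (U x) (U y) = cinner x y"
proof -
  have Re: "Re (cinner (U x) (U y)) = Re (cinner x y)" for x y
    using iso[of "x + y"] norm_add_square[of "U x" "U y"] norm_add_square[of x y]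
    by (simp add: clinear_add[OF lin] iso)
  show ?thesis
  proof (rule complex_eqI)
    show "Im (cinner (U x) (U y)) = Im (cinner x y)"
      using Re[of x "scaleC \<i> y"] by (simp add: clinear_scaleC[OF lin] cinner_scaleC_right)
  qed (rule Re)
qed

lemma is_adj_flat: "is_adj flat unflat"
  unfolding is_adj_def using isometry_cinner[OF clinear_flat norm_flat] by (metis flat_unflat)

text \<open>The pairing sends \<open>(0, 0)\<close> to \<open>0\<close>, so flattening keeps
  \<open>H\<close> in coordinate 0.\<close>

lemma unflat_single: "unflat (single 0 h) = single 0 (single 0 h)"
proof (rule ell2_eqI, rule ell2_eqI)
  fix i j
  have "prod_encode (i, j) = 0 \<longleftrightarrow> i = 0 \<and> j = 0"
  proof -
    have "prod_encode (0, 0) = 0" by (simp add: prod_encode_def)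
    then show ?thesis using prod_encode_eq[of "(i, j)" "(0, 0)"] by simp
  qed
  then show "coord (coord (unflat (single 0 h)) i) j = coord (coord (single 0 (single 0 h)) i) j"
    by (simp add: coord_unflat coord_single)
qed

lemma flat_single: "flat (single 0 (single 0 h)) = single 0 h"
  by (metis unflat_single flat_unflat)

subsection \<open>Dilating all rows\<close>

context twist
begin

lemma dc_system_flat:
  assumes sys: "dc_system A B"
  shows "dc_system (\<lambda>j l x. flat (A j l (unflat x))) (\<lambda>j l x. flat (B j l (unflat x)))"
proof -
  have lin: "flat (\<Sum>r<n. \<Sum>q<m. scaleC (c r q) (x r q)) = (\<Sum>r<n. \<Sum>q<m. scaleC (c r q) (flat (x r q)))"
    for n m :: nat and c and x :: "nat \<Rightarrow> nat \<Rightarrow> 'a ell2 ell2"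
    by (simp add: clinear_sum[OF clinear_flat] clinear_scaleC[OF clinear_flat])
  have "is_adj (\<lambda>x. flat (A j l (unflat x))) (\<lambda>x. flat (B j l (unflat x)))" if "j < k" "l < d j" for j l
    by (rule is_adj_comp[OF is_adj_flat is_adj_comp[OF dc_systemD(1)[OF sys that] is_adj_sym[OF is_adj_flat]]])
  moreover have "row_contractive (d j) (\<lambda>l x. flat (A j l (unflat x)))" if "j < k" for j
    unfolding row_contractive_def
  proof
    fix x :: "nat \<Rightarrow> 'a ell2"
    have "(norm (\<Sum>l<d j. A j l (unflat (x l))))\<^sup>2 \<le> (\<Sum>l<d j. (norm (unflat (x l)))\<^sup>2)"
      using dc_systemD(2)[OF sys that] by (simp add: row_contractive_def)
    then show "(norm (\<Sum>l<d j. flat (A j l (unflat (x l)))))\<^sup>2 \<le> (\<Sum>l<d j. (norm (x l))\<^sup>2)"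
      using norm_flat[of "unflat (x _)"] by (simp add: norm_flat flat_unflat flip: clinear_sum[OF clinear_flat])
  qed
  ultimately show ?thesis
    using dc_systemD(3,4)[OF sys]
    by (simp add: dc_system_def twisted_commute_def unflat_flat lin)
qed

lemma row_isometric_flat:
  assumes "row_isometric n A"
  shows "row_isometric n (\<lambda>l x. flat (A l (unflat x)))"
  unfolding row_isometric_def
proof
  fix x :: "nat \<Rightarrow> 'a ell2"
  have "(norm (\<Sum>l<n. A l (unflat (x l))))\<^sup>2 = (\<Sum>l<n. (norm (unflat (x l)))\<^sup>2)"
    using assms by (simp add: row_isometric_def)
  then show "(norm (\<Sum>l<n. flat (A l (unflat (x l)))))\<^sup>2 = (\<Sum>l<n. (norm (x l))\<^sup>2)"
    using norm_flat[of "unflat (x _)"] by (simp add: norm_flat flat_unflat flip: clinear_sum[OF clinear_flat])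
qed

text \<open>The start of the induction: the given rows in coordinate 0 and zero elsewhere. The
  relations are homogeneous, so extension by zero preserves them.\<close>

lemma dc_system_embed:
  assumes sys: "dc_system A B"
  shows "dc_system (\<lambda>j l x. single 0 (A j l (coord x 0))) (\<lambda>j l x. single 0 (B j l (coord x 0)))"
proof -
  have lin: "single 0 (\<Sum>r<n. \<Sum>q<m. scaleC (c r q) (x r q)) = (\<Sum>r<n. \<Sum>q<m. scaleC (c r q) (single 0 (x r q)))"
    for n m :: nat and c and x :: "nat \<Rightarrow> nat \<Rightarrow> 'a"
    by (simp add: clinear_sum[OF clinear_single] clinear_scaleC[OF clinear_single])
  have "is_adj (\<lambda>x. single 0 (A j l (coord x 0))) (\<lambda>x. single 0 (B j l (coord x 0)))" if "j < k" "l < d j" for j l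
    by (rule is_adj_comp[OF is_adj_single is_adj_comp[OF dc_systemD(1)[OF sys that] is_adj_sym[OF is_adj_single]]])
  moreover have "row_contractive (d j) (\<lambda>l x. single 0 (A j l (coord x 0)))" if "j < k" for j
    unfolding row_contractive_def
  proof
    fix x :: "nat \<Rightarrow> 'a ell2"
    have "(norm (\<Sum>l<d j. A j l (coord (x l) 0)))\<^sup>2 \<le> (\<Sum>l<d j. (norm (coord (x l) 0))\<^sup>2)"
      using dc_systemD(2)[OF sys that] by (simp add: row_contractive_def)
    also have "\<dots> \<le> (\<Sum>l<d j. (norm (x l))\<^sup>2)"
      by (intro sum_mono power_mono norm_coord_le) simp
    finally show "(norm (\<Sum>l<d j. single 0 (A j l (coord (x l) 0))))\<^sup>2 \<le> (\<Sum>l<d j. (norm (x l))\<^sup>2)"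
      by (simp flip: clinear_sum[OF clinear_single])
  qed
  ultimately show ?thesis
    using dc_systemD(3,4)[OF sys]
    by (simp add: dc_system_def twisted_commute_def coord_single lin)
qed

text \<open>Induction on the number \<open>m\<close> of rows already made isometric. A step dilates
  row \<open>m\<close> on \<open>'h ell2 ell2\<close> without spoiling these, and flattening returns
  to the type of the induction hypothesis.\<close>

lemma dilate_rows:
  fixes A B :: "nat \<Rightarrow> nat \<Rightarrow> 'h::{complex_inner_space, complete_space} \<Rightarrow> 'h"
  assumes sys: "dc_system A B"
  shows "m \<le> k \<Longrightarrow> \<exists>A' B' :: nat \<Rightarrow> nat \<Rightarrow> 'h ell2 \<Rightarrow> 'h ell2. dc_system A' B'
    \<and> (\<forall>j<m. row_isometric (d j) (A' j))
    \<and> (\<forall>j<k. \<forall>l<d j. \<forall>h. B' j l (single 0 h) = single 0 (B j l h))"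
proof (induction m)
  case 0
  show ?case
    using dc_system_embed[OF sys] by (intro exI conjI) (auto simp: coord_single)
next
  case (Suc m)
  then obtain A' B' :: "nat \<Rightarrow> nat \<Rightarrow> 'h ell2 \<Rightarrow> 'h ell2" where sys': "dc_system A' B'"
    and iso: "\<And>j. j < m \<Longrightarrow> row_isometric (d j) (A' j)"
    and B': "\<And>j l h. j < k \<Longrightarrow> l < d j \<Longrightarrow> B' j l (single 0 h) = single 0 (B j l h)"
    by auto
  have m: "m < k" using Suc.prems by simp
  obtain A'' B'' :: "nat \<Rightarrow> nat \<Rightarrow> 'h ell2 ell2 \<Rightarrow> 'h ell2 ell2" where sys'': "dc_system A'' B''"
    and isom: "row_isometric (d m) (A'' m)"
    and iso'': "\<And>j. j < k \<Longrightarrow> row_isometric (d j) (A' j) \<Longrightarrow> row_isometric (d j) (A'' j)"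
    and B'': "\<And>j l h. j < k \<Longrightarrow> l < d j \<Longrightarrow> B'' j l (single 0 h) = single 0 (B' j l h)"
    using dilate_one_row[OF sys' m] by blast
  show ?case
  proof (intro exI conjI)
    show "dc_system (\<lambda>j l x. flat (A'' j l (unflat x))) (\<lambda>j l x. flat (B'' j l (unflat x)))"
      by (rule dc_system_flat[OF sys''])
    show "\<forall>j<Suc m. row_isometric (d j) (\<lambda>l x. flat (A'' j l (unflat x)))"
      using isom iso'' iso m by (auto simp: less_Suc_eq intro!: row_isometric_flat)
    show "\<forall>j<k. \<forall>l<d j. \<forall>h. flat (B'' j l (unflat (single 0 h))) = single 0 (B j l h)"
      by (simp add: unflat_single B'' B' flat_single)
  qed
qed

end

subsection \<open>From the maps \<open>t\<^sub>i\<^sub>j\<close> to matrix identities\<close>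

lemma tmap_apply: "l < dj \<Longrightarrow> p < di \<Longrightarrow> tmap U di dj v (l, p) = (\<Sum>q<di. \<Sum>m<dj. v (q, m) * U (q, m) (p, l))"
  by (simp add: tmap_def)

lemma sum_delta2:
  fixes g :: "nat \<Rightarrow> nat \<Rightarrow> complex"
  assumes "q < n" "r < m"
  shows "(\<Sum>x<n. \<Sum>y<m. (if x = q \<and> y = r then c else 0) * g x y) = c * g q r"
proof -
  have "(\<Sum>x<n. \<Sum>y<m. (if x = q \<and> y = r then c else 0) * g x y) = (\<Sum>x<n. if x = q then c * g q r else 0)"
  proof (rule sum.cong[OF refl])
    fix x
    have "(\<Sum>y<m. (if x = q \<and> y = r then c else 0) * g x y) = (\<Sum>y<m. if y = r then (if x = q then c * g q r else 0) else 0)"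
      by (rule sum.cong) auto
    then show "(\<Sum>y<m. (if x = q \<and> y = r then c else 0) * g x y) = (if x = q then c * g q r else 0)"
      using assms by simp
  qed
  then show ?thesis using assms by simp
qed

text \<open>Evaluation on basis vectors shows that \<open>U'\<close>, with the factors of its index
  pairs exchanged, is a right inverse of \<open>U\<close>; as \<open>U\<close> is unitary, it is the
  conjugate transpose.\<close>

lemma flip_of_tmap_inverse:
  assumes unit: "unitary_mat n m U"
    and inv: "\<And>v. supp2 n m v \<Longrightarrow> tmap U' m n (tmap U n m v) = v"
    and l: "l < m" and p: "p < n" and b: "b < m" and a: "a < n"
  shows "U' (l, p) (b, a) = cnj (U (a, b) (p, l))"
proof -
  let ?I = "{..<n} \<times> {..<m}"
  have MN: "(\<Sum>x\<in>?I. U c x * U' (snd x, fst x) (b, a)) = (if c = (a, b) then 1 else 0)" if c: "c \<in> ?I" for c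
  proof -
    obtain q r where c': "c = (q, r)" and q: "q < n" and r: "r < m" using c by (cases c) auto
    define v :: "nat \<times> nat \<Rightarrow> complex" where "v = (\<lambda>(x, y). if x = q \<and> y = r then 1 else 0)"
    have "supp2 n m v" using q r by (auto simp: supp2_def v_def)
    from fun_cong[OF inv[OF this], of "(a, b)"]
    have "(\<Sum>l<m. \<Sum>p<n. tmap U n m v (l, p) * U' (l, p) (b, a)) = v (a, b)"
      by (simp add: tmap_apply a b)
    moreover have "tmap U n m v (l, p) = U (q, r) (p, l)" if "l < m" "p < n" for l p
      using sum_delta2[OF q r, of 1 "\<lambda>x y. U (x, y) (p, l)"] that by (simp add: tmap_apply v_def)
    ultimately have "(\<Sum>l<m. \<Sum>p<n. U (q, r) (p, l) * U' (l, p) (b, a)) = v (a, b)" by simp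
    moreover have "(\<Sum>l<m. \<Sum>p<n. U (q, r) (p, l) * U' (l, p) (b, a)) = (\<Sum>x\<in>?I. U c x * U' (snd x, fst x) (b, a))"
      by (subst sum.swap) (simp add: sum.cartesian_product' c')
    ultimately show ?thesis by (auto simp: v_def c')
  qed
  have "(\<Sum>c\<in>?I. cnj (U c (p, l)) * (\<Sum>x\<in>?I. U c x * U' (snd x, fst x) (b, a)))
      = (\<Sum>c\<in>?I. if c = (a, b) then cnj (U (a, b) (p, l)) else 0)"
    by (rule sum.cong) (auto simp: MN)
  also have "\<dots> = cnj (U (a, b) (p, l))" using a b by simp
  finally have 1: "(\<Sum>c\<in>?I. cnj (U c (p, l)) * (\<Sum>x\<in>?I. U c x * U' (snd x, fst x) (b, a))) = cnj (U (a, b) (p, l))" .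
  have "(\<Sum>c\<in>?I. cnj (U c (p, l)) * (\<Sum>x\<in>?I. U c x * U' (snd x, fst x) (b, a)))
      = (\<Sum>x\<in>?I. (\<Sum>c\<in>?I. cnj (U c (p, l)) * U c x) * U' (snd x, fst x) (b, a))"
    unfolding sum_distrib_left sum_distrib_right by (subst sum.swap) (simp add: mult.assoc)
  also have "\<dots> = (\<Sum>x\<in>?I. if (p, l) = x then U' (l, p) (b, a) else 0)"
  proof (rule sum.cong[OF refl])
    fix x assume "x \<in> ?I"
    then have "(\<Sum>c\<in>?I. cnj (U c (p, l)) * U c x) = (if (p, l) = x then 1 else 0)"
      using unit l p unfolding unitary_mat_def by blast
    then show "(\<Sum>c\<in>?I. cnj (U c (p, l)) * U c x) * U' (snd x, fst x) (b, a)
        = (if (p, l) = x then U' (l, p) (b, a) else 0)" by auto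
  qed
  also have "\<dots> = U' (l, p) (b, a)" using l p by simp
  finally show ?thesis using 1 by simp
qed

lemma tensI_apply: "tensI f w (a, b, c) = f (\<lambda>(x, y). w (x, y, c)) (a, b)"
  and Itens_apply: "Itens f w (a, b, c) = f (\<lambda>(y, z). w (a, y, z)) (b, c)"
  by (simp_all add: tensI_def Itens_def)

text \<open>The hypothesis is evaluated on the basis tensor
  \<open>e_q \<otimes> e_r \<otimes> e_a\<close> and read at \<open>(c, l, p)\<close>;
  \<open>w1\<close> to \<open>w4\<close> are the intermediate tensors on the two routes.\<close>

lemma yang_baxter_of_tmap:
  assumes assoc: "\<And>w. supp3 n m d w \<Longrightarrow>
       tensI (tmap wY m d) (Itens (tmap wX n d) (tensI (tmap v n m) w))
     = Itens (tmap v n m) (tensI (tmap wX n d) (Itens (tmap wY m d) w))"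
  shows "yang_baxter d n m wX wY v"
  unfolding yang_baxter_def
proof (intro allI impI)
  fix q r a c p l
  assume q: "q < n" and r: "r < m" and a: "a < d" and c: "c < d" and p: "p < n" and l: "l < m"
  define w :: "nat \<times> nat \<times> nat \<Rightarrow> complex" where "w = (\<lambda>(x, y, z). if x = q \<and> y = r \<and> z = a then 1 else 0)"
  have supp: "supp3 n m d w" using q r a by (auto simp: supp3_def w_def)
  define w1 where "w1 = tensI (tmap v n m) w"
  have w1: "w1 (t, s, z) = (if z = a then v (q, r) (s, t) else 0)" if "t < m" "s < n" for t s z
  proof -
    have "w1 (t, s, z) = (\<Sum>x<n. \<Sum>y<m. (if x = q \<and> y = r then (if z = a then 1 else 0) else 0) * v (x, y) (s, t))"
      unfolding w1_def tensI_apply tmap_apply[OF that] by (intro sum.cong refl) (simp add: w_def)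
    then show ?thesis by (simp add: sum_delta2[OF q r])
  qed
  define w2 where "w2 = Itens (tmap wX n d) w1"
  have w2: "w2 (t, b, s') = (\<Sum>s<n. v (q, r) (s, t) * wX (s, a) (s', b))" if "t < m" "b < d" "s' < n" for t b s'
  proof -
    have "w2 (t, b, s') = (\<Sum>s<n. \<Sum>z<d. if z = a then v (q, r) (s, t) * wX (s, a) (s', b) else 0)"
      unfolding w2_def Itens_apply tmap_apply[OF that(2,3)]
      by (intro sum.cong refl) (use that in \<open>simp add: w1\<close>)
    then show ?thesis using a by simp
  qed
  have L: "tensI (tmap wY m d) w2 (c, l, p) = (\<Sum>t<m. \<Sum>b<d. \<Sum>s<n. v (q, r) (s, t) * wY (t, b) (l, c) * wX (s, a) (p, b))"
    unfolding tensI_apply tmap_apply[OF c l]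
    by (intro sum.cong refl) (simp add: w2 p sum_distrib_right mult_ac sum_distrib_left)
  define w3 where "w3 = Itens (tmap wY m d) w"
  have w3: "w3 (x, b, t) = (if x = q then wY (r, a) (t, b) else 0)" if "b < d" "t < m" for x b t
  proof -
    have "w3 (x, b, t) = (\<Sum>y<m. \<Sum>z<d. (if y = r \<and> z = a then (if x = q then 1 else 0) else 0) * wY (y, z) (t, b))"
      unfolding w3_def Itens_apply tmap_apply[OF that] by (intro sum.cong refl) (simp add: w_def)
    then show ?thesis by (simp add: sum_delta2[OF r a])
  qed
  define w4 where "w4 = tensI (tmap wX n d) w3"
  have w4: "w4 (c, s, t) = (\<Sum>b<d. wX (q, b) (s, c) * wY (r, a) (t, b))" if "s < n" "t < m" for s t
  proof -
    have "w4 (c, s, t) = (\<Sum>x<n. \<Sum>b<d. if x = q then wX (q, b) (s, c) * wY (r, a) (t, b) else 0)"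
      unfolding w4_def tensI_apply tmap_apply[OF c that(1)]
      by (intro sum.cong refl) (use that in \<open>simp add: w3\<close>)
    also have "\<dots> = (\<Sum>x<n. if x = q then \<Sum>b<d. wX (q, b) (s, c) * wY (r, a) (t, b) else 0)"
      by (intro sum.cong refl) simp
    finally show ?thesis using q by simp
  qed
  have R: "Itens (tmap v n m) w4 (c, l, p) = (\<Sum>s<n. \<Sum>t<m. \<Sum>b<d. wX (q, b) (s, c) * wY (r, a) (t, b) * v (s, t) (p, l))"
    unfolding Itens_apply tmap_apply[OF l p]
    by (intro sum.cong refl) (simp add: w4 sum_distrib_right)
  have "(\<Sum>t<m. \<Sum>b<d. \<Sum>s<n. v (q, r) (s, t) * wY (t, b) (l, c) * wX (s, a) (p, b))
      = (\<Sum>s<n. \<Sum>t<m. \<Sum>b<d. v (q, r) (s, t) * wY (t, b) (l, c) * wX (s, a) (p, b))"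
    unfolding sum.cartesian_product
    by (rule sum.reindex_bij_witness[of _ "\<lambda>(s,t,b). (t,b,s)" "\<lambda>(t,b,s). (s,t,b)"]) auto
  then show "(\<Sum>s<n. \<Sum>t<m. \<Sum>b<d. wX (q, b) (s, c) * wY (r, a) (t, b) * v (s, t) (p, l))
      = (\<Sum>s<n. \<Sum>t<m. \<Sum>b<d. v (q, r) (s, t) * wY (t, b) (l, c) * wX (s, a) (p, b))"
    using fun_cong[OF assoc[OF supp], of "(c, l, p)"] L R
    unfolding w1_def w2_def w3_def w4_def by simp
qed

subsection \<open>Rows of isometries\<close>

text \<open>Tuples with one nonzero entry show that each \<open>A l\<close> is an isometry; tuples
  with two show that the ranges of different entries are orthogonal.\<close>

lemma row_isometric_adjoint:
  assumes iso: "row_isometric n A" and adj: "\<And>r. r < n \<Longrightarrow> is_adj (A r) (B r)"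
    and l: "l < n" and q: "q < n"
  shows "B l (A q x) = (if l = q then x else 0)"
proof -
  have lin: "clinear (A r)" if "r < n" for r using adj[OF that] by (rule is_adj_clinear)
  have norm1: "norm (A l x) = norm x" if "l < n" for l x
  proof -
    have "(\<Sum>r<n. A r (if r = l then x else 0)) = (\<Sum>r<n. if r = l then A l x else 0)"
      by (rule sum.cong) (auto simp: clinear_0 lin)
    moreover have "(\<Sum>r<n. (norm (if r = l then x else 0))\<^sup>2) = (\<Sum>r<n. if r = l then (norm x)\<^sup>2 else 0)"
      by (rule sum.cong) auto
    ultimately have "(norm (A l x))\<^sup>2 = (norm x)\<^sup>2"
      using iso[unfolded row_isometric_def, rule_format, of "\<lambda>r. if r = l then x else 0"] that by simp
    then show ?thesis by simp
  qed
  show ?thesis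
  proof (cases "l = q")
    case True
    have "cinner z (B l (A l x)) = cinner z x" for z
      using isometry_cinner[OF lin[OF l] norm1[OF l], of z x] is_adjD[OF adj[OF l], of z "A l x"] by simp
    then show ?thesis using True by (auto intro: cinner_eqI_right)
  next
    case False
    have Re0: "Re (cinner (A l z) (A q x)) = 0" for z x
    proof -
      define f where "f r = (if r = l then z else 0) + (if r = q then x else 0)" for r
      have "(\<Sum>r<n. A r (f r)) = (\<Sum>r<n. (if r = l then A l z else 0) + (if r = q then A q x else 0))"
        by (rule sum.cong) (auto simp: f_def clinear_0 clinear_add lin)
      then have 1: "(\<Sum>r<n. A r (f r)) = A l z + A q x" using l q by (simp add: sum.distrib)
      have "(\<Sum>r<n. (norm (f r))\<^sup>2) = (\<Sum>r<n. (if r = l then (norm z)\<^sup>2 else 0) + (if r = q then (norm x)\<^sup>2 else 0))"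
        by (rule sum.cong) (use False in \<open>auto simp: f_def\<close>)
      then have 2: "(\<Sum>r<n. (norm (f r))\<^sup>2) = (norm z)\<^sup>2 + (norm x)\<^sup>2" using l q by (simp add: sum.distrib)
      have "(norm (A l z + A q x))\<^sup>2 = (norm z)\<^sup>2 + (norm x)\<^sup>2"
        using iso[unfolded row_isometric_def, rule_format, of f] unfolding 1 2 .
      then show ?thesis by (simp add: norm_add_square norm1 l q)
    qed
    have "cinner (A l z) (A q x) = 0" for z
    proof (rule complex_eqI)
      show "Im (cinner (A l z) (A q x)) = Im 0"
        using Re0[of z "scaleC \<i> x"] by (simp add: clinear_scaleC[OF lin[OF q]] cinner_scaleC_right)
    qed (simp add: Re0)
    then have "cinner z (B l (A q x)) = cinner z 0" for z
      using is_adjD[OF adj[OF l], of z "A q x"] by simp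
    then show ?thesis using False by (auto intro: cinner_eqI_right)
  qed
qed

text \<open>A row is contractive exactly when the column of its adjoints is, by the Cauchy-Schwarz
  inequality on the direct sum. The column bound is the positivity condition in
  \<open>row_contraction\<close>.\<close>

lemma row_contractive_iff_adjoint:
  assumes adj: "\<And>r. r < n \<Longrightarrow> is_adj (A r) (B r)"
  shows "row_contractive n A \<longleftrightarrow> (\<forall>y. (\<Sum>l<n. (norm (B l y))\<^sup>2) \<le> (norm y)\<^sup>2)"
proof
  assume contr: "row_contractive n A"
  show "\<forall>y. (\<Sum>l<n. (norm (B l y))\<^sup>2) \<le> (norm y)\<^sup>2"
  proof
    fix y
    define s where "s = (\<Sum>l<n. (norm (B l y))\<^sup>2)"
    define z where "z = (\<Sum>l<n. A l (B l y))"
    have s0: "s \<ge> 0" by (simp add: s_def sum_nonneg)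
    have "cinner z y = complex_of_real s"
      by (simp add: z_def s_def cinner.sum_left is_adjD[OF adj] cinner_norm)
    then have "s = cmod (cinner z y)" using s0 by simp
    also have "\<dots> \<le> norm z * norm y" by (rule norm_cinner_le)
    finally have "s\<^sup>2 \<le> (norm z * norm y)\<^sup>2" using s0 by (rule power_mono)
    also have "\<dots> = (norm z)\<^sup>2 * (norm y)\<^sup>2" by (rule power_mult_distrib)
    also have "\<dots> \<le> s * (norm y)\<^sup>2"
      using contr unfolding row_contractive_def z_def s_def by (intro mult_right_mono) auto
    finally have "s * s \<le> s * (norm y)\<^sup>2" by (simp add: power2_eq_square)
    then have "s \<le> (norm y)\<^sup>2" using s0 by (cases "s = 0") (simp_all add: mult_le_cancel_left)
    then show "(\<Sum>l<n. (norm (B l y))\<^sup>2) \<le> (norm y)\<^sup>2" by (simp add: s_def)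
  qed
next
  assume B: "\<forall>y. (\<Sum>l<n. (norm (B l y))\<^sup>2) \<le> (norm y)\<^sup>2"
  show "row_contractive n A"
    unfolding row_contractive_def
  proof
    fix x
    define y where "y = (\<Sum>l<n. A l (x l))"
    define t where "t = (\<Sum>l<n. (norm (x l))\<^sup>2)"
    have t0: "t \<ge> 0" by (simp add: t_def sum_nonneg)
    have "cinner y y = (\<Sum>l<n. cinner (x l) (B l y))"
      by (subst (1) y_def) (simp add: cinner.sum_left is_adjD[OF adj])
    then have "complex_of_real ((norm y)\<^sup>2) = (\<Sum>l<n. cinner (x l) (B l y))"
      by (simp only: cinner_norm)
    then have "(norm y)\<^sup>2 = cmod (\<Sum>l<n. cinner (x l) (B l y))"
      by (metis abs_power2 norm_of_real)
    also have "\<dots> \<le> sqrt t * sqrt (\<Sum>l<n. (norm (B l y))\<^sup>2)"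
      unfolding t_def by (rule norm_sum_cinner_le)
    also have "\<dots> \<le> sqrt t * sqrt ((norm y)\<^sup>2)"
      using B t0 by (intro mult_left_mono real_sqrt_le_mono) auto
    finally have "norm y * norm y \<le> sqrt t * norm y" by (simp add: power2_eq_square)
    then have "norm y \<le> sqrt t" using t0 by (cases "y = 0") simp_all
    then have "(norm y)\<^sup>2 \<le> (sqrt t)\<^sup>2" by (rule power_mono) simp
    then show "(norm (\<Sum>l<n. A l (x l)))\<^sup>2 \<le> (\<Sum>l<n. (norm (x l))\<^sup>2)"
      using t0 by (simp add: y_def t_def)
  qed
qed

subsection \<open>Words of operators and regularity\<close>

lemma wordop_append: "wordop W (a @ b) x = wordop W a (wordop W b x)"
  by (induction a) auto

context twist
begin

definition letters :: "(nat \<times> nat) set" where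
  "letters = {(i, l). i < k \<and> l < d i}"

lemma is_adj_wordop:
  assumes "\<And>j l. j < k \<Longrightarrow> l < d j \<Longrightarrow> is_adj (A j l) (B j l)"
  shows "set w \<subseteq> letters \<Longrightarrow> is_adj (wordop A w) (wordop B (rev w))"
proof (induction w)
  case Nil
  then show ?case by (simp add: is_adj_def)
next
  case (Cons a w)
  obtain i l where a: "a = (i, l)" by force
  have "i < k" "l < d i" using Cons.prems by (auto simp: a letters_def)
  then show ?case
    using is_adj_comp[OF assms Cons.IH] Cons.prems by (simp add: a is_adj_def wordop_append)
qed

text \<open>Dual form of the invariance of coordinate 0 under the adjoint: the projection onto
  \<open>H\<close> intertwines the dilated operator with the given one.\<close>

lemma coord_dilation_commute:
  assumes adj: "is_adj A B" and adj': "is_adj A' B'" and B': "\<And>h. B' (single 0 h) = single 0 (B h)"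
  shows "coord (A' x) 0 = A (coord x 0)"
proof (rule cinner_eqI)
  fix h
  have "cinner (coord (A' x) 0) h = cinner (A' x) (single 0 h)"
    by (rule is_adjD[OF is_adj_sym[OF is_adj_single]])
  also have "\<dots> = cinner x (single 0 (B h))" by (simp add: is_adjD[OF adj'] B')
  also have "\<dots> = cinner (coord x 0) (B h)"
    by (rule is_adjD[OF is_adj_sym[OF is_adj_single], symmetric])
  also have "\<dots> = cinner (A (coord x 0)) h" by (simp add: is_adjD[OF adj])
  finally show "cinner (coord (A' x) 0) h = cinner (A (coord x 0)) h" .
qed

context
  fixes A B :: "nat \<Rightarrow> nat \<Rightarrow> 'h::complex_inner_space \<Rightarrow> 'h"
    and A' B' :: "nat \<Rightarrow> nat \<Rightarrow> 'h ell2 \<Rightarrow> 'h ell2"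
  assumes sys: "dc_system A B" and sys': "dc_system A' B'"
    and B'_single: "\<And>j l h. j < k \<Longrightarrow> l < d j \<Longrightarrow> B' j l (single 0 h) = single 0 (B j l h)"
begin

lemma wordop_adjoint_single:
  "set w \<subseteq> letters \<Longrightarrow> wordop B' w (single 0 h) = single 0 (wordop B w h)"
  by (induction w) (auto simp: letters_def B'_single)

text \<open>One letter is moved past the adjoints of a word in other rows: by double commutation this
  only uses words of the same shape, with the same coefficients in both systems.\<close>

lemma regular_step:
  assumes j: "j < k"
  shows "set \<beta> \<subseteq> letters \<Longrightarrow> j \<notin> fst ` set \<beta> \<Longrightarrow> q < d j \<Longrightarrow>
    (\<And>\<beta>'. map fst \<beta>' = map fst \<beta> \<Longrightarrow> set \<beta>' \<subseteq> letters \<Longrightarrow>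
       coord (wordop B' (rev \<beta>') x) 0 = wordop B (rev \<beta>') y) \<Longrightarrow>
    coord (wordop B' (rev \<beta>) (A' j q x)) 0 = wordop B (rev \<beta>) (A j q y)"
proof (induction \<beta> arbitrary: q x y)
  case Nil
  have "coord x 0 = y" using Nil.prems(4)[of "[]"] by simp
  then show ?case
    using coord_dilation_commute[OF dc_systemD(1)[OF sys j Nil.prems(3)]
        dc_systemD(1)[OF sys' j Nil.prems(3)] B'_single[OF j Nil.prems(3)]] by simp
next
  case (Cons a \<beta>)
  obtain i l where a: "a = (i, l)" by force
  have i: "i < k" "l < d i" "i \<noteq> j" and \<beta>: "set \<beta> \<subseteq> letters" "j \<notin> fst ` set \<beta>"
    using Cons.prems by (auto simp: a letters_def)
  note sd = dc_systemD(1)[OF sys] and sd' = dc_systemD(1)[OF sys']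
  have linB': "clinear (wordop B' (rev \<beta>))"
    using is_adj_clinear2[OF is_adj_wordop[OF sd' \<beta>(1)]] .
  have linB: "clinear (wordop B (rev \<beta>))"
    using is_adj_clinear2[OF is_adj_wordop[OF sd \<beta>(1)]] .
  have IH: "coord (wordop B' (rev \<beta>) (A' j p (B' i r x))) 0 = wordop B (rev \<beta>) (A j p (B i r y))"
    if "p < d j" "r < d i" for p r
  proof (rule Cons.IH[OF \<beta> that(1)])
    fix \<beta>' assume "map fst \<beta>' = map fst \<beta>" "set \<beta>' \<subseteq> letters"
    then show "coord (wordop B' (rev \<beta>') (B' i r x)) 0 = wordop B (rev \<beta>') (B i r y)"
      using Cons.prems(4)[of "(i, r) # \<beta>'"] that i by (simp add: a wordop_append letters_def)
  qed
  show ?case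
    unfolding a
    by (simp add: wordop_append twisted_commuteD[OF dc_systemD(4)[OF sys' i(1) j i(3)] i(2) Cons.prems(3)]
        twisted_commuteD[OF dc_systemD(4)[OF sys i(1) j i(3)] i(2) Cons.prems(3)]
        clinear_sum[OF linB] clinear_sum[OF linB'] clinear_scaleC[OF linB] clinear_scaleC[OF linB'] IH)
qed

text \<open>Adjoint letters can be moved past \<open>\<alpha>\<close> because no row occurs in both
  words. \<open>regular_step\<close> alters the letters of \<open>\<beta>\<close> but not their
  rows, hence the induction on \<open>\<alpha>\<close> for all \<open>\<beta>\<close>.\<close>

lemma regular_dilation:
  "set \<alpha> \<subseteq> letters \<Longrightarrow> set \<beta> \<subseteq> letters \<Longrightarrow> fst ` set \<alpha> \<inter> fst ` set \<beta> = {} \<Longrightarrow>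
    coord (wordop B' (rev \<beta>) (wordop A' \<alpha> (single 0 h))) 0 = wordop B (rev \<beta>) (wordop A \<alpha> h)"
proof (induction \<alpha> arbitrary: \<beta>)
  case Nil
  then show ?case using wordop_adjoint_single[of "rev \<beta>"] by (simp add: coord_single)
next
  case (Cons a \<alpha>)
  obtain j q where a: "a = (j, q)" by force
  have j: "j < k" "q < d j" "j \<notin> fst ` set \<beta>" using Cons.prems by (auto simp: a letters_def)
  have "coord (wordop B' (rev \<beta>) (A' j q (wordop A' \<alpha> (single 0 h)))) 0
      = wordop B (rev \<beta>) (A j q (wordop A \<alpha> h))"
  proof (rule regular_step[OF j(1) Cons.prems(2) j(3) j(2)])
    fix \<beta>' assume \<beta>': "map fst \<beta>' = map fst \<beta>" "set \<beta>' \<subseteq> letters"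
    have "fst ` set \<beta>' = fst ` set \<beta>" using \<beta>'(1) by (metis list.set_map)
    then have "fst ` set \<alpha> \<inter> fst ` set \<beta>' = {}" using Cons.prems(3) by auto
    then show "coord (wordop B' (rev \<beta>') (wordop A' \<alpha> (single 0 h))) 0 = wordop B (rev \<beta>') (wordop A \<alpha> h)"
      using Cons.IH[of \<beta>'] Cons.prems(1) \<beta>'(2) by simp
  qed
  then show ?case by (simp add: a)
qed

end

end

subsection \<open>Closed subspaces of sequences\<close>

definition closed_csubspace :: "'a::complex_inner_space set \<Rightarrow> bool" where
  "closed_csubspace M \<longleftrightarrow> closed M \<and> 0 \<in> M \<and> (\<forall>x\<in>M. \<forall>y\<in>M. x + y \<in> M) \<and> (\<forall>c. \<forall>x\<in>M. scaleC c x \<in> M)"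

lemma closed_csubspace_sum:
  "closed_csubspace M \<Longrightarrow> (\<And>i. i \<in> I \<Longrightarrow> f i \<in> M) \<Longrightarrow> (\<Sum>i\<in>I. f i) \<in> M"
  by (induction I rule: infinite_finite_induct) (auto simp: closed_csubspace_def)

lemma closed_csubspace_diff:
  assumes "closed_csubspace M" "x \<in> M" "y \<in> M"
  shows "x - y \<in> M"
proof -
  have "x + scaleC (-1) y \<in> M" using assms by (auto simp: closed_csubspace_def)
  then show ?thesis by (simp add: scaleC.minus_left)
qed

section \<open>Transfer between the type of sequences and sets of functions\<close>

lemma coord_plus_fun: "coord f + coord g = coord (f + g)"
  and coord_minus_fun: "coord f - coord g = coord (f - g)"
  and coord_zero_fun: "0 = coord 0"
  and l2sc_coord: "l2sc c (coord f) = coord (scaleC c f)"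
  and l2ip_coord: "l2ip (coord f) (coord g) = cinner f g"
  and l2norm_coord: "l2norm (coord f) = norm f"
  and emb_coord: "emb h = coord (single 0 h)"
  by (auto simp: fun_eq_iff l2sc_def cinner_ell2_def norm_ell2_def emb_def coord_single)

lemma coord_sum_fun: "(\<Sum>i\<in>I. coord (f i)) = coord (\<Sum>i\<in>I. f i)"
  by (induction I rule: infinite_finite_induct) (simp_all add: coord_plus_fun coord_zero_fun[symmetric])

lemma closed_l2_subspace_coord:
  assumes M: "closed_csubspace M"
  shows "closed_l2_subspace (coord ` M)"
  unfolding closed_l2_subspace_def
proof (intro conjI ballI allI impI)
  show "coord ` M \<subseteq> l2seq" using coord by blast
  show "0 \<in> coord ` M" using M by (auto simp: coord_zero_fun closed_csubspace_def)
  show "f + g \<in> coord ` M" if "f \<in> coord ` M" "g \<in> coord ` M" for f g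
    using that M by (auto simp: coord_plus_fun closed_csubspace_def)
  show "l2sc c f \<in> coord ` M" if "f \<in> coord ` M" for c f
    using that M by (auto simp: l2sc_coord closed_csubspace_def)
  fix X f
  assume *: "(\<forall>n. X n \<in> coord ` M) \<and> f \<in> l2seq \<and> (\<lambda>n. l2norm (X n - f)) \<longlonglongrightarrow> 0"
  then obtain x where x: "\<And>n. x n \<in> M" "\<And>n. X n = coord (x n)"
    unfolding image_iff by metis
  have f: "f = coord (Abs_ell2 f)" using * by simp
  have "(\<lambda>n. norm (x n - Abs_ell2 f)) \<longlonglongrightarrow> 0"
    using * unfolding x(2) by (subst (asm) (2) f) (simp add: coord_minus_fun l2norm_coord)
  then have "x \<longlonglongrightarrow> Abs_ell2 f"
    by (rule LIM_zero_cancel[OF tendsto_norm_zero_cancel])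
  then have "Abs_ell2 f \<in> M"
    using M x(1) closed_sequentially[of M x] by (simp add: closed_csubspace_def)
  then show "f \<in> coord ` M" using f by blast
qed

lemma closed_csubspace_coord:
  assumes M: "closed_l2_subspace M"
  shows "closed_csubspace {x. coord x \<in> M}"
  unfolding closed_csubspace_def
proof (intro conjI ballI allI)
  show "closed {x. coord x \<in> M}"
    unfolding closed_sequential_limits
  proof (intro allI impI, elim conjE)
    fix x l assume x: "\<forall>n. x n \<in> {x. coord x \<in> M}" and "x \<longlonglongrightarrow> l"
    then have "(\<lambda>n. norm (x n - l)) \<longlonglongrightarrow> 0"
      by (intro tendsto_norm_zero LIM_zero)
    then have "(\<lambda>n. l2norm (coord (x n) - coord l)) \<longlonglongrightarrow> 0"
      by (simp add: coord_minus_fun l2norm_coord)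
    moreover have "\<forall>X f. (\<forall>n. X n \<in> M) \<and> f \<in> l2seq \<and> (\<lambda>n. l2norm (X n - f)) \<longlonglongrightarrow> 0 \<longrightarrow> f \<in> M"
      using M unfolding closed_l2_subspace_def by (elim conjE)
    ultimately show "l \<in> {x. coord x \<in> M}"
      using x coord[of l] by simp
  qed
qed (use M in \<open>auto simp: closed_l2_subspace_def coord_zero_fun l2sc_coord[symmetric] coord_plus_fun[symmetric]\<close>)

lemma adj_Hsp:
  assumes AB: "is_adj A B"
  shows "adj Hsp A = B"
  unfolding adj_def Hsp_def
proof (rule the_equality, goal_cases)
  case 1
  show ?case by (simp add: is_adjD[OF AB])
next
  case (2 C)
  then have "is_adj A C" by (simp add: is_adj_def)
  then show "C = B" using AB by (rule is_adj_unique)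
qed

text \<open>The adjoint on the subspace is the restriction of \<open>Y\<close>, which maps
  \<open>K\<close> into itself, extended by zero as the definition of \<open>adj\<close>
  prescribes.\<close>

lemma adj_Ksp:
  fixes F :: "(nat \<Rightarrow> 'h::complex_inner_space) \<Rightarrow> (nat \<Rightarrow> 'h)"
  assumes K: "closed_csubspace K" and XY: "is_adj X Y"
    and Y: "\<And>x. x \<in> K \<Longrightarrow> Y x \<in> K" and F: "\<And>x. x \<in> K \<Longrightarrow> F (coord x) = coord (X x)" and y: "y \<in> K"
  shows "adj (Ksp (coord ` K)) F (coord y) = coord (Y y)"
proof -
  define G where "G g = (if g \<in> coord ` K then coord (Y (Abs_ell2 g)) else 0)" for g
  have Gy: "G (coord y) = coord (Y y)" if "y \<in> K" for y
    using that by (simp add: G_def coord_inverse)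
  have "adj (Ksp (coord ` K)) F = G"
    unfolding adj_def Ksp_def
  proof (rule the_equality, goal_cases)
    case 1
    show ?case using Y F is_adjD[OF XY] by (auto simp: Gy l2ip_coord) (auto simp: G_def)
  next
    case (2 A)
    show "A = G"
    proof
      fix g
      show "A g = G g"
      proof (cases "g \<in> coord ` K")
        case True
        then obtain y where y: "y \<in> K" "g = coord y" by blast
        from 2 True obtain a where a: "a \<in> K" "A g = coord a" by auto
        have "cinner x a = cinner x (Y y)" if "x \<in> K" for x
        proof -
          have "l2ip (F (coord x)) (coord y) = l2ip (coord x) (A (coord y))"
            using 2 that y by simp
          then show ?thesis using a y that by (simp add: F l2ip_coord is_adjD[OF XY])
        qed
        \<comment> \<open>The difference itself lies in \<open>K\<close> and may be used as the test
          vector.\<close>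
        then have "cinner (a - Y y) (a - Y y) = 0"
          using closed_csubspace_diff[OF K a(1) Y[OF y(1)]] by (simp add: cinner.diff_right)
        then show ?thesis using a y by (simp add: cinner_norm Gy)
      next
        case False
        then show ?thesis using 2 by (simp add: G_def)
      qed
    qed
  qed
  then show ?thesis using y by (simp add: Gy)
qed

context twist
begin

text \<open>\<open>K\<close> is the smallest closed invariant subspace containing \<open>H\<close>.
  Let \<open>N\<close> consist of the vectors of \<open>K\<close> that all adjoints map into
  \<open>K\<close>. \<open>N\<close> is again invariant: an adjoint meets a letter of its own row in
  the relation for isometric rows, and a letter of another row in condition (b). Minimality then
  gives \<open>K \<subseteq> N\<close>.\<close>

lemma reducing_subspace:
  fixes B :: "nat \<Rightarrow> nat \<Rightarrow> 'h::complex_inner_space \<Rightarrow> 'h"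
    and A' B' :: "nat \<Rightarrow> nat \<Rightarrow> 'h ell2 \<Rightarrow> 'h ell2"
  assumes sys': "dc_system A' B'" and iso: "\<And>j. j < k \<Longrightarrow> row_isometric (d j) (A' j)"
    and B'_single: "\<And>j l h. j < k \<Longrightarrow> l < d j \<Longrightarrow> B' j l (single 0 h) = single 0 (B j l h)"
  obtains K where "closed_csubspace K" "range (single 0) \<subseteq> K"
    "\<And>j l x. j < k \<Longrightarrow> l < d j \<Longrightarrow> x \<in> K \<Longrightarrow> A' j l x \<in> K"
    "\<And>j l x. j < k \<Longrightarrow> l < d j \<Longrightarrow> x \<in> K \<Longrightarrow> B' j l x \<in> K"
    "\<And>M. closed_csubspace M \<Longrightarrow> range (single 0) \<subseteq> M \<Longrightarrow>
       (\<And>j l x. j < k \<Longrightarrow> l < d j \<Longrightarrow> x \<in> M \<Longrightarrow> A' j l x \<in> M) \<Longrightarrow> K \<subseteq> M"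
proof -
  define inv where "inv M \<longleftrightarrow> closed_csubspace M \<and> range (single 0) \<subseteq> M
      \<and> (\<forall>j<k. \<forall>l<d j. \<forall>x\<in>M. A' j l x \<in> M)" for M
  define K where "K = \<Inter> {M. inv M}"
  have Kmin: "K \<subseteq> M" if "inv M" for M using that by (auto simp: K_def)
  have sub: "closed_csubspace K"
    unfolding closed_csubspace_def K_def
    by (intro conjI closed_Inter) (auto simp: inv_def closed_csubspace_def)
  have single: "range (single 0) \<subseteq> K" by (auto simp: K_def inv_def)
  have KA: "A' j l x \<in> K" if "j < k" "l < d j" "x \<in> K" for j l x
    using that by (auto simp: K_def inv_def)
  note adj = dc_systemD(1)[OF sys']
  have cont: "continuous_on UNIV (B' j l)" if "j < k" "l < d j" for j l
  proof -
    have lin: "clinear (A' j r)" if "r < d j" for r using adj[OF \<open>j < k\<close> that] by (rule is_adj_clinear)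
    have "norm (A' j l x) \<le> norm x" for x
      by (rule row_contractive_norm_le[OF dc_systemD(2)[OF sys' that(1)] that(2) lin])
    from norm_adjoint_contraction[OF adj[OF that] this] have "bounded_linear (B' j l)"
      by (intro bounded_linear_contraction is_adj_clinear2[OF adj[OF that]])
    then show ?thesis by (rule linear_continuous_on)
  qed
  define N where "N = K \<inter> (\<Inter>j\<in>{..<k}. \<Inter>l\<in>{..<d j}. B' j l -` K)"
  have N: "x \<in> N \<longleftrightarrow> x \<in> K \<and> (\<forall>j<k. \<forall>l<d j. B' j l x \<in> K)" for x by (auto simp: N_def)
  have linB: "clinear (B' j l)" if "j < k" "l < d j" for j l
    using adj[OF that] by (rule is_adj_clinear2)
  have "inv N"
    unfolding inv_def
  proof (intro conjI allI impI ballI)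
    have "closed N"
      unfolding N_def
      using sub cont by (intro closed_Int closed_INT ballI closed_vimage) (auto simp: closed_csubspace_def)
    then show "closed_csubspace N"
      using sub by (auto simp: closed_csubspace_def N clinear_0 clinear_add clinear_scaleC linB)
    show "range (single 0) \<subseteq> N"
      using single by (simp add: image_subset_iff N B'_single)
    show "A' j q x \<in> N" if j: "j < k" "q < d j" and x: "x \<in> N" for j q x
      unfolding N
    proof (intro conjI allI impI)
      show "A' j q x \<in> K" using KA[OF j] x by (simp add: N)
      fix i l assume i: "i < k" "l < d i"
      show "B' i l (A' j q x) \<in> K"
      proof (cases "i = j")
        case True
        then have "B' i l (A' j q x) = (if l = q then x else 0)"
          using row_isometric_adjoint[OF iso[OF j(1)] adj[OF j(1)], of l q] i j by simp
        then show ?thesis using x sub by (simp add: N closed_csubspace_def)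
      next
        case False
        have "(\<Sum>r<d i. \<Sum>p<d j. scaleC (partial_adj (u i j) (l, q) (r, p)) (A' j p (B' i r x))) \<in> K"
          using sub x i j
          by (intro closed_csubspace_sum[OF sub]) (auto simp: closed_csubspace_def N KA)
        then show ?thesis
          using twisted_commuteD[OF dc_systemD(4)[OF sys' i(1) j(1) False] i(2) j(2)] by simp
      qed
    qed
  qed
  then have "K \<subseteq> N" by (rule Kmin)
  show thesis
  proof (rule that[OF sub single KA])
    show "B' j l x \<in> K" if "j < k" "l < d j" "x \<in> K" for j l x
      using \<open>K \<subseteq> N\<close> that N by blast
    show "K \<subseteq> M" if "closed_csubspace M" "range (single 0) \<subseteq> M"
      "\<And>j l x. j < k \<Longrightarrow> l < d j \<Longrightarrow> x \<in> M \<Longrightarrow> A' j l x \<in> M" for M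
      using that by (intro Kmin) (auto simp: inv_def)
  qed
qed

lemma wordop_invariant:
  assumes "\<And>j l x. j < k \<Longrightarrow> l < d j \<Longrightarrow> x \<in> K \<Longrightarrow> A j l x \<in> K"
  shows "set w \<subseteq> letters \<Longrightarrow> x \<in> K \<Longrightarrow> wordop A w x \<in> K"
  by (induction w) (auto simp: letters_def assms)

end

section \<open>Transfer of the dilation to sequences in \<open>H\<close> and its properties\<close>

theorem theorem4p8:
  fixes k :: nat
    and d :: "nat \<Rightarrow> nat"
    and u :: "nat \<Rightarrow> nat \<Rightarrow> (nat \<times> nat \<Rightarrow> nat \<times> nat \<Rightarrow> complex)"
    and T :: "nat \<Rightarrow> nat \<Rightarrow> 'h::{complex_inner_space, complete_space} \<Rightarrow> 'h"
  assumes d_pos: "\<forall>i<k. 1 \<le> d i"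
    and u_unitary: "\<forall>i<k. \<forall>j<k. unitary_mat (d i) (d j) (u i j)"
    and t_id: "\<forall>i<k. \<forall>v. supp2 (d i) (d i) v \<longrightarrow> tmap (u i i) (d i) (d i) v = v"
    and t_inv: "\<forall>i<k. \<forall>j<k. \<forall>v. supp2 (d i) (d j) v \<longrightarrow>
                   tmap (u j i) (d j) (d i) (tmap (u i j) (d i) (d j) v) = v"
    and t_assoc: "\<forall>i<k. \<forall>j<k. \<forall>l<k. \<forall>w. supp3 (d l) (d j) (d i) w \<longrightarrow>
                   tensI (tmap (u j i) (d j) (d i)) (Itens (tmap (u l i) (d l) (d i))
                      (tensI (tmap (u l j) (d l) (d j)) w))
                 = Itens (tmap (u l j) (d l) (d j)) (tensI (tmap (u l i) (d l) (d i))
                      (Itens (tmap (u j i) (d j) (d i)) w))"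
    and T_rc: "\<forall>i<k. row_contraction Hsp (d i) (T i)"
    and T_dc: "\<forall>i<k. \<forall>j<k. i \<noteq> j \<longrightarrow> doubly_commute Hsp (u i j) (d i) (d j) (T i) (T j)"
  shows "\<exists>(K :: (nat \<Rightarrow> 'h) set) (V :: nat \<Rightarrow> nat \<Rightarrow> (nat \<Rightarrow> 'h) \<Rightarrow> (nat \<Rightarrow> 'h)).
           closed_l2_subspace K \<and> range emb \<subseteq> K
         \<and> (\<forall>i<k. row_isometry (Ksp K) (d i) (V i))
         \<and> (\<forall>i<k. \<forall>j<k. i \<noteq> j \<longrightarrow> doubly_commute (Ksp K) (u i j) (d i) (d j) (V i) (V j))
         \<and> (\<forall>i<k. \<forall>l<d i. \<forall>h. adj (Ksp K) (V i l) (emb h) \<in> range emb)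
         \<and> (\<forall>(n :: nat \<Rightarrow> int) \<alpha> \<beta> h.
              valid_word k d (\<lambda>i. nat (n i)) \<alpha> \<longrightarrow> valid_word k d (\<lambda>i. nat (- n i)) \<beta> \<longrightarrow>
              adj (Ksp K) (wordop V (flat_word k \<beta>)) (wordop V (flat_word k \<alpha>) (emb h)) 0
                = adj Hsp (wordop T (flat_word k \<beta>)) (wordop T (flat_word k \<alpha>) h))
         \<and> (\<forall>M. closed_l2_subspace M \<and> M \<subseteq> K \<and> range emb \<subseteq> M
                 \<and> (\<forall>i<k. \<forall>l<d i. V i l ` M \<subseteq> M) \<longrightarrow> K \<subseteq> M)"
proof -
  interpret twist k d u
  proof
    show "1 \<le> d i" if "i < k" for i using d_pos that by simp
    show "unitary_mat (d i) (d j) (u i j)" if "i < k" "j < k" for i j using u_unitary that by simp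
    show "u j i (l, p) (m, q) = cnj (u i j (q, m) (p, l))"
      if "i < k" "j < k" "l < d j" "p < d i" "m < d j" "q < d i" for i j l p m q
      using that t_inv u_unitary by (intro flip_of_tmap_inverse[of "d i" "d j"]) auto
    \<comment> \<open>In the associativity condition, \<open>j\<close> takes the place of
      \<open>l\<close> and \<open>j'\<close> that of \<open>j\<close>.\<close>
    show "yang_baxter (d i) (d j) (d j') (u j i) (u j' i) (u j j')" if "i < k" "j < k" "j' < k" for i j j'
      using that t_assoc by (intro yang_baxter_of_tmap) auto
  qed
  define B where "B i l = (SOME b. is_adj (T i l) b)" for i l
  have adjT: "is_adj (T i l) (B i l)" if "i < k" "l < d i" for i l
  proof -
    have b: "bop Hsp (T i l)" using T_rc that by (simp add: row_contraction_def)
    then have "clinear (T i l)" by (simp add: bop_def Hsp_def clinear_def)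
    moreover obtain c where "\<And>x. norm (T i l x) \<le> c * norm x"
      using b by (auto simp: bop_def Hsp_def ipnorm_def Re_cinner_self)
    ultimately have "\<exists>b. is_adj (T i l) b" by (rule adjoint_exists)
    then show ?thesis unfolding B_def by (rule someI_ex)
  qed
  note aT = adj_Hsp[OF adjT]
  have sys: "dc_system T B"
    unfolding dc_system_def
  proof (intro conjI allI impI)
    show "is_adj (T j l) (B j l)" if "j < k" "l < d j" for j l using adjT[OF that] .
    show "row_contractive (d j) (T j)" if j: "j < k" for j
    proof (subst row_contractive_iff_adjoint[OF adjT[OF j]], assumption, intro allI)
      fix y
      have "positive_op Hsp (\<lambda>x. x - (\<Sum>l<d j. T j l (adj Hsp (T j l) x)))"
        using T_rc j by (simp add: row_contraction_def)
      then have "0 \<le> Re (cinner y (y - (\<Sum>l<d j. T j l (adj Hsp (T j l) y))))"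
        by (simp add: positive_op_def Hsp_def)
      also have "(\<Sum>l<d j. T j l (adj Hsp (T j l) y)) = (\<Sum>l<d j. T j l (B j l y))"
        by (simp add: aT j)
      also have "Re (cinner y (y - (\<Sum>l<d j. T j l (B j l y)))) = (norm y)\<^sup>2 - (\<Sum>l<d j. (norm (B j l y))\<^sup>2)"
        by (simp add: cinner.diff_right cinner.sum_right is_adjD[OF is_adj_sym[OF adjT[OF j]], symmetric] Re_cinner_self)
      finally show "(\<Sum>l<d j. (norm (B j l y))\<^sup>2) \<le> (norm y)\<^sup>2" by simp
    qed
    fix i j assume i: "i < k" and j: "j < k" and ij: "i \<noteq> j"
    show "twisted_commute (d i) (d j) (u i j) (T i) (T j)"
      using T_dc i j ij by (simp add: doubly_commute_def twisted_commute_def Hsp_def)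
    show "twisted_commute (d i) (d j) (partial_adj (u i j)) (B i) (T j)"
      unfolding twisted_commute_def
    proof (intro allI impI)
      fix r q x assume r: "r < d i" and q: "q < d j"
      \<comment> \<open>Condition (b) of the pair \<open>(T j, T i)\<close>; \<open>flip\<close>
        then turns \<open>u j i\<close> into \<open>partial_adj (u i j)\<close>.\<close>
      have "adj Hsp (T i r) (T j q x) = (\<Sum>p<d j. \<Sum>l<d i. scaleC (u j i (q, l) (p, r)) (T j p (adj Hsp (T i l) x)))"
        using T_dc i j ij r q by (simp add: doubly_commute_def Hsp_def)
      then have "B i r (T j q x) = (\<Sum>p<d j. \<Sum>l<d i. scaleC (u j i (q, l) (p, r)) (T j p (B i l x)))"
        using r i by (simp add: aT)
      also have "\<dots> = (\<Sum>l<d i. \<Sum>p<d j. scaleC (u j i (q, l) (p, r)) (T j p (B i l x)))"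
        by (rule sum.swap)
      finally show "B i r (T j q x) = (\<Sum>l<d i. \<Sum>p<d j. scaleC (partial_adj (u i j) (r, q) (l, p)) (T j p (B i l x)))"
        using r q by (simp add: flip[OF i j])
    qed
  qed
  obtain A' B' :: "nat \<Rightarrow> nat \<Rightarrow> 'h ell2 \<Rightarrow> 'h ell2" where sys': "dc_system A' B'"
    and iso: "\<And>j. j < k \<Longrightarrow> row_isometric (d j) (A' j)"
    and B': "\<And>j l h. j < k \<Longrightarrow> l < d j \<Longrightarrow> B' j l (single 0 h) = single 0 (B j l h)"
    using dilate_rows[OF sys order_refl] by auto
  note adjA = dc_systemD(1)[OF sys']
  obtain K where K: "closed_csubspace K" and KH: "range (single 0) \<subseteq> K"
    and KA: "\<And>j l x. j < k \<Longrightarrow> l < d j \<Longrightarrow> x \<in> K \<Longrightarrow> A' j l x \<in> K"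
    and KB: "\<And>j l x. j < k \<Longrightarrow> l < d j \<Longrightarrow> x \<in> K \<Longrightarrow> B' j l x \<in> K"
    and Kmin: "\<And>M. closed_csubspace M \<Longrightarrow> range (single 0) \<subseteq> M \<Longrightarrow>
       (\<And>j l x. j < k \<Longrightarrow> l < d j \<Longrightarrow> x \<in> M \<Longrightarrow> A' j l x \<in> M) \<Longrightarrow> K \<subseteq> M"
    using reducing_subspace[OF sys' iso B'] by blast
  \<comment> \<open>The operators are moved from the type to functions; everything demanded of
    \<open>V\<close> concerns elements of the subspace, which are square-summable.\<close>
  define V where "V i l f = coord (A' i l (Abs_ell2 f))" for i l f
  have V: "V i l (coord x) = coord (A' i l x)" for i l x by (simp add: V_def coord_inverse)
  have linA: "clinear (A' i l)" if "i < k" "l < d i" for i l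
    using adjA[OF that] by (rule is_adj_clinear)
  have adjV: "adj (Ksp (coord ` K)) (V i l) (coord y) = coord (B' i l y)" if "i < k" "l < d i" "y \<in> K" for i l y
    by (rule adj_Ksp[OF K adjA[OF that(1,2)] KB[OF that(1,2)] V that(3)])
  have isoA: "cinner (A' i l x) (A' i l y) = cinner x y" if "i < k" "l < d i" for i l x y
    using row_isometric_adjoint[OF iso[OF that(1)] adjA[OF that(1)] that(2,2)] by (simp add: is_adjD[OF adjA[OF that]])
  have bopV: "bop (Ksp (coord ` K)) (V i l)" if "i < k" "l < d i" for i l
    unfolding bop_def
  proof (intro conjI ballI allI exI[of _ 1])
    fix f assume "f \<in> car (Ksp (coord ` K))"
    then obtain x where x: "x \<in> K" "f = coord x" by (auto simp: Ksp_def)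
    show "V i l f \<in> car (Ksp (coord ` K))" using x that by (simp add: V Ksp_def KA)
    show "ipnorm (Ksp (coord ` K)) (V i l f) \<le> 1 * ipnorm (Ksp (coord ` K)) f"
      using x that by (simp add: V ipnorm_def Ksp_def l2ip_coord isoA)
    show "V i l (sc (Ksp (coord ` K)) c f) = sc (Ksp (coord ` K)) c (V i l f)" for c
      using x that by (simp add: V Ksp_def l2sc_coord clinear_scaleC linA)
    fix g assume "g \<in> car (Ksp (coord ` K))"
    then obtain y where y: "y \<in> K" "g = coord y" by (auto simp: Ksp_def)
    show "V i l (f + g) = V i l f + V i l g"
      using x y that by (simp add: V coord_plus_fun clinear_add linA)
  qed
  have row: "row_isometry (Ksp (coord ` K)) (d i) (V i)" if i: "i < k" for i
    unfolding row_isometry_def row_contraction_def positive_op_def isometry_def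
  proof (intro conjI allI impI ballI bopV[OF i])
    fix f assume "f \<in> car (Ksp (coord ` K))"
    then obtain x where x: "x \<in> K" "f = coord x" by (auto simp: Ksp_def)
    have "f - (\<Sum>l<d i. V i l (adj (Ksp (coord ` K)) (V i l) f)) = coord (x - (\<Sum>l<d i. A' i l (B' i l x)))"
      using x i by (simp add: adjV V coord_sum_fun coord_minus_fun)
    then have "ip (Ksp (coord ` K)) f (f - (\<Sum>l<d i. V i l (adj (Ksp (coord ` K)) (V i l) f)))
        = cinner x (x - (\<Sum>l<d i. A' i l (B' i l x)))"
      using x by (simp add: Ksp_def l2ip_coord)
    also have "\<dots> = complex_of_real ((norm x)\<^sup>2 - (\<Sum>l<d i. (norm (B' i l x))\<^sup>2))"
      by (simp add: cinner.diff_right cinner.sum_right is_adjD[OF is_adj_sym[OF adjA[OF i]], symmetric] cinner_norm)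
    finally have e: "ip (Ksp (coord ` K)) f (f - (\<Sum>l<d i. V i l (adj (Ksp (coord ` K)) (V i l) f)))
        = complex_of_real ((norm x)\<^sup>2 - (\<Sum>l<d i. (norm (B' i l x))\<^sup>2))" .
    have "(\<Sum>l<d i. (norm (B' i l x))\<^sup>2) \<le> (norm x)\<^sup>2"
      using dc_systemD(2)[OF sys' i] row_contractive_iff_adjoint[of "d i" "A' i" "B' i", OF adjA[OF i]] by simp
    then show "Im (ip (Ksp (coord ` K)) f (f - (\<Sum>l<d i. V i l (adj (Ksp (coord ` K)) (V i l) f)))) = 0"
      "0 \<le> Re (ip (Ksp (coord ` K)) f (f - (\<Sum>l<d i. V i l (adj (Ksp (coord ` K)) (V i l) f))))"
      unfolding e by simp_all
    show "ip (Ksp (coord ` K)) (V i l f) (V i l f) = ip (Ksp (coord ` K)) f f" if "l < d i" for l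
      using x i that by (simp add: V Ksp_def l2ip_coord isoA)
  qed
  have dc: "doubly_commute (Ksp (coord ` K)) (u i j) (d i) (d j) (V i) (V j)"
    if i: "i < k" and j: "j < k" and ij: "i \<noteq> j" for i j
    unfolding doubly_commute_def
  proof (intro conjI allI impI ballI)
    fix q r f assume q: "q < d i" and r: "r < d j" and "f \<in> car (Ksp (coord ` K))"
    then obtain x where x: "x \<in> K" "f = coord x" by (auto simp: Ksp_def)
    show "V i q (V j r f) = (\<Sum>p<d i. \<Sum>l<d j. sc (Ksp (coord ` K)) (u i j (q, r) (p, l)) (V j l (V i p f)))"
      using twisted_commuteD[OF dc_systemD(3)[OF sys' i j ij] q r]
      by (simp add: x V Ksp_def l2sc_coord coord_sum_fun)
    have "B' j r (A' i q x) = (\<Sum>l<d j. \<Sum>p<d i. scaleC (u i j (q, l) (p, r)) (A' i p (B' j l x)))"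
      using twisted_commuteD[OF dc_systemD(4)[OF sys' j i ij[symmetric]] r q] r q by (simp add: flip[OF j i])
    also have "\<dots> = (\<Sum>p<d i. \<Sum>l<d j. scaleC (u i j (q, l) (p, r)) (A' i p (B' j l x)))"
      by (rule sum.swap)
    finally have "coord (B' j r (A' i q x)) = coord (\<Sum>p<d i. \<Sum>l<d j. scaleC (u i j (q, l) (p, r)) (A' i p (B' j l x)))"
      by (rule arg_cong)
    then show "adj (Ksp (coord ` K)) (V j r) (V i q f)
        = (\<Sum>p<d i. \<Sum>l<d j. sc (Ksp (coord ` K)) (u i j (q, l) (p, r)) (V i p (adj (Ksp (coord ` K)) (V j l) f)))"
      using x r q i j by (simp add: V adjV KA coord_sum_fun[symmetric] l2sc_coord[symmetric])
        (simp add: Ksp_def)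
  qed
  have word: "set (flat_word k \<gamma>) \<subseteq> letters" if "valid_word k d n \<gamma>" for n \<gamma>
    using that by (auto simp: flat_word_def valid_word_def letters_def)
  \<comment> \<open>A row occurs in a word only if its exponent is positive, and \<open>n i\<close>
    and \<open>- n i\<close> are not both positive; hence the two words share no row.\<close>
  have index: "0 < n i" if valid: "valid_word k d n \<gamma>" and i: "i \<in> fst ` set (flat_word k \<gamma>)" for n \<gamma> i
  proof -
    obtain l where "i < k" "l \<in> set (\<gamma> i)" using i by (auto simp: flat_word_def)
    then show ?thesis using valid length_pos_if_in_set[of l "\<gamma> i"] by (simp add: valid_word_def)
  qed
  have wordV: "wordop V w (coord x) = coord (wordop A' w x)" for w x
    by (induction w) (auto simp: V)
  \<comment> \<open>Both adjoints become words in the adjoint letters in reverse order, and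
    coordinate 0 is the projection onto \<open>H\<close>.\<close>
  have reg: "adj (Ksp (coord ` K)) (wordop V (flat_word k \<beta>)) (wordop V (flat_word k \<alpha>) (emb h)) 0
      = adj Hsp (wordop T (flat_word k \<beta>)) (wordop T (flat_word k \<alpha>) h)"
    if \<alpha>: "valid_word k d (\<lambda>i. nat (n i)) \<alpha>" and \<beta>: "valid_word k d (\<lambda>i. nat (- n i)) \<beta>" for n :: "nat \<Rightarrow> int" and \<alpha> \<beta> h
  proof -
    let ?a = "flat_word k \<alpha>" and ?b = "flat_word k \<beta>"
    have rb: "set (rev ?b) \<subseteq> letters" using word[OF \<beta>] by simp
    have "wordop A' ?a (single 0 h) \<in> K"
      by (rule wordop_invariant[of K A']) (use KA word[OF \<alpha>] KH in auto)
    moreover have "wordop B' (rev ?b) x \<in> K" if "x \<in> K" for x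
      by (rule wordop_invariant[of K B']) (use KB rb that in auto)
    ultimately have 1: "adj (Ksp (coord ` K)) (wordop V ?b) (coord (wordop A' ?a (single 0 h)))
        = coord (wordop B' (rev ?b) (wordop A' ?a (single 0 h)))"
      using adj_Ksp[OF K is_adj_wordop[where A = A' and B = B', OF adjA word[OF \<beta>]]] wordV by blast
    have disj: "fst ` set ?a \<inter> fst ` set ?b = {}"
    proof (intro equals0I, elim IntE)
      fix i assume "i \<in> fst ` set ?a" "i \<in> fst ` set ?b"
      from index[OF \<alpha> this(1)] index[OF \<beta> this(2)] show False by simp
    qed
    have "coord (wordop B' (rev ?b) (wordop A' ?a (single 0 h))) 0 = wordop B (rev ?b) (wordop T ?a h)"
      by (rule regular_dilation[OF sys sys' _ word[OF \<alpha>] word[OF \<beta>] disj]) (rule B')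
    then show ?thesis
      by (simp add: emb_coord wordV 1 adj_Hsp[OF is_adj_wordop[where A = T and B = B, OF adjT word[OF \<beta>]]])
  qed
  have min: "coord ` K \<subseteq> M" if M: "closed_l2_subspace M" "range emb \<subseteq> M" "\<forall>i<k. \<forall>l<d i. V i l ` M \<subseteq> M" for M
  proof -
    have "K \<subseteq> {x. coord x \<in> M}"
    proof (rule Kmin[OF closed_csubspace_coord[OF M(1)]])
      show "range (single 0) \<subseteq> {x. coord x \<in> M}" using M(2) by (auto simp: emb_coord)
      show "A' j l x \<in> {x. coord x \<in> M}" if "j < k" "l < d j" "x \<in> {x. coord x \<in> M}" for j l x
        using M(3) that V[of j l x] by (metis image_subset_iff mem_Collect_eq)
    qed
    then show ?thesis by blast
  qed
  show ?thesis
  proof (intro exI[of _ "coord ` K"] exI[of _ V] conjI allI impI)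
    show "closed_l2_subspace (coord ` K)" by (rule closed_l2_subspace_coord[OF K])
    show "range emb \<subseteq> coord ` K" using KH by (auto simp: emb_coord)
    show "row_isometry (Ksp (coord ` K)) (d i) (V i)" if "i < k" for i by (rule row[OF that])
    show "doubly_commute (Ksp (coord ` K)) (u i j) (d i) (d j) (V i) (V j)" if "i < k" "j < k" "i \<noteq> j" for i j
      by (rule dc[OF that])
    show "adj (Ksp (coord ` K)) (V i l) (emb h) \<in> range emb" if "i < k" "l < d i" for i l h
    proof -
      have "single 0 h \<in> K" using KH by blast
      then have "adj (Ksp (coord ` K)) (V i l) (emb h) = emb (B i l h)"
        using that by (simp add: emb_coord adjV B')
      then show ?thesis by blast
    qed
    show "adj (Ksp (coord ` K)) (wordop V (flat_word k \<beta>)) (wordop V (flat_word k \<alpha>) (emb h)) 0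
        = adj Hsp (wordop T (flat_word k \<beta>)) (wordop T (flat_word k \<alpha>) h)"
      if "valid_word k d (\<lambda>i. nat (n i)) \<alpha>" "valid_word k d (\<lambda>i. nat (- n i)) \<beta>" for n :: "nat \<Rightarrow> int" and \<alpha> \<beta> h
      by (rule reg[OF that])
    show "coord ` K \<subseteq> M" if "closed_l2_subspace M \<and> M \<subseteq> coord ` K \<and> range emb \<subseteq> M \<and> (\<forall>i<k. \<forall>l<d i. V i l ` M \<subseteq> M)" for M
      using that min by blast
  qed
qed

end
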